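(* Let $S$ be a monoid, let $H$ be an $\mathscr{H}$-class of $S$ with Schützenberger group $\mathcal{G}$, and let $R$ be the $\mathscr{R}$-class of $S$ that contains $H$. Let $s\in S$ be any element of the right multiplicative pointwise stabilizer of $H$, i.e. $xs=x$ for all $x\in H$, and let $R_s$ denote the $\mathscr{R}$-class of $s$. Suppose that (a) $R$ contains only finitely many $\mathscr{H}$-classes; and (b) under the left action $*$ of $S$ on its set $S/\mathscr{R}$ of $\mathscr{R}$-classes, the intersection of the orbit $\{t*R_s : t\in S\}$ of $R_s$ with the inverse orbit $\{R'\in S/\mathscr{R} : t*R'=R \text{ for some } t\in S\}$ of $R$ is finite. Then: (i) if $S$ is finitely presented then $\mathcal{G}$ is finitely presented; (ii) if $S$ has finite derivation type then $\mathcal{G}$ has finite derivation type.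
   Context: Green's relations on a monoid $S$: $x\mathscr{R}y$ iff $xS=yS$; $x\mathscr{L}y$ iff $Sx=Sy$; $\mathscr{H}=\mathscr{R}\cap\mathscr{L}$. The left action of $S$ on $S/\mathscr{R}$ is given by $t*R'=R''$ iff $tR'\subseteq R''$ (well defined since $\mathscr{R}$ is a left congruence). The (right) Schützenberger group of an $\mathscr{H}$-class $H$ is $\mathrm{Stab}(H)/\sigma$, where $\mathrm{Stab}(H)=\{s\in S: Hs=H\}$ and $(s,t)\in\sigma$ iff $xs=xt$ for all $x\in H$; it is a group. A monoid presentation $\mathcal{P}=\langle A\mid\mathfrak{R}\rangle$ consists of a set $A$ and $\mathfrak{R}\subseteq A^*\times A^*$; it defines the monoid $A^*/{\leftrightarrow^*_{\mathfrak R}}$, the quotient of the free monoid by the congruence generated by $\mathfrak{R}$. A monoid is finitely presented if it is defined by a presentation with $A,\mathfrak{R}$ finite. The derivation graph $\Gamma(\mathcal{P})$ has vertex set $A^*$ and edges $\mathbb{E}=(\alpha,r,\epsilon,\beta)$ with $\alpha,\beta\in A^*$, $r=(r_{+1},r_{-1})\in\mathfrak{R}$, $\epsilon=\pm1$, where $\iota\mathbb{E}=\alpha r_\epsilon\beta$, $\tau\mathbb{E}=\alpha r_{-\epsilon}\beta$, $\mathbb{E}^{-1}=(\alpha,r,-\epsilon,\beta)$. Paths are composed with $\circ$ (empty paths allowed). $A^*$ acts on both sides: $\gamma\cdot\mathbb{E}\cdot\delta=(\gamma\alpha,r,\epsilon,\beta\delta)$, extended to paths. The Squier complex $\mathcal{D}(\mathcal{P})$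 is the 2-complex with 1-skeleton $\Gamma(\mathcal{P})$ and defining closed paths $[\mathbb{E}_1,\mathbb{E}_2]=(\mathbb{E}_1\cdot\iota\mathbb{E}_2)\circ(\tau\mathbb{E}_1\cdot\mathbb{E}_2)\circ(\mathbb{E}_1^{-1}\cdot\tau\mathbb{E}_2)\circ(\iota\mathbb{E}_1\cdot\mathbb{E}_2^{-1})$ for all edges $\mathbb{E}_1,\mathbb{E}_2$. In a 2-complex, two paths are homotopic if one is obtained from the other by finitely many moves: insert/delete a subpath $e\circ e^{-1}$; replace a subpath $p$ by $q$ if $p\circ q^{-1}$ is a cyclic permutation of a defining path or the inverse of one. A set $X$ of closed paths in $\mathcal{D}(\mathcal{P})$ is a homotopy base if, after adjoining all $\alpha\cdot\mathbb{P}\cdot\beta$ ($\alpha,\beta\in A^*$, $\mathbb{P}\in X$) as further defining paths, every closed path is homotopic to an empty path. A presentation has finite derivation type (FDT) if its Squier complex has a finite homotopy base; a monoid has FDT if it is defined by a finite presentation having FDT (for finite presentations this is independent of the choice of presentation). A group is finitely presented, or has FDT, when it is so as a monoid. *)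

theory Defs
  imports "HOL-Algebra.Coset" "Graph_Theory.Arc_Walk"
begin

section \<open>Green's relations and Schutzenberger groups\<close>

definition green_R :: "('a, 'm) monoid_scheme \<Rightarrow> ('a \<times> 'a) set" where
  "green_R S = {(x, y). x \<in> carrier S \<and> y \<in> carrier S \<and>
      x <#\<^bsub>S\<^esub> carrier S = y <#\<^bsub>S\<^esub> carrier S}"

definition green_L :: "('a, 'm) monoid_scheme \<Rightarrow> ('a \<times> 'a) set" where
  "green_L S = {(x, y). x \<in> carrier S \<and> y \<in> carrier S \<and>
      carrier S #>\<^bsub>S\<^esub> x = carrier S #>\<^bsub>S\<^esub> y}"

definition green_H :: "('a, 'm) monoid_scheme \<Rightarrow> ('a \<times> 'a) set" where
  "green_H S = green_R S \<inter> green_L S"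

lemma equiv_green_R: "equiv (carrier S) (green_R S)"
  by (rule equivI) (auto simp: green_R_def refl_on_def sym_def trans_def)

lemma equiv_green_L: "equiv (carrier S) (green_L S)"
  by (rule equivI) (auto simp: green_L_def refl_on_def sym_def trans_def)

lemma equiv_green_H: "equiv (carrier S) (green_H S)"
  using equiv_green_R[of S] equiv_green_L[of S] unfolding green_H_def equiv_def refl_on_def sym_def trans_def
  by blast

definition R_act :: "('a, 'm) monoid_scheme \<Rightarrow> 'a \<Rightarrow> 'a set \<Rightarrow> 'a set" where
  "R_act S t R' = (THE R''. R'' \<in> carrier S // green_R S \<and> t <#\<^bsub>S\<^esub> R' \<subseteq> R'')"

lemma green_R_left_congruence:
  assumes "monoid S" "(x, y) \<in> green_R S" "t \<in> carrier S"
  shows "(t \<otimes>\<^bsub>S\<^esub> x, t \<otimes>\<^bsub>S\<^esub> y) \<in> green_R S"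
proof -
  interpret monoid S by fact
  have xy: "x \<in> carrier S" "y \<in> carrier S" "x <#\<^bsub>S\<^esub> carrier S = y <#\<^bsub>S\<^esub> carrier S"
    using assms(2) by (auto simp: green_R_def)
  have *: "(t \<otimes>\<^bsub>S\<^esub> z) <#\<^bsub>S\<^esub> carrier S = t <#\<^bsub>S\<^esub> (z <#\<^bsub>S\<^esub> carrier S)" if "z \<in> carrier S" for z
    using m_assoc[OF assms(3) that] unfolding l_coset_def by auto
  show ?thesis using xy assms(3) by (auto simp: green_R_def *)
qed

lemma R_act_class:
  assumes "monoid S" "x \<in> carrier S" "t \<in> carrier S"
  shows "R_act S t (green_R S `` {x}) = green_R S `` {t \<otimes>\<^bsub>S\<^esub> x}"
proof -
  interpret monoid S by fact
  have sub: "t <#\<^bsub>S\<^esub> (green_R S `` {x}) \<subseteq> green_R S `` {t \<otimes>\<^bsub>S\<^esub> x}"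
    using green_R_left_congruence[OF assms(1) _ assms(3)] by (auto simp: l_coset_def)
  have refl: "x \<in> green_R S `` {x}"
    using assms(2) by (simp add: green_R_def)
  show ?thesis
    unfolding R_act_def
  proof (rule the_equality, intro conjI sub)
    show "green_R S `` {t \<otimes>\<^bsub>S\<^esub> x} \<in> carrier S // green_R S"
      using assms(2,3) by (simp add: quotientI)
  next
    fix C assume C: "C \<in> carrier S // green_R S \<and> t <#\<^bsub>S\<^esub> (green_R S `` {x}) \<subseteq> C"
    then have "t \<otimes>\<^bsub>S\<^esub> x \<in> C" using refl by (auto simp: l_coset_def)
    moreover have "t \<otimes>\<^bsub>S\<^esub> x \<in> green_R S `` {t \<otimes>\<^bsub>S\<^esub> x}"
      using assms(2,3) by (simp add: green_R_def)
    ultimately show "C = green_R S `` {t \<otimes>\<^bsub>S\<^esub> x}"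
      using quotient_disj[OF equiv_green_R, of C S "green_R S `` {t \<otimes>\<^bsub>S\<^esub> x}"] C
        quotientI[of "t \<otimes>\<^bsub>S\<^esub> x" "carrier S" "green_R S"] assms(2,3) by blast
  qed
qed

definition quotient_monoid ::
    "('a, 'm) monoid_scheme \<Rightarrow> ('a \<times> 'a) set \<Rightarrow> 'a set monoid" where
  "quotient_monoid M \<rho> =
     \<lparr>carrier = carrier M // \<rho>,
      mult = (\<lambda>U V. \<rho> `` (U <#>\<^bsub>M\<^esub> V)),
      one = \<rho> `` {\<one>\<^bsub>M\<^esub>}\<rparr>"

definition right_stab :: "('a, 'm) monoid_scheme \<Rightarrow> 'a set \<Rightarrow> 'a set" where
  "right_stab S H = {s \<in> carrier S. H #>\<^bsub>S\<^esub> s = H}"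

definition stab_cong :: "('a, 'm) monoid_scheme \<Rightarrow> 'a set \<Rightarrow> ('a \<times> 'a) set" where
  "stab_cong S H = {(s, t). s \<in> right_stab S H \<and> t \<in> right_stab S H \<and>
      (\<forall>x\<in>H. x \<otimes>\<^bsub>S\<^esub> s = x \<otimes>\<^bsub>S\<^esub> t)}"

definition schutzenberger_group :: "('a, 'm) monoid_scheme \<Rightarrow> 'a set \<Rightarrow> 'a set monoid" where
  "schutzenberger_group S H =
     quotient_monoid (S\<lparr>carrier := right_stab S H\<rparr>) (stab_cong S H)"

lemma (in monoid) r_coset_mult:
  assumes "M \<subseteq> carrier G" "g \<in> carrier G" "h \<in> carrier G"
  shows "M #> (g \<otimes> h) = (M #> g) #> h"
proof -
  have "x \<otimes> (g \<otimes> h) = x \<otimes> g \<otimes> h" if "x \<in> M" for x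
    using m_assoc[of x g h] that assms by auto
  then show ?thesis by (simp add: r_coset_def)
qed

lemma group_schutzenberger:
  assumes "monoid S" "H \<in> carrier S // green_H S"
  shows "group (schutzenberger_group S H)"
proof -
  interpret monoid S by fact
  let ?T = "right_stab S H" and ?c = "stab_cong S H"
  obtain h where h: "h \<in> carrier S" "H = green_H S `` {h}" using assms(2) by (auto elim: quotientE)
  have hH: "h \<in> H" using equiv_class_self[OF equiv_green_H h(1)] h(2) by simp
  have HS: "x \<in> carrier S" if "x \<in> H" for x
    using that h(2) unfolding green_H_def green_R_def by blast
  have T: "s \<in> carrier S" if "s \<in> ?T" for s using that by (simp add: right_stab_def)
  have TH: "x \<otimes>\<^bsub>S\<^esub> s \<in> H" if "s \<in> ?T" "x \<in> H" for s x
    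
    proof -
      have "x \<otimes>\<^bsub>S\<^esub> s \<in> H #>\<^bsub>S\<^esub> s" using that(2) unfolding r_coset_def by blast
      then show ?thesis using that(1) unfolding right_stab_def by blast
    qed
  have one: "\<one>\<^bsub>S\<^esub> \<in> ?T"
  proof -
    have "x \<otimes>\<^bsub>S\<^esub> \<one>\<^bsub>S\<^esub> = x" if "x \<in> H" for x using HS[OF that] by simp
    then show ?thesis by (simp add: right_stab_def r_coset_def)
  qed
  have mul: "s \<otimes>\<^bsub>S\<^esub> t \<in> ?T" if "s \<in> ?T" "t \<in> ?T" for s t
  proof -
    have "H #>\<^bsub>S\<^esub> (s \<otimes>\<^bsub>S\<^esub> t) = (H #>\<^bsub>S\<^esub> s) #>\<^bsub>S\<^esub> t"
      using HS T that by (intro r_coset_mult) auto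
    then show ?thesis using that by (simp add: right_stab_def)
  qed
  have inv: "\<exists>t\<in>?T. \<forall>x\<in>H. x \<otimes>\<^bsub>S\<^esub> (t \<otimes>\<^bsub>S\<^esub> s) = x" if s: "s \<in> ?T" for s
  proof -
    have "(h, h \<otimes>\<^bsub>S\<^esub> s) \<in> green_R S" using TH[OF s hH] h by (auto simp: green_H_def)
    then have "h \<in> (h \<otimes>\<^bsub>S\<^esub> s) <#\<^bsub>S\<^esub> carrier S"
    proof -
      have "h \<in> h <#\<^bsub>S\<^esub> carrier S" using h(1) unfolding l_coset_def by (intro UN_I[of "\<one>\<^bsub>S\<^esub>"]) auto
      then show ?thesis using \<open>(h, h \<otimes>\<^bsub>S\<^esub> s) \<in> green_R S\<close> unfolding green_R_def by blast
    qed
    then obtain t where t: "t \<in> carrier S" "h = h \<otimes>\<^bsub>S\<^esub> s \<otimes>\<^bsub>S\<^esub> t" by (auto simp: l_coset_def)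
    have st: "x \<otimes>\<^bsub>S\<^esub> s \<otimes>\<^bsub>S\<^esub> t = x" if x: "x \<in> H" for x
    proof -
      have "(h, x) \<in> green_L S" using x h by (auto simp: green_H_def)
      then have "x \<in> carrier S #>\<^bsub>S\<^esub> h" 
      proof -
        have "x \<in> carrier S #>\<^bsub>S\<^esub> x" using HS[OF x] unfolding r_coset_def by (intro UN_I[of "\<one>\<^bsub>S\<^esub>"]) auto
        then show ?thesis using \<open>(h, x) \<in> green_L S\<close> unfolding green_L_def by blast
      qed
      then obtain u where u: "u \<in> carrier S" "x = u \<otimes>\<^bsub>S\<^esub> h" by (auto simp: r_coset_def)
      have "x \<otimes>\<^bsub>S\<^esub> s \<otimes>\<^bsub>S\<^esub> t = u \<otimes>\<^bsub>S\<^esub> (h \<otimes>\<^bsub>S\<^esub> s \<otimes>\<^bsub>S\<^esub> t)" using u t(1) h(1) T[OF s] by (simp add: m_assoc)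
      then show ?thesis using t u by simp
    qed
    have ex: "\<exists>x\<in>H. y = x \<otimes>\<^bsub>S\<^esub> s" if "y \<in> H" for y
      using that s unfolding right_stab_def r_coset_def by blast
    have "H #>\<^bsub>S\<^esub> t = H"
    proof
      show "H #>\<^bsub>S\<^esub> t \<subseteq> H" 
      proof
        fix z assume "z \<in> H #>\<^bsub>S\<^esub> t"
        then obtain y where y: "y \<in> H" "z = y \<otimes>\<^bsub>S\<^esub> t" unfolding r_coset_def by blast
        obtain x where x: "x \<in> H" "y = x \<otimes>\<^bsub>S\<^esub> s" using ex[OF y(1)] by blast
        show "z \<in> H" using st[OF x(1)] x y by simp
      qed
      show "H \<subseteq> H #>\<^bsub>S\<^esub> t" 
      proof
        fix z assume z: "z \<in> H"
        have "z = (z \<otimes>\<^bsub>S\<^esub> s) \<otimes>\<^bsub>S\<^esub> t" using st[OF z] by simp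
        then show "z \<in> H #>\<^bsub>S\<^esub> t" using TH[OF s z] unfolding r_coset_def by blast
      qed
    qed
    then have "t \<in> ?T" using t by (simp add: right_stab_def)
    moreover have "x \<otimes>\<^bsub>S\<^esub> (t \<otimes>\<^bsub>S\<^esub> s) = x" if x: "x \<in> H" for x
    proof -
      obtain y where y: "y \<in> H" "x = y \<otimes>\<^bsub>S\<^esub> s" using ex x by blast
      have "x \<otimes>\<^bsub>S\<^esub> (t \<otimes>\<^bsub>S\<^esub> s) = x \<otimes>\<^bsub>S\<^esub> t \<otimes>\<^bsub>S\<^esub> s" using HS[OF x] t T[OF s] by (simp add: m_assoc)
      then show ?thesis using y st by simp
    qed
    ultimately show ?thesis by blast
  qed
  have eq: "equiv ?T ?c" by (auto simp: equiv_def refl_on_def sym_def trans_def stab_cong_def)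
  have cong: "(s \<otimes>\<^bsub>S\<^esub> t, s' \<otimes>\<^bsub>S\<^esub> t') \<in> ?c" if "(s, s') \<in> ?c" "(t, t') \<in> ?c" for s s' t t'
  proof -
    have st: "s \<in> ?T" "s' \<in> ?T" "t \<in> ?T" "t' \<in> ?T" using that by (auto simp: stab_cong_def)
    have "x \<otimes>\<^bsub>S\<^esub> (s \<otimes>\<^bsub>S\<^esub> t) = x \<otimes>\<^bsub>S\<^esub> (s' \<otimes>\<^bsub>S\<^esub> t')" if x: "x \<in> H" for x
    proof -
      have "x \<otimes>\<^bsub>S\<^esub> (s \<otimes>\<^bsub>S\<^esub> t) = (x \<otimes>\<^bsub>S\<^esub> s) \<otimes>\<^bsub>S\<^esub> t" using st HS[OF x] T by (simp add: m_assoc)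
      also have "\<dots> = (x \<otimes>\<^bsub>S\<^esub> s) \<otimes>\<^bsub>S\<^esub> t'"
        using TH[OF st(1) x] \<open>(t, t') \<in> ?c\<close> unfolding stab_cong_def by blast
      also have "x \<otimes>\<^bsub>S\<^esub> s = x \<otimes>\<^bsub>S\<^esub> s'"
        using x \<open>(s, s') \<in> ?c\<close> unfolding stab_cong_def by blast
      also have "(x \<otimes>\<^bsub>S\<^esub> s') \<otimes>\<^bsub>S\<^esub> t' = x \<otimes>\<^bsub>S\<^esub> (s' \<otimes>\<^bsub>S\<^esub> t')" using st HS[OF x] T by (simp add: m_assoc)
      finally show ?thesis .
    qed
    then show ?thesis using st mul unfolding stab_cong_def by blast
  qed
  let ?G = "schutzenberger_group S H"
  have car: "carrier ?G = ?T // ?c" by (simp add: schutzenberger_group_def quotient_monoid_def)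
  have cls: "(?c `` {s}) \<otimes>\<^bsub>?G\<^esub> (?c `` {t}) = ?c `` {s \<otimes>\<^bsub>S\<^esub> t}" if "s \<in> ?T" "t \<in> ?T" for s t
  proof -
    have "(s, s) \<in> ?c" "(t, t) \<in> ?c" using eq that by (auto simp: stab_cong_def)
    then have "?c `` ((?c `` {s}) <#>\<^bsub>S\<lparr>carrier := ?T\<rparr>\<^esub> (?c `` {t})) = ?c `` {s \<otimes>\<^bsub>S\<^esub> t}"
    proof (intro equalityI subsetI)
      fix z assume "z \<in> ?c `` ((?c `` {s}) <#>\<^bsub>S\<lparr>carrier := ?T\<rparr>\<^esub> (?c `` {t}))"
      then obtain s' t' where *: "(s, s') \<in> ?c" "(t, t') \<in> ?c" "(s' \<otimes>\<^bsub>S\<^esub> t', z) \<in> ?c"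
        by (auto simp: set_mult_def)
      have "(s \<otimes>\<^bsub>S\<^esub> t, z) \<in> ?c" using cong[OF *(1,2)] *(3) eq by (meson equivE transE)
      then show "z \<in> ?c `` {s \<otimes>\<^bsub>S\<^esub> t}" by simp
    next
      fix z assume "z \<in> ?c `` {s \<otimes>\<^bsub>S\<^esub> t}"
      then show "z \<in> ?c `` ((?c `` {s}) <#>\<^bsub>S\<lparr>carrier := ?T\<rparr>\<^esub> (?c `` {t}))"
        using \<open>(s, s) \<in> ?c\<close> \<open>(t, t) \<in> ?c\<close> unfolding set_mult_def by auto
    qed
    then show ?thesis by (simp add: schutzenberger_group_def quotient_monoid_def)
  qed
  have on: "\<one>\<^bsub>?G\<^esub> = ?c `` {\<one>\<^bsub>S\<^esub>}" by (simp add: schutzenberger_group_def quotient_monoid_def)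
  show ?thesis
  proof (rule groupI)
    show "\<one>\<^bsub>?G\<^esub> \<in> carrier ?G" using one by (simp add: car on quotientI)
  next
    fix x y assume "x \<in> carrier ?G" "y \<in> carrier ?G"
    then show "x \<otimes>\<^bsub>?G\<^esub> y \<in> carrier ?G"
      unfolding car by (auto elim!: quotientE simp: cls mul quotientI)
  next
    fix x y z assume "x \<in> carrier ?G" "y \<in> carrier ?G" "z \<in> carrier ?G"
    then show "x \<otimes>\<^bsub>?G\<^esub> y \<otimes>\<^bsub>?G\<^esub> z = x \<otimes>\<^bsub>?G\<^esub> (y \<otimes>\<^bsub>?G\<^esub> z)"
      unfolding car by (auto elim!: quotientE simp: cls mul m_assoc T)
  next
    fix x assume "x \<in> carrier ?G"
    then show "\<one>\<^bsub>?G\<^esub> \<otimes>\<^bsub>?G\<^esub> x = x"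
      unfolding car on by (auto elim!: quotientE simp: cls one T)
  next
    fix x assume "x \<in> carrier ?G"
    then obtain s where s: "s \<in> ?T" "x = ?c `` {s}" unfolding car by (auto elim: quotientE)
    obtain t where t: "t \<in> ?T" "\<forall>x\<in>H. x \<otimes>\<^bsub>S\<^esub> (t \<otimes>\<^bsub>S\<^esub> s) = x" using inv[OF s(1)] by blast
    have "(t \<otimes>\<^bsub>S\<^esub> s, \<one>\<^bsub>S\<^esub>) \<in> ?c" 
      using t(2) mul[OF t(1) s(1)] one HS unfolding stab_cong_def by simp
    then have "?c `` {t} \<otimes>\<^bsub>?G\<^esub> x = \<one>\<^bsub>?G\<^esub>"
      using cls[OF t(1) s(1)] s(2) on equiv_class_eq[OF eq] by simp
    then show "\<exists>y\<in>carrier ?G. y \<otimes>\<^bsub>?G\<^esub> x = \<one>\<^bsub>?G\<^esub>"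
      using t(1) by (auto simp: car quotientI)
  qed
qed

section \<open>Monoid presentations\<close>

record 'b presentation =
  letters :: "'b set"
  rels :: "('b list \<times> 'b list) set"

definition presentation :: "'b presentation \<Rightarrow> bool" where
  "presentation P \<longleftrightarrow> rels P \<subseteq> lists (letters P) \<times> lists (letters P)"

definition finite_presentation :: "'b presentation \<Rightarrow> bool" where
  "finite_presentation P \<longleftrightarrow> presentation P \<and> finite (letters P) \<and> finite (rels P)"

definition free_monoid :: "'b set \<Rightarrow> 'b list monoid" where
  "free_monoid A = \<lparr>carrier = lists A, mult = (@), one = []\<rparr>"

definition rewrite_step :: "'b presentation \<Rightarrow> ('b list \<times> 'b list) set" where
  "rewrite_step P = {(\<alpha> @ u @ \<beta>, \<alpha> @ v @ \<beta>) | \<alpha> u v \<beta>.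
      \<alpha> \<in> lists (letters P) \<and> \<beta> \<in> lists (letters P) \<and> (u, v) \<in> rels P}"

definition presentation_cong :: "'b presentation \<Rightarrow> ('b list \<times> 'b list) set" where
  "presentation_cong P =
     Restr ((rewrite_step P \<union> (rewrite_step P)\<inverse>)\<^sup>*) (lists (letters P))"

lemma rels_subset_presentation_cong:
  assumes "presentation P"
  shows "rels P \<subseteq> presentation_cong P"
proof
  fix z assume z: "z \<in> rels P"
  obtain u v where uv: "z = (u,v)" by (cases z)
  have "(u, v) \<in> rewrite_step P" unfolding rewrite_step_def mem_Collect_eq using z uv
    by (intro exI[of _ "[]"] exI[of _ u] exI[of _ v]) simp
  then show "z \<in> presentation_cong P" using z assms uv
    by (auto simp: presentation_cong_def presentation_def)
qed

lemma equiv_presentation_cong: "equiv (lists (letters P)) (presentation_cong P)"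
proof -
  have "sym ((rewrite_step P \<union> (rewrite_step P)\<inverse>)\<^sup>*)"
    by (intro sym_rtrancl) (auto simp: sym_def)
  moreover have "trans ((rewrite_step P \<union> (rewrite_step P)\<inverse>)\<^sup>*)" by (rule trans_rtrancl)
  ultimately show ?thesis
    unfolding equiv_def presentation_cong_def refl_on_def sym_def trans_def by blast
qed

definition presented_monoid :: "'b presentation \<Rightarrow> 'b list set monoid" where
  "presented_monoid P = quotient_monoid (free_monoid (letters P)) (presentation_cong P)"

definition presents :: "'b presentation \<Rightarrow> ('a, 'm) monoid_scheme \<Rightarrow> bool" where
  "presents P M \<longleftrightarrow> presentation P \<and> presented_monoid P \<cong> M"

text \<open>Every finite alphabet can be renamed into the natural numbers, so letters of type
  \<^typ>\<open>nat\<close> lose no generality here.\<close>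

definition finitely_presented :: "('a, 'm) monoid_scheme \<Rightarrow> bool" where
  "finitely_presented M \<longleftrightarrow> (\<exists>P :: nat presentation. finite_presentation P \<and> presents P M)"

section \<open>Homotopy of paths in 2-complexes\<close>

text \<open>A path from \<open>u\<close> to \<open>v\<close> is a list \<open>p\<close> of edges with \<open>awalk u p v\<close>; the empty path at \<open>u\<close>
  is \<open>[]\<close> seen as a walk from \<open>u\<close> to \<open>u\<close>. Defining paths are stored as bare edge lists: a nonempty
  one determines its base point, and an empty one only yields the trivial replacement of
  \<open>[]\<close> by \<open>[]\<close>.\<close>

record ('v, 'e) two_complex =
  skeleton :: "('v, 'e) pre_digraph"
  edge_inv :: "'e \<Rightarrow> 'e"
  cells :: "'e list set"

definition is_path :: "('v, 'e) two_complex \<Rightarrow> 'v \<Rightarrow> 'e list \<Rightarrow> 'v \<Rightarrow> bool" where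
  "is_path K u p v \<longleftrightarrow> pre_digraph.awalk (skeleton K) u p v"

definition path_inv :: "('v, 'e) two_complex \<Rightarrow> 'e list \<Rightarrow> 'e list" where
  "path_inv K p = rev (map (edge_inv K) p)"

definition replaceable :: "('v, 'e) two_complex \<Rightarrow> 'e list \<Rightarrow> 'e list \<Rightarrow> bool" where
  "replaceable K p q \<longleftrightarrow>
     (\<exists>e. p = [] \<and> q = [e, edge_inv K e]) \<or>
     (\<exists>e. p = [e, edge_inv K e] \<and> q = []) \<or>
     (\<exists>c\<in>cells K. \<exists>n. p @ path_inv K q = rotate n c \<or> p @ path_inv K q = rotate n (path_inv K c))"

definition homotopy_move ::
    "('v, 'e) two_complex \<Rightarrow> 'v \<Rightarrow> 'v \<Rightarrow> ('e list \<times> 'e list) set" where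
  "homotopy_move K u v = {(a @ p @ b, a @ q @ b) | a p q b.
      is_path K u (a @ p @ b) v \<and> is_path K u (a @ q @ b) v \<and> replaceable K p q}"

definition homotopic ::
    "('v, 'e) two_complex \<Rightarrow> 'v \<Rightarrow> 'v \<Rightarrow> 'e list \<Rightarrow> 'e list \<Rightarrow> bool" where
  "homotopic K u v p q \<longleftrightarrow>
     is_path K u p v \<and> is_path K u q v \<and> (p, q) \<in> (homotopy_move K u v)\<^sup>*"

section \<open>The Squier complex and finite derivation type\<close>

text \<open>In \<open>Edge \<alpha> r \<epsilon> \<beta>\<close> the sign \<open>\<epsilon>\<close> is \<open>True\<close> for $+1$ and \<open>False\<close> for $-1$;
  the pair \<open>r\<close> is $(r_{+1}, r_{-1})$.\<close>

datatype 'b edge =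
  Edge (left_context: "'b list") (relation: "'b list \<times> 'b list") (sign: bool)
    (right_context: "'b list")

fun rel_side :: "'b list \<times> 'b list \<Rightarrow> bool \<Rightarrow> 'b list" where
  "rel_side r True = fst r"
| "rel_side r False = snd r"

fun edge_src :: "'b edge \<Rightarrow> 'b list" where
  "edge_src (Edge \<alpha> r \<epsilon> \<beta>) = \<alpha> @ rel_side r \<epsilon> @ \<beta>"

fun edge_tgt :: "'b edge \<Rightarrow> 'b list" where
  "edge_tgt (Edge \<alpha> r \<epsilon> \<beta>) = \<alpha> @ rel_side r (\<not> \<epsilon>) @ \<beta>"

fun edge_rev :: "'b edge \<Rightarrow> 'b edge" where
  "edge_rev (Edge \<alpha> r \<epsilon> \<beta>) = Edge \<alpha> r (\<not> \<epsilon>) \<beta>"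

fun edge_act :: "'b list \<Rightarrow> 'b edge \<Rightarrow> 'b list \<Rightarrow> 'b edge" where
  "edge_act \<gamma> (Edge \<alpha> r \<epsilon> \<beta>) \<delta> = Edge (\<gamma> @ \<alpha>) r \<epsilon> (\<beta> @ \<delta>)"

definition path_act :: "'b list \<Rightarrow> 'b edge list \<Rightarrow> 'b list \<Rightarrow> 'b edge list" where
  "path_act \<gamma> p \<delta> = map (\<lambda>E. edge_act \<gamma> E \<delta>) p"

definition derivation_graph :: "'b presentation \<Rightarrow> ('b list, 'b edge) pre_digraph" where
  "derivation_graph P =
     \<lparr>verts = lists (letters P),
      arcs = {Edge \<alpha> r \<epsilon> \<beta> | \<alpha> r \<epsilon> \<beta>.
        \<alpha> \<in> lists (letters P) \<and> r \<in> rels P \<and> \<beta> \<in> lists (letters P)},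
      tail = edge_src,
      head = edge_tgt\<rparr>"

definition commuting_square :: "'b edge \<Rightarrow> 'b edge \<Rightarrow> 'b edge list" where
  "commuting_square E F =
     [edge_act [] E (edge_src F), edge_act (edge_tgt E) F [],
      edge_act [] (edge_rev E) (edge_tgt F), edge_act (edge_src E) (edge_rev F) []]"

definition squier_complex :: "'b presentation \<Rightarrow> ('b list, 'b edge) two_complex" where
  "squier_complex P =
     \<lparr>skeleton = derivation_graph P,
      edge_inv = edge_rev,
      cells = {commuting_square E F | E F.
        E \<in> arcs (derivation_graph P) \<and> F \<in> arcs (derivation_graph P)}\<rparr>"

lemma commuting_square_closed:
  assumes "presentation P" "E \<in> arcs (derivation_graph P)" "F \<in> arcs (derivation_graph P)"
  shows "is_path (squier_complex P) (edge_src E @ edge_src F) (commuting_square E F)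
           (edge_src E @ edge_src F)"
proof -
  obtain \<alpha> r \<epsilon> \<beta> where E: "E = Edge \<alpha> r \<epsilon> \<beta>" by (cases E)
  obtain \<gamma> q \<delta> \<zeta> where F: "F = Edge \<gamma> q \<delta> \<zeta>" by (cases F)
  have arc: "Edge a r' e b \<in> arcs (derivation_graph P) \<longleftrightarrow>
      a \<in> lists (letters P) \<and> r' \<in> rels P \<and> b \<in> lists (letters P)" for a r' e b
    by (cases r') (simp add: derivation_graph_def)
  have ht: "tail (derivation_graph P) = edge_src" "head (derivation_graph P) = edge_tgt"
    "verts (derivation_graph P) = lists (letters P)"
    by (simp_all add: derivation_graph_def)
  have side: "rel_side r' e \<in> lists (letters P)" if "r' \<in> rels P" for r' e
    using that assms(1) by (cases e) (auto simp: presentation_def)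
  show ?thesis
    using assms(2,3) side[of r] side[of q] unfolding E F
    by (simp add: is_path_def pre_digraph.awalk_def pre_digraph.cas.simps squier_complex_def
         commuting_square_def arc ht)
qed

definition adjoin_cells ::
    "'b presentation \<Rightarrow> 'b edge list set \<Rightarrow> ('b list, 'b edge) two_complex" where
  "adjoin_cells P X = (squier_complex P)
     \<lparr>cells := cells (squier_complex P) \<union>
       {path_act \<alpha> p \<beta> | \<alpha> p \<beta>. \<alpha> \<in> lists (letters P) \<and> p \<in> X \<and> \<beta> \<in> lists (letters P)}\<rparr>"

definition homotopy_base :: "'b presentation \<Rightarrow> 'b edge list set \<Rightarrow> bool" where
  "homotopy_base P X \<longleftrightarrow>
     (\<forall>p\<in>X. \<exists>u. is_path (squier_complex P) u p u) \<and>
     (\<forall>u p. is_path (squier_complex P) u p u \<longrightarrow> homotopic (adjoin_cells P X) u u p [])"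

definition presentation_FDT :: "'b presentation \<Rightarrow> bool" where
  "presentation_FDT P \<longleftrightarrow> (\<exists>X. finite X \<and> homotopy_base P X)"

definition monoid_FDT :: "('a, 'm) monoid_scheme \<Rightarrow> bool" where
  "monoid_FDT M \<longleftrightarrow>
     (\<exists>P :: nat presentation. finite_presentation P \<and> presents P M \<and> presentation_FDT P)"

end

theory Submission
  imports Defs "HOL-Library.Nat_Bijection"
begin

text \<open>
  Let \<open>T\<close> be the right stabilizer of \<open>H\<close>. Conditions (a) and (b) say that the set of vertices
  \<open>V = {y \<in> S s. \<alpha> y \<in> H for some \<alpha>}\<close> falls into finitely many classes under \<open>y T = y' T\<close>; in
  particular \<open>s\<close> may be replaced by a power with \<open>s s T = s T\<close>. A word whose product with \<open>s\<close>
  lies in \<open>H\<close> has all its suffixes in \<open>V\<close>, so reading it from the right traces a path through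
  the finite graph of classes, and each edge of this graph determines an element of \<open>T\<close>, hence
  of the Schutzenberger group. This group is presented by the edges and their formal inverses,
  with the relations of \<open>S\<close> read along paths and one relation for each class that identifies it
  with the class of \<open>s\<close>.

  For finite derivation type, homotopy is tested against labellings of the derivation edges in
  groups. Every word over the new generators is rewritten, letter by letter, to a chosen word
  representing an element of \<open>H\<close>, using derivations over \<open>S\<close> wherever possible. Finitely many
  closed paths, among them the readings of a homotopy base for \<open>S\<close>, make these rewritings natural
  along all relations; they then form a potential for every labelling, so all closed paths
  are null-homotopic.
\<close>

section \<open>Permutation groups\<close>

text \<open>A homotopy is a sequence of list rewritings and awkward to calculate with. A labelling
  turns paths into elements of a group, where naturality becomes an equation that can be rearranged.
  As a definition cannot range over all group types, one type has to suffice: permutations of sets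
  of paths, because a fundamental group acts faithfully on its own loop classes.

  \<open>T\<close> acts by right multiplication while letters multiply on the left; hence states are
  right \<open>T\<close>-orbits and words are read from the right. \<open>s\<close> need not be
  idempotent; passing to a power ensures that reading a word for \<open>s\<close> leads from
  \<open>s\<close> back to \<open>s\<close>, so that this word can be inserted as a null loop.

  The main obstacle is that a generator can follow infinitely many words leading into
  \<open>H\<close>, while only finitely many closed paths may be adjoined. \<open>om_step\<close>
  removes the dependence on the preceding word by comparing two returns to \<open>s\<close> from one
  vertex, one of them along an additional edge. \<open>common_factor\<close> provides a state
  through which both returns factor, and one closed path \<open>adj\<close> for each edge makes the
  comparison coherent.\<close>

typedef 'x sym_group = "{f :: 'x \<Rightarrow> 'x. bij f}"
  morphisms apply_sym Abs_sym
  by (rule exI[of _ id]) simp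

setup_lifting type_definition_sym_group

text \<open>The class \<open>group_add\<close> does not demand commutativity. Additive notation lets
  the label of a path be an ordinary \<open>sum_list\<close>, with the order of the summands
  significant.\<close>

instantiation sym_group :: (type) group_add
begin

lift_definition zero_sym_group :: "'a sym_group" is id by simp
lift_definition plus_sym_group :: "'a sym_group \<Rightarrow> 'a sym_group \<Rightarrow> 'a sym_group" is "(\<circ>)"
  by (simp add: bij_comp)
lift_definition uminus_sym_group :: "'a sym_group \<Rightarrow> 'a sym_group" is "inv_into UNIV"
  by (simp add: bij_imp_bij_inv)
definition minus_sym_group :: "'a sym_group \<Rightarrow> 'a sym_group \<Rightarrow> 'a sym_group" where
  "minus_sym_group a b = a + - b"

instance
proof
  fix a b c :: "'a sym_group"
  show "a + b + c = a + (b + c)" by transfer (simp add: comp_assoc)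
  show "0 + a = a" by transfer simp
  show "a + 0 = a" by transfer simp
  show "- a + a = 0" by transfer (simp add: bij_is_inj)
  show "a + - b = a - b" by (simp add: minus_sym_group_def)
qed

end

section \<open>Paths in the Squier complex\<close>

abbreviation dpath :: "'b presentation \<Rightarrow> 'b list \<Rightarrow> 'b edge list \<Rightarrow> 'b list \<Rightarrow> bool" where
  "dpath P \<equiv> is_path (squier_complex P)"

abbreviation words :: "'b presentation \<Rightarrow> 'b list set" where
  "words P \<equiv> lists (letters P)"

abbreviation dedges :: "'b presentation \<Rightarrow> 'b edge set" where
  "dedges P \<equiv> arcs (derivation_graph P)"

abbreviation dinv :: "'b edge list \<Rightarrow> 'b edge list" where
  "dinv p \<equiv> rev (map edge_rev p)"

lemma dedge_iff:
  "Edge \<alpha> r \<epsilon> \<beta> \<in> dedges P \<longleftrightarrow> \<alpha> \<in> words P \<and> r \<in> rels P \<and> \<beta> \<in> words P"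
  by (cases r) (simp add: derivation_graph_def)

lemma rel_side_words:
  assumes "presentation P" "r \<in> rels P"
  shows "rel_side r \<epsilon> \<in> words P"
  using assms by (cases \<epsilon>) (auto simp: presentation_def)

lemma edge_ends_words:
  assumes "presentation P" "E \<in> dedges P"
  shows "edge_src E \<in> words P" "edge_tgt E \<in> words P"
proof -
  obtain \<alpha> r \<epsilon> \<beta> where E: "E = Edge \<alpha> r \<epsilon> \<beta>" by (cases E)
  then show "edge_src E \<in> words P" "edge_tgt E \<in> words P"
    using assms rel_side_words[OF assms(1), of r] by (auto simp: dedge_iff)
qed

lemma edge_rev_rev [simp]: "edge_rev (edge_rev E) = E"
  by (cases E) simp

lemma edge_src_rev [simp]: "edge_src (edge_rev E) = edge_tgt E"
  by (cases E) simp

lemma edge_tgt_rev [simp]: "edge_tgt (edge_rev E) = edge_src E"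
  by (cases E) simp

lemma edge_rev_dedges [simp]: "edge_rev E \<in> dedges P \<longleftrightarrow> E \<in> dedges P"
  by (cases E) (simp add: dedge_iff)

lemma edge_act_src [simp]: "edge_src (edge_act \<alpha> E \<beta>) = \<alpha> @ edge_src E @ \<beta>"
  by (cases E) simp

lemma edge_act_tgt [simp]: "edge_tgt (edge_act \<alpha> E \<beta>) = \<alpha> @ edge_tgt E @ \<beta>"
  by (cases E) simp

lemma edge_act_rev: "edge_act \<alpha> (edge_rev E) \<beta> = edge_rev (edge_act \<alpha> E \<beta>)"
  by (cases E) simp

lemma edge_act_act [simp]: "edge_act \<alpha> (edge_act \<gamma> E \<delta>) \<beta> = edge_act (\<alpha> @ \<gamma>) E (\<delta> @ \<beta>)"
  by (cases E) simp

lemma edge_act_Nil [simp]: "edge_act [] E [] = E"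
  by (cases E) simp

lemma edge_act_dedges:
  "E \<in> dedges P \<Longrightarrow> \<alpha> \<in> words P \<Longrightarrow> \<beta> \<in> words P \<Longrightarrow> edge_act \<alpha> E \<beta> \<in> dedges P"
  by (cases E) (simp add: dedge_iff)

lemma commuting_square_act:
  "path_act \<alpha> (commuting_square E F) \<beta> = commuting_square (edge_act \<alpha> E []) (edge_act [] F \<beta>)"
  by (cases E; cases F) (simp add: commuting_square_def path_act_def)

lemma path_act_append [simp]: "path_act \<alpha> (p @ q) \<beta> = path_act \<alpha> p \<beta> @ path_act \<alpha> q \<beta>"
  by (simp add: path_act_def)

lemma path_act_Nil [simp]: "path_act \<alpha> [] \<beta> = []"
  by (simp add: path_act_def)

lemma path_act_Cons [simp]: "path_act \<alpha> (E # p) \<beta> = edge_act \<alpha> E \<beta> # path_act \<alpha> p \<beta>"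
  by (simp add: path_act_def)

lemma path_act_act [simp]: "path_act \<alpha> (path_act \<gamma> p \<delta>) \<beta> = path_act (\<alpha> @ \<gamma>) p (\<delta> @ \<beta>)"
  by (simp add: path_act_def)

lemma path_act_neutral [simp]: "path_act [] p [] = p"
  by (simp add: path_act_def map_idI)

lemma path_act_dinv: "path_act \<alpha> (dinv p) \<beta> = dinv (path_act \<alpha> p \<beta>)"
  by (simp add: path_act_def rev_map edge_act_rev)

lemma dpath_def:
  "dpath P u p v \<longleftrightarrow> u \<in> words P \<and> set p \<subseteq> dedges P \<and> pre_digraph.cas (derivation_graph P) u p v"
  by (simp add: is_path_def squier_complex_def pre_digraph.awalk_def derivation_graph_def)

lemma cas_derivation_graph [simp]:
  "pre_digraph.cas (derivation_graph P) u [] v \<longleftrightarrow> u = v"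
  "pre_digraph.cas (derivation_graph P) u (E # p) v \<longleftrightarrow>
     edge_src E = u \<and> pre_digraph.cas (derivation_graph P) (edge_tgt E) p v"
  by (simp_all add: pre_digraph.cas.simps derivation_graph_def)

lemma dpath_Nil [simp]: "dpath P u [] v \<longleftrightarrow> u = v \<and> u \<in> words P"
  by (auto simp: dpath_def)

lemma dpath_Cons:
  assumes "presentation P"
  shows "dpath P u (E # p) v \<longleftrightarrow> E \<in> dedges P \<and> edge_src E = u \<and> dpath P (edge_tgt E) p v"
  using edge_ends_words[OF assms] by (auto simp: dpath_def)

lemma dpath_append:
  assumes "presentation P"
  shows "dpath P u (p @ q) v \<longleftrightarrow> (\<exists>w. dpath P u p w \<and> dpath P w q v)"
proof (induction p arbitrary: u)
  case Nil
  then show ?case by (auto simp: dpath_def)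
next
  case (Cons E p)
  then show ?case using dpath_Cons[OF assms] by auto
qed

lemma dpath_appendI:
  assumes "presentation P" "dpath P u p w" "dpath P w q v"
  shows "dpath P u (p @ q) v"
  using assms dpath_append by blast

lemma dpath_single:
  assumes "presentation P" "E \<in> dedges P"
  shows "dpath P (edge_src E) [E] (edge_tgt E)"
  using dpath_Cons[OF assms(1)] assms edge_ends_words[OF assms] by simp

lemma dpath_ends:
  assumes "presentation P" "dpath P u p v"
  shows "u \<in> words P" "v \<in> words P"
proof -
  show "u \<in> words P" using assms(2) by (simp add: dpath_def)
  show "v \<in> words P" using assms(2)
  proof (induction p arbitrary: u)
    case (Cons E p)
    then show ?case using dpath_Cons[OF assms(1)] by blast
  qed simp
qed

lemma dpath_dinv:
  assumes "presentation P" "dpath P u p v"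
  shows "dpath P v (dinv p) u"
  using assms(2)
proof (induction p arbitrary: u)
  case (Cons E p)
  then have E: "E \<in> dedges P" "edge_src E = u" "dpath P (edge_tgt E) p v"
    using dpath_Cons[OF assms(1)] by auto
  have "dpath P (edge_tgt E) [edge_rev E] u"
    using dpath_single[OF assms(1), of "edge_rev E"] E by simp
  then show ?case using Cons.IH[OF E(3)] dpath_appendI[OF assms(1)] by simp
qed simp

lemma dpath_act:
  assumes "presentation P" "dpath P u p v" "\<alpha> \<in> words P" "\<beta> \<in> words P"
  shows "dpath P (\<alpha> @ u @ \<beta>) (path_act \<alpha> p \<beta>) (\<alpha> @ v @ \<beta>)"
  using assms(2)
proof (induction p arbitrary: u)
  case Nil
  then show ?case using assms(3,4) by auto
next
  case (Cons E p)
  then show ?case using edge_act_dedges[OF _ assms(3,4)] by (simp add: dpath_Cons[OF assms(1)])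
qed

lemma path_presentation_cong:
  assumes "presentation P"
  shows "(u, v) \<in> presentation_cong P \<longleftrightarrow> (\<exists>p. dpath P u p v)"
proof -
  let ?s = "rewrite_step P \<union> (rewrite_step P)\<inverse>"
  have fwd: "\<exists>E\<in>dedges P. edge_src E = x \<and> edge_tgt E = y" if xy: "(x, y) \<in> rewrite_step P" for x y
  proof -
    obtain \<alpha> a b \<beta> where *: "x = \<alpha> @ a @ \<beta>" "y = \<alpha> @ b @ \<beta>" "\<alpha> \<in> words P" "\<beta> \<in> words P"
      "(a, b) \<in> rels P" using xy unfolding rewrite_step_def by blast
    then have "Edge \<alpha> (a, b) True \<beta> \<in> dedges P" by (simp add: dedge_iff)
    then show ?thesis using * by (intro bexI[of _ "Edge \<alpha> (a, b) True \<beta>"]) simp_all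
  qed
  have edge_ex: "\<exists>E\<in>dedges P. edge_src E = x \<and> edge_tgt E = y" if xy: "(x, y) \<in> ?s" for x y
  proof (cases "(x, y) \<in> rewrite_step P")
    case False
    then have "(y, x) \<in> rewrite_step P" using xy by simp
    then obtain E where "E \<in> dedges P" "edge_src E = y" "edge_tgt E = x" using fwd by blast
    then show ?thesis by (intro bexI[of _ "edge_rev E"]) simp_all
  qed (use fwd in blast)
  have edge_step: "(edge_src E, edge_tgt E) \<in> ?s" if "E \<in> dedges P" for E
  proof -
    obtain \<alpha> r \<epsilon> \<beta> where EE: "E = Edge \<alpha> r \<epsilon> \<beta>" by (cases E)
    have r: "\<alpha> \<in> words P" "\<beta> \<in> words P" "(fst r, snd r) \<in> rels P"
      using that EE dedge_iff[of \<alpha> r \<epsilon> \<beta> P] by simp_all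
    then have "(\<alpha> @ fst r @ \<beta>, \<alpha> @ snd r @ \<beta>) \<in> rewrite_step P"
      unfolding rewrite_step_def by blast
    then show ?thesis using EE by (cases \<epsilon>) simp_all
  qed
  show ?thesis
  proof
    assume "(u, v) \<in> presentation_cong P"
    then have "(u, v) \<in> ?s\<^sup>*" "u \<in> words P" unfolding presentation_cong_def by blast+
    then show "\<exists>p. dpath P u p v"
    proof (induction rule: rtrancl_induct)
      case base
      then show ?case by (intro exI[of _ "[]"]) simp
    next
      case (step x y)
      then obtain p where p: "dpath P u p x" by blast
      obtain E where E: "E \<in> dedges P" "edge_src E = x" "edge_tgt E = y"
        using edge_ex[OF step.hyps(2)] by blast
      then have "dpath P x [E] y" using dpath_single[OF assms] by blast
      then show ?case using p dpath_appendI[OF assms] by blast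
    qed
  next
    assume "\<exists>p. dpath P u p v"
    then obtain p where p: "dpath P u p v" by blast
    then have "(u, v) \<in> ?s\<^sup>*"
    proof (induction p arbitrary: u)
      case (Cons E p)
      then have E: "E \<in> dedges P" "edge_src E = u" "dpath P (edge_tgt E) p v"
        using dpath_Cons[OF assms] by auto
      have "(u, edge_tgt E) \<in> ?s" using edge_step[OF E(1)] E(2) by (simp only:)
      then show ?case using Cons.IH[OF E(3)] by (rule converse_rtrancl_into_rtrancl)
    qed simp
    then show "(u, v) \<in> presentation_cong P"
      using dpath_ends[OF assms p] unfolding presentation_cong_def by blast
  qed
qed

section \<open>Homotopy detected by labellings in groups\<close>

text \<open>On the complex with the translates of \<open>X\<close> adjoined, this is a homomorphism
  from the groupoid of paths up to homotopy into a group, given by its values on edges.\<close>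

definition labelling ::
    "'b presentation \<Rightarrow> 'b edge list set \<Rightarrow> ('b edge \<Rightarrow> 'g::group_add) \<Rightarrow> bool" where
  "labelling P X \<theta> \<longleftrightarrow>
     (\<forall>E\<in>dedges P. \<theta> (edge_rev E) = - \<theta> E) \<and>
     (\<forall>E\<in>dedges P. \<forall>F\<in>dedges P. (\<Sum>e\<leftarrow>commuting_square E F. \<theta> e) = 0) \<and>
     (\<forall>p\<in>X. \<forall>\<alpha>\<in>words P. \<forall>\<beta>\<in>words P. (\<Sum>e\<leftarrow>path_act \<alpha> p \<beta>. \<theta> e) = 0)"

lemma label_dinv:
  assumes "labelling P X \<theta>" "set p \<subseteq> dedges P"
  shows "(\<Sum>e\<leftarrow>dinv p. \<theta> e) = - (\<Sum>e\<leftarrow>p. \<theta> e)"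
  using assms(2)
proof (induction p)
  case (Cons E p)
  then show ?case using assms(1) by (simp add: labelling_def minus_add)
qed simp

text \<open>A cyclic permutation of a closed path conjugates its label, and being zero is invariant
  under conjugation.\<close>

lemma label_rotate:
  fixes \<theta> :: "'e \<Rightarrow> 'g::group_add"
  assumes "(\<Sum>e\<leftarrow>c. \<theta> e) = 0"
  shows "(\<Sum>e\<leftarrow>rotate n c. \<theta> e) = 0"
proof -
  let ?k = "n mod length c"
  have "(\<Sum>e\<leftarrow>take ?k c. \<theta> e) + (\<Sum>e\<leftarrow>drop ?k c. \<theta> e) = 0"
    using assms by (metis append_take_drop_id map_append sum_list_append)
  then have "(\<Sum>e\<leftarrow>drop ?k c. \<theta> e) + (\<Sum>e\<leftarrow>take ?k c. \<theta> e) = 0"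
    by (metis add_eq_0_iff left_minus)
  then show ?thesis by (simp add: rotate_drop_take)
qed

lemma is_path_adjoin [simp]: "is_path (adjoin_cells P X) = dpath P"
  by (intro ext) (simp add: is_path_def adjoin_cells_def)

lemma path_inv_adjoin [simp]: "path_inv (adjoin_cells P X) p = dinv p"
  by (simp add: path_inv_def adjoin_cells_def squier_complex_def)

lemma edge_inv_adjoin [simp]: "edge_inv (adjoin_cells P X) = edge_rev"
  by (simp add: adjoin_cells_def squier_complex_def)

lemma cells_adjoin:
  "cells (adjoin_cells P X) = {commuting_square E F | E F. E \<in> dedges P \<and> F \<in> dedges P} \<union>
     {path_act \<alpha> p \<beta> | \<alpha> p \<beta>. \<alpha> \<in> words P \<and> p \<in> X \<and> \<beta> \<in> words P}"
  by (simp add: adjoin_cells_def squier_complex_def)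

definition closed_paths :: "'b presentation \<Rightarrow> 'b edge list set \<Rightarrow> bool" where
  "closed_paths P X \<longleftrightarrow> (\<forall>p\<in>X. \<exists>u. dpath P u p u)"

lemma cell_closed:
  assumes "presentation P" "closed_paths P X" "c \<in> cells (adjoin_cells P X)"
  shows "\<exists>u. dpath P u c u"
proof -
  consider E F where "c = commuting_square E F" "E \<in> dedges P" "F \<in> dedges P" |
    \<alpha> p \<beta> where "c = path_act \<alpha> p \<beta>" "\<alpha> \<in> words P" "p \<in> X" "\<beta> \<in> words P"
    using assms(3) unfolding cells_adjoin by blast
  then show ?thesis
  proof cases
    case 1
    then show ?thesis using commuting_square_closed[OF assms(1)] by blast
  next
    case 2
    then show ?thesis using dpath_act[OF assms(1)] assms(2) unfolding closed_paths_def by blast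
  qed
qed

lemma label_cell:
  assumes "labelling P X \<theta>" "c \<in> cells (adjoin_cells P X)"
  shows "(\<Sum>e\<leftarrow>c. \<theta> e) = 0"
  using assms unfolding cells_adjoin labelling_def by blast

text \<open>The easy half: labels are homotopy invariants. For null-homotopy of closed paths the
  converse is \<open>null_homotopic_if_label_zero\<close>.\<close>

lemma label_homotopic:
  fixes \<theta> :: "'b edge \<Rightarrow> 'g::group_add"
  assumes P: "presentation P" "closed_paths P X" and lab: "labelling P X \<theta>"
    and htp: "homotopic (adjoin_cells P X) u v p q"
  shows "(\<Sum>e\<leftarrow>p. \<theta> e) = (\<Sum>e\<leftarrow>q. \<theta> e)"
proof -
  have pair: "\<theta> e + \<theta> (edge_rev e) = 0" if "e \<in> dedges P" for e
    using lab that by (simp add: labelling_def)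
  have move: "(\<Sum>e\<leftarrow>r. \<theta> e) = (\<Sum>e\<leftarrow>t. \<theta> e)"
    if mv: "(r, t) \<in> homotopy_move (adjoin_cells P X) u v" for r t
  proof -
    obtain a p q b where r: "r = a @ p @ b" and t: "t = a @ q @ b"
      and paths: "dpath P u (a @ p @ b) v" "dpath P u (a @ q @ b) v"
      and rep: "replaceable (adjoin_cells P X) p q"
      using mv unfolding homotopy_move_def by auto
    have pq: "set p \<subseteq> dedges P" "set q \<subseteq> dedges P" using paths by (auto simp: dpath_def)
    have "(\<Sum>e\<leftarrow>p. \<theta> e) = (\<Sum>e\<leftarrow>q. \<theta> e)"
      using rep unfolding replaceable_def
    proof (elim disjE exE bexE conjE)
      fix c n
      assume c: "c \<in> cells (adjoin_cells P X)"
        and eq: "p @ path_inv (adjoin_cells P X) q = rotate n c"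
      have "(\<Sum>e\<leftarrow>p @ dinv q. \<theta> e) = 0"
        using eq label_rotate[OF label_cell[OF lab c]] by simp
      then show ?thesis using label_dinv[OF lab pq(2)] by simp
    next
      fix c n
      assume c: "c \<in> cells (adjoin_cells P X)"
        and eq: "p @ path_inv (adjoin_cells P X) q = rotate n (path_inv (adjoin_cells P X) c)"
      have "set c \<subseteq> dedges P" using cell_closed[OF P c] by (auto simp: dpath_def)
      then have "(\<Sum>e\<leftarrow>dinv c. \<theta> e) = 0" using label_dinv[OF lab] label_cell[OF lab c] by simp
      then have "(\<Sum>e\<leftarrow>p @ dinv q. \<theta> e) = 0" using eq label_rotate by (metis path_inv_adjoin)
      then show ?thesis using label_dinv[OF lab pq(2)] by simp
    qed (use pq pair in auto)
    then show ?thesis by (simp add: r t)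
  qed
  have "(p, q) \<in> (homotopy_move (adjoin_cells P X) u v)\<^sup>*" using htp by (simp add: homotopic_def)
  then show ?thesis by (induction rule: rtrancl_induct) (use move in auto)
qed

text \<open>Inverting \<open>p @ dinv q\<close> gives \<open>q @ dinv p\<close>, and the inverse of
  a rotation of \<open>c\<close> is a rotation of \<open>dinv c\<close>; so the two orientations of
  a cell are exchanged.\<close>

lemma replaceable_sym:
  assumes "replaceable (adjoin_cells P X) p q"
  shows "replaceable (adjoin_cells P X) q p"
proof -
  have flip: "\<exists>m. q @ dinv p = rotate m (dinv c)"
    if "p @ dinv q = rotate n c" for p q c :: "'a edge list" and n
  proof -
    let ?t = "take (n mod length c) c" and ?d = "drop (n mod length c) c"
    have "q @ dinv p = dinv (p @ dinv q)" by (simp add: rev_map[symmetric] comp_def)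
    also have "\<dots> = dinv (?d @ ?t)" using that by (simp only: rotate_drop_take)
    also have "\<dots> = dinv ?t @ dinv ?d" by simp
    also have "\<dots> = rotate (length (dinv ?d)) (dinv ?d @ dinv ?t)" by (simp only: rotate_append)
    also have "dinv ?d @ dinv ?t = dinv (?t @ ?d)" by (simp only: map_append rev_append)
    also have "?t @ ?d = c" by simp
    finally show ?thesis by blast
  qed
  from assms show ?thesis unfolding replaceable_def
  proof (elim disjE exE bexE conjE)
    fix c n
    assume c: "c \<in> cells (adjoin_cells P X)"
      and "p @ path_inv (adjoin_cells P X) q = rotate n c"
    then have "\<exists>m. q @ dinv p = rotate m (dinv c)" using flip by simp
    then show "(\<exists>e. q = [] \<and> p = [e, edge_inv (adjoin_cells P X) e]) \<or>
        (\<exists>e. q = [e, edge_inv (adjoin_cells P X) e] \<and> p = []) \<or>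
        (\<exists>c\<in>cells (adjoin_cells P X). \<exists>n.
          q @ path_inv (adjoin_cells P X) p = rotate n c \<or>
          q @ path_inv (adjoin_cells P X) p = rotate n (path_inv (adjoin_cells P X) c))"
      using c by auto
  next
    fix c n
    assume c: "c \<in> cells (adjoin_cells P X)"
      and "p @ path_inv (adjoin_cells P X) q = rotate n (path_inv (adjoin_cells P X) c)"
    then have "\<exists>m. q @ dinv p = rotate m (dinv (dinv c))"
      using flip[of p q n "dinv c"] by simp
    moreover have "dinv (dinv c) = c" by (simp add: rev_map[symmetric] comp_def)
    ultimately have "\<exists>m. q @ dinv p = rotate m c" by simp
    then show "(\<exists>e. q = [] \<and> p = [e, edge_inv (adjoin_cells P X) e]) \<or>
        (\<exists>e. q = [e, edge_inv (adjoin_cells P X) e] \<and> p = []) \<or>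
        (\<exists>c\<in>cells (adjoin_cells P X). \<exists>n.
          q @ path_inv (adjoin_cells P X) p = rotate n c \<or>
          q @ path_inv (adjoin_cells P X) p = rotate n (path_inv (adjoin_cells P X) c))"
      using c by auto
  qed auto
qed

section \<open>Homotopy as a congruence on paths; loop classes under left multiplication\<close>

context
  fixes P :: "'b presentation" and X :: "'b edge list set"
  assumes P: "presentation P" and X: "closed_paths P X"
begin

abbreviation htp :: "'b list \<Rightarrow> 'b list \<Rightarrow> 'b edge list \<Rightarrow> 'b edge list \<Rightarrow> bool" where
  "htp \<equiv> homotopic (adjoin_cells P X)"

lemma htp_refl: "dpath P u p v \<Longrightarrow> htp u v p p"
  by (simp add: homotopic_def)

lemma htp_sym: "htp u v p q \<Longrightarrow> htp u v q p"
proof -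
  assume h: "htp u v p q"
  have "sym (homotopy_move (adjoin_cells P X) u v)"
    unfolding sym_def homotopy_move_def using replaceable_sym by blast
  then have "sym ((homotopy_move (adjoin_cells P X) u v)\<^sup>*)" by (rule sym_rtrancl)
  then show ?thesis using h unfolding homotopic_def sym_def by blast
qed

lemma htp_trans: "htp u v p q \<Longrightarrow> htp u v q r \<Longrightarrow> htp u v p r"
  unfolding homotopic_def by (meson rtrancl_trans)

lemma htp_context:
  assumes "htp u v p q" "dpath P w a u" "dpath P v b z"
  shows "htp w z (a @ p @ b) (a @ q @ b)"
proof -
  let ?M = "\<lambda>u v. homotopy_move (adjoin_cells P X) u v"
  have pth: "dpath P w (a @ r @ b) z" if "dpath P u r v" for r
    using that assms(2,3) dpath_appendI[OF P] by blast
  have mv: "(a @ r @ b, a @ t @ b) \<in> ?M w z" if "(r, t) \<in> ?M u v" for r t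
  proof -
    obtain c p' q' d where r: "r = c @ p' @ d" "t = c @ q' @ d"
      "dpath P u (c @ p' @ d) v" "dpath P u (c @ q' @ d) v" "replaceable (adjoin_cells P X) p' q'"
      using \<open>(r, t) \<in> ?M u v\<close> unfolding homotopy_move_def by auto
    have "dpath P w ((a @ c) @ p' @ (d @ b)) z" "dpath P w ((a @ c) @ q' @ (d @ b)) z"
      using pth[OF r(3)] pth[OF r(4)] by simp_all
    then have "((a @ c) @ p' @ (d @ b), (a @ c) @ q' @ (d @ b)) \<in> ?M w z"
      unfolding homotopy_move_def using r(5) by (auto simp del: append_assoc)
    then show ?thesis using r(1,2) by simp
  qed
  have "(p, q) \<in> (?M u v)\<^sup>*" using assms(1) by (simp add: homotopic_def)
  then have "(a @ p @ b, a @ q @ b) \<in> (?M w z)\<^sup>*"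
    by (induction rule: rtrancl_induct) (auto intro: rtrancl_into_rtrancl mv)
  then show ?thesis using assms(1) pth by (simp add: homotopic_def)
qed

lemma htp_replace:
  assumes "replaceable (adjoin_cells P X) p q" "dpath P u p v" "dpath P u q v"
  shows "htp u v p q"
proof -
  have "([] @ p @ [], [] @ q @ []) \<in> homotopy_move (adjoin_cells P X) u v"
    using assms unfolding homotopy_move_def by (intro CollectI exI[of _ "[]"] exI[of _ p] exI[of _ q]) auto
  then show ?thesis using assms by (auto simp: homotopic_def)
qed

lemma htp_cell:
  assumes "c \<in> cells (adjoin_cells P X)" "dpath P u c u"
  shows "htp u u c []"
proof (rule htp_replace)
  have "c @ path_inv (adjoin_cells P X) [] = rotate 0 c" by simp
  then show "replaceable (adjoin_cells P X) c []" unfolding replaceable_def using assms(1) by blast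
qed (use assms dpath_ends[OF P] in auto)

lemma htp_cancel:
  assumes "dpath P u p v"
  shows "htp u u (p @ dinv p) []"
  using assms
proof (induction p arbitrary: u)
  case Nil
  then show ?case by (auto intro!: htp_refl)
next
  case (Cons E p)
  then have E: "E \<in> dedges P" "edge_src E = u" "dpath P (edge_tgt E) p v"
    using dpath_Cons[OF P] by auto
  have paths: "dpath P u [E] (edge_tgt E)" "dpath P (edge_tgt E) [edge_rev E] u"
    using dpath_single[OF P] E edge_rev_dedges by (force, metis edge_src_rev edge_tgt_rev edge_rev_dedges)
  have "htp u u ([E] @ (p @ dinv p) @ [edge_rev E]) ([E] @ [] @ [edge_rev E])"
    using htp_context[OF Cons.IH[OF E(3)]] paths by blast
  moreover have "htp u u [E, edge_rev E] []"
  proof (rule htp_replace)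
    show "replaceable (adjoin_cells P X) [E, edge_rev E] []" by (simp add: replaceable_def)
  qed (use paths dpath_appendI[OF P, of u "[E]" "edge_tgt E" "[edge_rev E]"] dpath_ends[OF P] in auto)
  ultimately show ?case using htp_trans by simp
qed

lemma htp_cancel':
  assumes "dpath P u p v"
  shows "htp v v (dinv p @ p) []"
  using htp_cancel[OF dpath_dinv[OF P assms]] by (simp add: rev_map[symmetric] comp_def)

definition loops :: "'b list \<Rightarrow> 'b edge list \<Rightarrow> 'b edge list set" where
  "loops b q = {q'. htp b b q q'}"

lemma loops_eq: "dpath P b q b \<Longrightarrow> loops b q = loops b q' \<longleftrightarrow> htp b b q q'"
proof
  assume q: "dpath P b q b" and eq: "loops b q = loops b q'"
  have "q \<in> loops b q" using htp_refl[OF q] by (simp add: loops_def)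
  then have "htp b b q' q" unfolding eq by (simp add: loops_def)
  then show "htp b b q q'" by (rule htp_sym)
next
  assume "htp b b q q'"
  then show "loops b q = loops b q'" unfolding loops_def using htp_sym htp_trans by blast
qed

text \<open>Left multiplication by \<open>l\<close> in the fundamental group at \<open>b\<close>.
  Sets that are not classes of loops are left fixed, so that a loop \<open>l\<close> yields a
  permutation of the whole type.\<close>

definition loop_act :: "'b list \<Rightarrow> 'b edge list \<Rightarrow> 'b edge list set \<Rightarrow> 'b edge list set" where
  "loop_act b l C = (if \<exists>q. dpath P b q b \<and> C = loops b q
     then loops b (l @ (SOME q. dpath P b q b \<and> C = loops b q)) else C)"

lemma loop_act_loops:
  assumes "dpath P b l b" "dpath P b q b"
  shows "loop_act b l (loops b q) = loops b (l @ q)"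
proof -
  let ?q = "SOME q'. dpath P b q' b \<and> loops b q = loops b q'"
  have q: "dpath P b ?q b" "loops b q = loops b ?q"
    using someI[of "\<lambda>q'. dpath P b q' b \<and> loops b q = loops b q'" q] assms(2) by auto
  then have "htp b b ?q q" using loops_eq assms(2) htp_sym by blast
  then have "htp b b (l @ ?q @ []) (l @ q @ [])"
    using htp_context assms(1) dpath_ends[OF P assms(1)] by (meson dpath_Nil)
  then have "loops b (l @ ?q) = loops b (l @ q)"
    using loops_eq dpath_appendI[OF P assms(1) q(1)] by simp
  then show ?thesis unfolding loop_act_def using assms(2) by auto
qed

lemma loop_act_other: "\<not> (\<exists>q. dpath P b q b \<and> C = loops b q) \<Longrightarrow> loop_act b l C = C"
  unfolding loop_act_def by auto

lemma loop_act_append: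
  assumes "dpath P b l b" "dpath P b l' b"
  shows "loop_act b (l @ l') = loop_act b l \<circ> loop_act b l'"
proof
  fix C show "loop_act b (l @ l') C = (loop_act b l \<circ> loop_act b l') C"
  proof (cases "\<exists>q. dpath P b q b \<and> C = loops b q")
    case True
    then obtain q where "dpath P b q b" "C = loops b q" by blast
    then show ?thesis using assms dpath_appendI[OF P] by (simp add: loop_act_loops)
  next
    case False
    then show ?thesis by (simp add: loop_act_other)
  qed
qed

lemma loop_act_htp:
  assumes "htp b b l l'"
  shows "loop_act b l = loop_act b l'"
proof
  fix C
  have l: "dpath P b l b" "dpath P b l' b" using assms by (auto simp: homotopic_def)
  show "loop_act b l C = loop_act b l' C"
  proof (cases "\<exists>q. dpath P b q b \<and> C = loops b q")
    case True
    then obtain q where q: "dpath P b q b" "C = loops b q" by blast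
    have "htp b b ([] @ l @ q) ([] @ l' @ q)"
      using htp_context[OF assms] q dpath_ends[OF P q(1)] by (meson dpath_Nil)
    then show ?thesis using q l loops_eq dpath_appendI[OF P] by (simp add: loop_act_loops)
  next
    case False
    then show ?thesis by (simp add: loop_act_other)
  qed
qed

lemma loop_act_Nil: "b \<in> words P \<Longrightarrow> loop_act b [] = id"
proof
  fix C assume b: "b \<in> words P"
  show "loop_act b [] C = id C"
  proof (cases "\<exists>q. dpath P b q b \<and> C = loops b q")
    case True
    then show ?thesis using loop_act_loops[of b "[]"] b by auto
  next
    case False
    then show ?thesis by (simp add: loop_act_other)
  qed
qed

lemma loop_act_bij:
  assumes "dpath P b l b"
  shows "bij (loop_act b l)"
proof -
  have b: "b \<in> words P" using dpath_ends[OF P assms] by simp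
  note l' = dpath_dinv[OF P assms]
  have "loop_act b l \<circ> loop_act b (dinv l) = id" "loop_act b (dinv l) \<circ> loop_act b l = id"
    using loop_act_append[OF assms l'] loop_act_append[OF l' assms] loop_act_htp[OF htp_cancel[OF assms]]
      loop_act_htp[OF htp_cancel'[OF assms]] loop_act_Nil[OF b] by auto
  then show ?thesis using o_bij by blast
qed

text \<open>The fundamental group at \<open>b\<close>, acting faithfully on itself, receives a labelling
  once a path from \<open>b\<close> to every vertex of its component is chosen.\<close>

theorem null_homotopic_if_label_zero:
  assumes p: "dpath P b p b"
    and lab: "\<And>\<theta> :: 'b edge \<Rightarrow> 'b edge list set sym_group. labelling P X \<theta> \<Longrightarrow> (\<Sum>e\<leftarrow>p. \<theta> e) = 0"
  shows "htp b b p []"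
proof -
  define conn where "conn v \<longleftrightarrow> (\<exists>q. dpath P b q v)" for v
  define t where "t v = (SOME q. dpath P b q v)" for v
  have t: "dpath P b (t v) v" if "conn v" for v
    using that unfolding conn_def t_def by (rule someI_ex)
  have b: "b \<in> words P" using dpath_ends[OF P p] by simp
  \<comment> \<open>Edges outside the component of \<open>b\<close> receive 0. Membership in that
    component does not change along an edge, so every path outside it sums to 0.\<close>
  define \<theta> where "\<theta> E = (if E \<in> dedges P \<and> conn (edge_src E)
      then Abs_sym (loop_act b (t (edge_src E) @ [E] @ dinv (t (edge_tgt E)))) else 0)" for E
  have conn_step: "conn (edge_tgt E)" if "E \<in> dedges P" "conn (edge_src E)" for E
    using that dpath_single[OF P] dpath_appendI[OF P] unfolding conn_def by blast
  have conn_iff: "conn (edge_tgt E) \<longleftrightarrow> conn (edge_src E)" if "E \<in> dedges P" for E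
    using that conn_step[of E] conn_step[of "edge_rev E"] by auto
  have loop: "dpath P b (t u @ q @ dinv (t v)) b" if "conn u" "dpath P u q v" for u q v
  proof -
    have "conn v" using that dpath_appendI[OF P] unfolding conn_def by blast
    then show ?thesis using t that dpath_dinv[OF P] dpath_appendI[OF P] by meson
  qed
  have cancel_mid: "htp b b ((t u @ q @ dinv (t v)) @ (t v @ q' @ dinv (t w))) (t u @ (q @ q') @ dinv (t w))"
    if "conn u" "dpath P u q v" "dpath P v q' w" for u q v q' w
  proof -
    have v: "conn v" using that(1,2) dpath_appendI[OF P] unfolding conn_def by blast
    then have w: "conn w" using that(3) dpath_appendI[OF P] unfolding conn_def by blast
    have "htp v v (dinv (t v) @ t v) []" by (rule htp_cancel'[OF t[OF v]])
    moreover have "dpath P b (t u @ q) v" using t that dpath_appendI[OF P] by blast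
    moreover have "dpath P v (q' @ dinv (t w)) b"
      using t[OF w] that(3) dpath_appendI[OF P] dpath_dinv[OF P] by blast
    ultimately have "htp b b ((t u @ q) @ (dinv (t v) @ t v) @ (q' @ dinv (t w))) ((t u @ q) @ [] @ (q' @ dinv (t w)))"
      by (rule htp_context)
    then show ?thesis by simp
  qed
  have Abs_append: "Abs_sym (loop_act b l) + Abs_sym (loop_act b l') = Abs_sym (loop_act b (l @ l'))"
    if "dpath P b l b" "dpath P b l' b" for l l'
    using that loop_act_bij by (simp add: plus_sym_group_def loop_act_append Abs_sym_inverse)
  have Abs_Nil: "Abs_sym (loop_act b []) = 0"
    using loop_act_Nil[OF b] by (simp add: zero_sym_group_def)
  have Abs_trivial: "Abs_sym (loop_act b (t v @ [] @ dinv (t v))) = 0" if "conn v" for v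
    using loop_act_htp[OF htp_cancel[OF t[OF that]]] Abs_Nil by simp
  have sum_path: "(\<Sum>e\<leftarrow>q. \<theta> e) = Abs_sym (loop_act b (t u @ q @ dinv (t v)))"
    if "conn u" "dpath P u q v" for u q v
    using that
  proof (induction q arbitrary: u)
    case Nil
    then show ?case using Abs_trivial by simp
  next
    case (Cons E q)
    then have E: "E \<in> dedges P" "edge_src E = u" "dpath P (edge_tgt E) q v"
      using dpath_Cons[OF P] by auto
    have c: "conn (edge_tgt E)" using conn_step E Cons.prems by blast
    have E1: "dpath P u [E] (edge_tgt E)" using dpath_single[OF P] E by blast
    have "(\<Sum>e\<leftarrow>E # q. \<theta> e) = Abs_sym (loop_act b (t u @ [E] @ dinv (t (edge_tgt E))))
        + Abs_sym (loop_act b (t (edge_tgt E) @ q @ dinv (t v)))"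
      using Cons.IH[OF c E(3)] E Cons.prems(1) by (simp add: \<theta>_def)
    also have "\<dots> = Abs_sym (loop_act b ((t u @ [E] @ dinv (t (edge_tgt E))) @ (t (edge_tgt E) @ q @ dinv (t v))))"
      using Abs_append loop Cons.prems(1) c E1 E(3) by blast
    also have "\<dots> = Abs_sym (loop_act b (t u @ ([E] @ q) @ dinv (t v)))"
      using loop_act_htp[OF cancel_mid[OF Cons.prems(1) E1 E(3)]] by simp
    finally show ?case by simp
  qed
  have sum_off: "(\<Sum>e\<leftarrow>q. \<theta> e) = 0" if "\<not> conn u" "dpath P u q v" for u q v
    using that
  proof (induction q arbitrary: u)
    case (Cons E q)
    then have E: "E \<in> dedges P" "edge_src E = u" "dpath P (edge_tgt E) q v"
      using dpath_Cons[OF P] by auto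
    then have "\<theta> E = 0" "(\<Sum>e\<leftarrow>q. \<theta> e) = 0"
      using Cons.IH[OF _ E(3)] Cons.prems(1) conn_iff by (simp_all add: \<theta>_def)
    then show ?case by simp
  qed simp
  have cell: "(\<Sum>e\<leftarrow>c. \<theta> e) = 0" if c: "c \<in> cells (adjoin_cells P X)" for c
  proof -
    obtain u where u: "dpath P u c u" using cell_closed[OF P X c] by blast
    show ?thesis
    proof (cases "conn u")
      case True
      have "htp b b (t u @ c @ dinv (t u)) (t u @ [] @ dinv (t u))"
        using htp_context[OF htp_cell[OF c u] t[OF True] dpath_dinv[OF P t[OF True]]] .
      then show ?thesis using sum_path[OF True u] Abs_trivial[OF True] loop_act_htp by metis
    next
      case False
      then show ?thesis using sum_off u by blast
    qed
  qed
  have "\<theta> (edge_rev E) = - \<theta> E" if E: "E \<in> dedges P" for E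
  proof (cases "conn (edge_src E)")
    case True
    have pE: "dpath P (edge_src E) [E] (edge_tgt E)" "dpath P (edge_tgt E) [edge_rev E] (edge_src E)"
      using dpath_single[OF P E] dpath_single[OF P, of "edge_rev E"] E by auto
    have path: "dpath P (edge_src E) ([E] @ [edge_rev E]) (edge_src E)"
      using pE dpath_appendI[OF P] by blast
    have "htp (edge_src E) (edge_src E) ([E] @ [edge_rev E]) []"
      using htp_cancel[OF pE(1)] by simp
    then have "htp b b (t (edge_src E) @ ([E] @ [edge_rev E]) @ dinv (t (edge_src E)))
        (t (edge_src E) @ [] @ dinv (t (edge_src E)))"
      using htp_context t[OF True] dpath_dinv[OF P t[OF True]] by blast
    then have "(\<Sum>e\<leftarrow>[E] @ [edge_rev E]. \<theta> e) = 0"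
      using sum_path[OF True path] Abs_trivial[OF True] loop_act_htp by metis
    then have "\<theta> E + \<theta> (edge_rev E) = 0" by simp
    then show ?thesis by (metis minus_unique)
  next
    case False
    then show ?thesis using conn_iff[OF E] by (simp add: \<theta>_def)
  qed
  then have "labelling P X \<theta>"
    unfolding labelling_def using cell unfolding cells_adjoin by blast
  then have "(\<Sum>e\<leftarrow>p. \<theta> e) = 0" by (rule lab)
  moreover have cb: "conn b" using b unfolding conn_def by (intro exI[of _ "[]"]) simp
  ultimately have "Abs_sym (loop_act b (t b @ p @ dinv (t b))) = 0" using sum_path p by simp
  then have "loop_act b (t b @ p @ dinv (t b)) = id"
    using Abs_sym_inverse loop_act_bij[OF loop[OF cb p]]
    by (metis mem_Collect_eq zero_sym_group.rep_eq)
  \<comment> \<open>Faithfulness: a left translation that is the identity fixes the class of the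
    empty loop.\<close>
  then have "loops b ((t b @ p @ dinv (t b)) @ []) = loops b []"
    using loop_act_loops[OF loop[OF cb p], of "[]"] b by simp
  then have h: "htp b b (t b @ p @ dinv (t b)) []"
    using loops_eq loop[OF cb p] by simp
  \<comment> \<open>The chosen path from \<open>b\<close> to itself need not be empty, so the
    conjugation by \<open>t b\<close> remains to be undone.\<close>
  have tb: "dpath P b (t b) b" using t cb by blast
  note tb' = dpath_dinv[OF P tb]
  note c = htp_cancel'[OF tb]
  have nil: "dpath P b [] b" using b by simp
  have "htp b b (p @ (dinv (t b) @ t b) @ []) (p @ [] @ [])"
    by (rule htp_context[OF c p nil])
  then have "htp b b p (p @ dinv (t b) @ t b)" using htp_sym by simp
  moreover have "htp b b ([] @ (dinv (t b) @ t b) @ (p @ dinv (t b) @ t b)) ([] @ [] @ (p @ dinv (t b) @ t b))"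
    by (rule htp_context[OF c nil dpath_appendI[OF P p dpath_appendI[OF P tb' tb]]])
  then have "htp b b (p @ dinv (t b) @ t b) (dinv (t b) @ t b @ p @ dinv (t b) @ t b)"
    using htp_sym by simp
  ultimately have "htp b b p (dinv (t b) @ t b @ p @ dinv (t b) @ t b)" by (rule htp_trans)
  moreover have "htp b b (dinv (t b) @ (t b @ p @ dinv (t b)) @ t b) (dinv (t b) @ [] @ t b)"
    by (rule htp_context[OF h tb' tb])
  then have "htp b b (dinv (t b) @ t b @ p @ dinv (t b) @ t b) (dinv (t b) @ t b)" by simp
  ultimately have "htp b b p (dinv (t b) @ t b)" by (rule htp_trans)
  then show ?thesis using c by (rule htp_trans)
qed

end

text \<open>Automation would otherwise replace membership in \<open>words P\<close> by membership of all letters.\<close>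

declare in_listsD [rule del] in_listsI [rule del]

section \<open>Calculus of labelled paths\<close>

text \<open>Translation sends commuting squares to commuting squares and translates of
  \<open>Y\<close> to translates of \<open>Y\<close>. Hence an identity that holds for all
  labellings without context holds in every context; see \<open>val_heq\<close>.\<close>

lemma labelling_shift:
  assumes "labelling Q Y \<theta>" "\<alpha> \<in> words Q" "\<beta> \<in> words Q"
  shows "labelling Q Y (\<lambda>E. \<theta> (edge_act \<alpha> E \<beta>))"
proof -
  have act: "(\<Sum>e\<leftarrow>p. \<theta> (edge_act \<alpha> e \<beta>)) = (\<Sum>e\<leftarrow>path_act \<alpha> p \<beta>. \<theta> e)" for p
    by (simp add: path_act_def comp_def)
  have "(\<Sum>e\<leftarrow>commuting_square E F. \<theta> (edge_act \<alpha> e \<beta>)) = 0"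
    if "E \<in> dedges Q" "F \<in> dedges Q" for E F
    using assms that edge_act_dedges[OF that(1) assms(2), of "[]"] edge_act_dedges[OF that(2) _ assms(3), of "[]"]
    unfolding act commuting_square_act labelling_def by simp
  moreover have "(\<Sum>e\<leftarrow>path_act \<gamma> p \<delta>. \<theta> (edge_act \<alpha> e \<beta>)) = 0"
    if "p \<in> Y" "\<gamma> \<in> words Q" "\<delta> \<in> words Q" for p \<gamma> \<delta>
  proof -
    have "\<alpha> @ \<gamma> \<in> words Q" "\<delta> @ \<beta> \<in> words Q" using assms that by auto
    then show ?thesis using assms(1) that(1) unfolding act path_act_act labelling_def by blast
  qed
  ultimately show ?thesis
    using assms edge_act_dedges[OF _ assms(2,3)] unfolding labelling_def edge_act_rev by blast
qed

locale labelled =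
  fixes Q :: "'b presentation" and Y :: "'b edge list set" and \<theta> :: "'b edge \<Rightarrow> 'g::group_add"
  assumes Q: "presentation Q" and lab: "labelling Q Y \<theta>"
begin

definition val :: "'b list \<Rightarrow> 'b edge list \<Rightarrow> 'b list \<Rightarrow> 'g" where
  "val \<alpha> p \<beta> = (\<Sum>e\<leftarrow>path_act \<alpha> p \<beta>. \<theta> e)"

lemma lab_rev: "E \<in> dedges Q \<Longrightarrow> \<theta> (edge_rev E) = - \<theta> E"
  using lab by (simp add: labelling_def)

lemma val_append [simp]: "val \<alpha> (p @ q) \<beta> = val \<alpha> p \<beta> + val \<alpha> q \<beta>"
  by (simp add: val_def)

lemma val_Nil [simp]: "val \<alpha> [] \<beta> = 0"
  by (simp add: val_def)

lemma val_act [simp]: "val \<alpha> (path_act \<gamma> p \<delta>) \<beta> = val (\<alpha> @ \<gamma>) p (\<delta> @ \<beta>)"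
  by (simp add: val_def)

lemma val_dinv:
  assumes "dpath Q u p v" "\<alpha> \<in> words Q" "\<beta> \<in> words Q"
  shows "val \<alpha> (dinv p) \<beta> = - val \<alpha> p \<beta>"
  unfolding val_def path_act_dinv
  by (rule label_dinv[OF lab]) (use dpath_act[OF Q assms] in \<open>simp add: dpath_def\<close>)

lemma val_cell:
  assumes "p \<in> Y" "\<alpha> \<in> words Q" "\<beta> \<in> words Q"
  shows "val \<alpha> p \<beta> = 0"
  using assms lab unfolding labelling_def val_def by blast

lemma square_sum:
  fixes a b c d :: 'g
  assumes "a + (b + (- c + - d)) = 0"
  shows "a + b = d + c"
proof -
  have "(a + b) + - (d + c) = 0" using assms by (simp add: minus_add add.assoc)
  then show ?thesis by (metis eq_neg_iff_add_eq_0 minus_minus)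
qed

lemma interchange_edges:
  assumes "E \<in> dedges Q" "F \<in> dedges Q" "\<alpha> \<in> words Q" "\<beta> \<in> words Q" "\<gamma> \<in> words Q"
  shows "val \<alpha> [E] (\<gamma> @ edge_src F @ \<beta>) + val (\<alpha> @ edge_tgt E @ \<gamma>) [F] \<beta> =
    val (\<alpha> @ edge_src E @ \<gamma>) [F] \<beta> + val \<alpha> [E] (\<gamma> @ edge_tgt F @ \<beta>)"
proof -
  let ?E = "edge_act \<alpha> E \<gamma>" and ?F = "edge_act [] F \<beta>"
  have EF: "?E \<in> dedges Q" "?F \<in> dedges Q" using assms edge_act_dedges by auto
  then have "(\<Sum>e\<leftarrow>commuting_square ?E ?F. \<theta> e) = 0" using lab unfolding labelling_def by blast
  moreover have "\<theta> (edge_rev (edge_act \<alpha> E (\<gamma> @ edge_tgt F @ \<beta>))) = - \<theta> (edge_act \<alpha> E (\<gamma> @ edge_tgt F @ \<beta>))"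
    "\<theta> (edge_rev (edge_act (\<alpha> @ edge_src E @ \<gamma>) F \<beta>)) = - \<theta> (edge_act (\<alpha> @ edge_src E @ \<gamma>) F \<beta>)"
    by (intro lab_rev edge_act_dedges; use assms edge_ends_words[OF Q] in simp)+
  ultimately have "\<theta> (edge_act \<alpha> E (\<gamma> @ edge_src F @ \<beta>)) + (\<theta> (edge_act (\<alpha> @ edge_tgt E @ \<gamma>) F \<beta>) +
      (- \<theta> (edge_act \<alpha> E (\<gamma> @ edge_tgt F @ \<beta>)) + - \<theta> (edge_act (\<alpha> @ edge_src E @ \<gamma>) F \<beta>))) = 0"
    by (simp add: commuting_square_def edge_act_rev)
  note square_sum[OF this]
  then show ?thesis by (simp add: val_def)
qed

text \<open>Derivations in disjoint factors of a word commute up to homotopy. The square for two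
  edges extends along \<open>p\<close> and then along \<open>q\<close> by induction;
  \<open>\<gamma>\<close> is the untouched factor between them.\<close>

lemma interchange:
  assumes p: "dpath Q u p u'" and q: "dpath Q v q v'"
    and w: "\<alpha> \<in> words Q" "\<beta> \<in> words Q" "\<gamma> \<in> words Q"
  shows "val \<alpha> p (\<gamma> @ v @ \<beta>) + val (\<alpha> @ u' @ \<gamma>) q \<beta> = val (\<alpha> @ u @ \<gamma>) q \<beta> + val \<alpha> p (\<gamma> @ v' @ \<beta>)"
proof -
  have edge: "val \<alpha> p (\<gamma> @ edge_src F @ \<beta>) + val (\<alpha> @ u' @ \<gamma>) [F] \<beta> =
      val (\<alpha> @ u @ \<gamma>) [F] \<beta> + val \<alpha> p (\<gamma> @ edge_tgt F @ \<beta>)" if F: "F \<in> dedges Q" for F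
    using p
  proof (induction p arbitrary: u)
    case (Cons E p)
    then have E: "E \<in> dedges Q" "edge_src E = u" "dpath Q (edge_tgt E) p u'"
      using dpath_Cons[OF Q] by auto
    have split: "val \<alpha> (E # p) \<delta> = val \<alpha> [E] \<delta> + val \<alpha> p \<delta>" for \<delta>
      using val_append[of \<alpha> "[E]" p \<delta>] by simp
    have "val \<alpha> (E # p) (\<gamma> @ edge_src F @ \<beta>) + val (\<alpha> @ u' @ \<gamma>) [F] \<beta> =
        val \<alpha> [E] (\<gamma> @ edge_src F @ \<beta>) + (val \<alpha> p (\<gamma> @ edge_src F @ \<beta>) + val (\<alpha> @ u' @ \<gamma>) [F] \<beta>)"
      by (simp add: split add.assoc)
    also have "\<dots> = (val \<alpha> [E] (\<gamma> @ edge_src F @ \<beta>) + val (\<alpha> @ edge_tgt E @ \<gamma>) [F] \<beta>) + val \<alpha> p (\<gamma> @ edge_tgt F @ \<beta>)"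
      by (simp only: Cons.IH[OF E(3)] add.assoc)
    also have "\<dots> = val (\<alpha> @ u @ \<gamma>) [F] \<beta> + val \<alpha> (E # p) (\<gamma> @ edge_tgt F @ \<beta>)"
      using interchange_edges[OF E(1) F w] E(2) by (simp add: split[of "\<gamma> @ edge_tgt F @ \<beta>"] add.assoc)
    finally show ?case .
  qed simp
  show ?thesis
    using q
  proof (induction q arbitrary: v)
    case (Cons F q)
    then have F: "F \<in> dedges Q" "edge_src F = v" "dpath Q (edge_tgt F) q v'"
      using dpath_Cons[OF Q] by auto
    have split: "val \<delta> (F # q) \<beta> = val \<delta> [F] \<beta> + val \<delta> q \<beta>" for \<delta>
      using val_append[of \<delta> "[F]" q \<beta>] by simp
    have "val \<alpha> p (\<gamma> @ v @ \<beta>) + val (\<alpha> @ u' @ \<gamma>) (F # q) \<beta> =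
        (val \<alpha> p (\<gamma> @ edge_src F @ \<beta>) + val (\<alpha> @ u' @ \<gamma>) [F] \<beta>) + val (\<alpha> @ u' @ \<gamma>) q \<beta>"
      using F(2) by (simp add: split[of "\<alpha> @ u' @ \<gamma>"] add.assoc)
    also have "\<dots> = val (\<alpha> @ u @ \<gamma>) [F] \<beta> + (val \<alpha> p (\<gamma> @ edge_tgt F @ \<beta>) + val (\<alpha> @ u' @ \<gamma>) q \<beta>)"
      by (simp only: edge[OF F(1)] add.assoc)
    also have "\<dots> = val (\<alpha> @ u @ \<gamma>) (F # q) \<beta> + val \<alpha> p (\<gamma> @ v' @ \<beta>)"
      by (simp only: Cons.IH[OF F(3)] split[of "\<alpha> @ u @ \<gamma>"] add.assoc)
    finally show ?case .
  qed simp
qed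

lemma interchange0:
  assumes "dpath Q u p u'" "dpath Q v q v'" "\<alpha> \<in> words Q" "\<beta> \<in> words Q"
  shows "val \<alpha> p (v @ \<beta>) + val (\<alpha> @ u') q \<beta> = val (\<alpha> @ u) q \<beta> + val \<alpha> p (v' @ \<beta>)"
  using interchange[OF assms, of "[]"] by simp

end

text \<open>The value type is fixed to the one for which \<open>null_homotopic_if_label_zero\<close>
  is available, since a definition cannot quantify over types.\<close>

definition heq :: "'b presentation \<Rightarrow> 'b edge list set \<Rightarrow> 'b edge list \<Rightarrow> 'b edge list \<Rightarrow> bool" where
  "heq Q Y p q \<longleftrightarrow> (\<forall>\<theta> :: 'b edge \<Rightarrow> 'b edge list set sym_group. labelling Q Y \<theta> \<longrightarrow>
     (\<Sum>e\<leftarrow>p. \<theta> e) = (\<Sum>e\<leftarrow>q. \<theta> e))"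

locale sym_labelled = labelled Q Y \<theta>
  for Q :: "'b presentation" and Y and \<theta> :: "'b edge \<Rightarrow> 'b edge list set sym_group"

lemma (in sym_labelled) val_heq:
  assumes "heq Q Y p q" "\<alpha> \<in> words Q" "\<beta> \<in> words Q"
  shows "val \<alpha> p \<beta> = val \<alpha> q \<beta>"
  using assms(1) labelling_shift[OF lab assms(2,3)] unfolding heq_def val_def
  by (simp add: path_act_def comp_def)

lemma heqI:
  assumes "presentation Q"
    and "\<And>\<theta> :: 'b edge \<Rightarrow> 'b edge list set sym_group. sym_labelled Q Y \<theta> \<Longrightarrow>
      labelled.val \<theta> [] p [] = labelled.val \<theta> [] q []"
  shows "heq Q Y p q"
  unfolding heq_def
proof (intro allI impI)
  fix \<theta> :: "'b edge \<Rightarrow> 'b edge list set sym_group" assume "labelling Q Y \<theta>"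
  then have l: "labelled Q Y \<theta>" using assms(1) by (simp add: labelled_def)
  then have l': "sym_labelled Q Y \<theta>" by (simp add: sym_labelled_def)
  show "(\<Sum>e\<leftarrow>p. \<theta> e) = (\<Sum>e\<leftarrow>q. \<theta> e)"
    using assms(2)[OF l'] by (simp add: labelled.val_def[OF l])
qed

lemma homotopy_baseI:
  assumes "presentation Q" "closed_paths Q Y"
    and "\<And>u p. dpath Q u p u \<Longrightarrow> heq Q Y p []"
  shows "homotopy_base Q Y"
  unfolding homotopy_base_def
proof (intro conjI allI impI)
  show "\<forall>p\<in>Y. \<exists>u. dpath Q u p u" using assms(2) by (simp add: closed_paths_def)
  fix u p assume p: "dpath Q u p u"
  show "homotopic (adjoin_cells Q Y) u u p []"
    by (rule null_homotopic_if_label_zero[OF assms(1,2) p])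
      (use assms(3)[OF p] in \<open>simp add: heq_def\<close>)
qed

section \<open>Coherent normal forms\<close>

text \<open>The letters act on \<open>H\<close> as on the vertices of a Cayley graph:
  \<open>nf\<close> selects a word for each vertex and \<open>\<sigma>\<close> a derivation for each
  arrow. The path \<open>c0\<close> deletes the word of the base point \<open>h0\<close>, so that
  \<open>nf h0\<close> can be inserted in front of any word by a derivation.\<close>

locale normal_forms =
  fixes Q :: "'b presentation" and H :: "'x set" and act :: "'x \<Rightarrow> 'b \<Rightarrow> 'x"
    and nf :: "'x \<Rightarrow> 'b list" and \<sigma> :: "'x \<Rightarrow> 'b \<Rightarrow> 'b edge list" and h0 :: 'x and c0 :: "'b edge list"
  assumes Q: "presentation Q"
    and act: "x \<in> H \<Longrightarrow> b \<in> letters Q \<Longrightarrow> act x b \<in> H"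
    and nf: "x \<in> H \<Longrightarrow> nf x \<in> words Q"
    and \<sigma>: "x \<in> H \<Longrightarrow> b \<in> letters Q \<Longrightarrow> dpath Q (nf x @ [b]) (\<sigma> x b) (nf (act x b))"
    and h0: "h0 \<in> H" and c0: "dpath Q (nf h0) c0 []"
    and act_rel: "x \<in> H \<Longrightarrow> (u, v) \<in> rels Q \<Longrightarrow> foldl act x u = foldl act x v"
begin

fun \<tau> :: "'x \<Rightarrow> 'b list \<Rightarrow> 'b edge list" where
  "\<tau> x [] = []"
| "\<tau> x (b # w) = path_act [] (\<sigma> x b) w @ \<tau> (act x b) w"

lemma foldl_act: "x \<in> H \<Longrightarrow> w \<in> words Q \<Longrightarrow> foldl act x w \<in> H"
  by (induction w arbitrary: x) (auto intro: act)

lemma \<tau>_path: "x \<in> H \<Longrightarrow> w \<in> words Q \<Longrightarrow> dpath Q (nf x @ w) (\<tau> x w) (nf (foldl act x w))"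
proof (induction w arbitrary: x)
  case Nil
  then show ?case using nf by simp
next
  case (Cons b w)
  then have bw: "b \<in> letters Q" "w \<in> words Q" by auto
  have "dpath Q ([] @ (nf x @ [b]) @ w) (path_act [] (\<sigma> x b) w) ([] @ nf (act x b) @ w)"
    by (rule dpath_act[OF Q \<sigma>]) (use Cons.prems bw in auto)
  then show ?case using Cons.IH[OF act[OF Cons.prems(1) bw(1)] bw(2)] dpath_appendI[OF Q] by simp
qed

lemma \<tau>_append: "\<tau> x (w @ w') = path_act [] (\<tau> x w) w' @ \<tau> (foldl act x w) w'"
  by (induction w arbitrary: x) simp_all

text \<open>Both words are derived to the normal form of their common value, after
  \<open>nf h0\<close> has been inserted in front by the inverse of \<open>c0\<close>. This is
  completeness of the relations.\<close>

lemma connected: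
  assumes "w \<in> words Q" "w' \<in> words Q" "foldl act h0 w = foldl act h0 w'"
  shows "\<exists>p. dpath Q w p w'"
proof -
  have "\<exists>p. dpath Q w p (nf (foldl act h0 w))" if w: "w \<in> words Q" for w
  proof -
    have "dpath Q ([] @ [] @ w) (path_act [] (dinv c0) w) ([] @ nf h0 @ w)"
      by (rule dpath_act[OF Q dpath_dinv[OF Q c0]]) (use w in auto)
    then show ?thesis using \<tau>_path[OF h0 w] dpath_appendI[OF Q] by (metis append_Nil)
  qed
  then obtain p p' where "dpath Q w p (nf (foldl act h0 w))" "dpath Q w' p' (nf (foldl act h0 w))"
    using assms by metis
  then show ?thesis using dpath_dinv[OF Q] dpath_appendI[OF Q] by blast
qed

lemma path_foldl_act:
  assumes "dpath Q w p w'" "x \<in> H"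
  shows "foldl act x w = foldl act x w'"
  using assms(1)
proof (induction p arbitrary: w)
  case (Cons E p)
  then have E: "E \<in> dedges Q" "edge_src E = w" "dpath Q (edge_tgt E) p w'"
    using dpath_Cons[OF Q] by auto
  obtain \<alpha> u v \<epsilon> \<beta> where EE: "E = Edge \<alpha> (u, v) \<epsilon> \<beta>" by (cases E) auto
  then have "\<alpha> \<in> words Q" "(u, v) \<in> rels Q" using E(1) by (simp_all add: dedge_iff)
  then have "foldl act (foldl act x \<alpha>) u = foldl act (foldl act x \<alpha>) v"
    using act_rel foldl_act assms(2) by blast
  then have "foldl act x (edge_src E) = foldl act x (edge_tgt E)" using EE by (cases \<epsilon>) simp_all
  then show ?case using Cons.IH[OF E(3)] E(2) by simp
qed simp

text \<open>If the chosen paths to normal forms are natural along every relation, they provide a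
  potential for every labelling, so that closed paths carry the label zero.\<close>

lemma closed_path_heq_Nil:
  assumes natural: "\<And>x u v. x \<in> H \<Longrightarrow> (u, v) \<in> rels Q \<Longrightarrow>
      heq Q Y (path_act (nf x) [Edge [] (u, v) True []] [] @ \<tau> x v) (\<tau> x u)"
    and p: "dpath Q w p w"
  shows "heq Q Y p []"
proof (rule heqI[OF Q])
  fix \<theta> :: "'b edge \<Rightarrow> 'b edge list set sym_group"
  assume "sym_labelled Q Y \<theta>"
  then interpret sym_labelled Q Y \<theta> .
  \<comment> \<open>The potential of a word \<open>w\<close> is the label of
    \<open>\<tau> h0 w\<close>. Since that path starts at \<open>nf h0 @ w\<close>, the derivation
    \<open>p\<close> is first considered with \<open>nf h0\<close> in front.\<close>
  have potential: "val (nf h0) p [] = val [] (\<tau> h0 w) [] - val [] (\<tau> h0 w') []"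
    if "dpath Q w p w'" for w p w'
    using that
  proof (induction p arbitrary: w)
    case (Cons E p)
    then have E: "E \<in> dedges Q" "edge_src E = w" "dpath Q (edge_tgt E) p w'"
      using dpath_Cons[OF Q] by auto
    obtain \<alpha> u v \<epsilon> \<beta> where EE: "E = Edge \<alpha> (u, v) \<epsilon> \<beta>" by (cases E) auto
    then have r: "\<alpha> \<in> words Q" "(u, v) \<in> rels Q" "\<beta> \<in> words Q" using E(1) by (simp_all add: dedge_iff)
    then have uv: "u \<in> words Q" "v \<in> words Q" using Q unfolding presentation_def by auto
    let ?e = "[Edge [] (u, v) True []]" and ?x = "foldl act h0 \<alpha>"
    have x: "?x \<in> H" using foldl_act h0 r(1) by blast
    have e: "dpath Q u ?e v"
      using dpath_single[OF Q, of "Edge [] (u, v) True []"] r(2) by (simp add: dedge_iff)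
    have xuv: "foldl act h0 (\<alpha> @ u) = foldl act h0 (\<alpha> @ v)" using act_rel[OF x r(2)] by simp
    have nat: "val (nf ?x) ?e \<beta> + val [] (\<tau> ?x v) \<beta> = val [] (\<tau> ?x u) \<beta>"
      using val_heq[OF natural[OF x r(2)], of "[]" \<beta>] r(3) by (simp add: val_def)
    have ic: "val [] (\<tau> h0 \<alpha>) (u @ \<beta>) + val (nf ?x) ?e \<beta> = val (nf h0 @ \<alpha>) ?e \<beta> + val [] (\<tau> h0 \<alpha>) (v @ \<beta>)"
      using interchange0[OF \<tau>_path[OF h0 r(1)] e, of "[]" \<beta>] r(3) by simp
    let ?ru = "val [] (\<tau> h0 (\<alpha> @ u @ \<beta>)) []" and ?rv = "val [] (\<tau> h0 (\<alpha> @ v @ \<beta>)) []"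
    let ?t = "val [] (\<tau> (foldl act h0 (\<alpha> @ u)) \<beta>) []"
    have ru: "?ru = val [] (\<tau> h0 \<alpha>) (u @ \<beta>) + (val [] (\<tau> ?x u) \<beta> + ?t)"
      by (simp add: \<tau>_append)
    have rv: "?rv = val [] (\<tau> h0 \<alpha>) (v @ \<beta>) + (val [] (\<tau> ?x v) \<beta> + ?t)"
      using act_rel[OF x r(2)] by (simp add: \<tau>_append)
    have "?ru = (val [] (\<tau> h0 \<alpha>) (u @ \<beta>) + val (nf ?x) ?e \<beta>) + (val [] (\<tau> ?x v) \<beta> + ?t)"
      unfolding ru nat[symmetric] by (simp only: add.assoc)
    also have "\<dots> = val (nf h0 @ \<alpha>) ?e \<beta> + ?rv" unfolding ic rv by (simp only: add.assoc)
    finally have main: "val (nf h0 @ \<alpha>) ?e \<beta> = ?ru - ?rv" by simp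
    have "val (nf h0) [E] [] = val [] (\<tau> h0 (edge_src E)) [] - val [] (\<tau> h0 (edge_tgt E)) []"
    proof (cases \<epsilon>)
      case True
      then show ?thesis using main EE by (simp add: val_def)
    next
      case False
      have ED: "Edge (nf h0 @ \<alpha>) (u, v) True \<beta> \<in> dedges Q" using r nf[OF h0] by (simp add: dedge_iff)
      have "val (nf h0) [E] [] = \<theta> (edge_rev (Edge (nf h0 @ \<alpha>) (u, v) True \<beta>))"
        using EE False by (simp add: val_def)
      also have "\<dots> = - \<theta> (Edge (nf h0 @ \<alpha>) (u, v) True \<beta>)"
        using lab ED unfolding labelling_def by blast
      also have "\<dots> = - val (nf h0 @ \<alpha>) ?e \<beta>" by (simp add: val_def)
      finally show ?thesis using main EE False by simp
    qed
    then have "val (nf h0) (E # p) [] = (val [] (\<tau> h0 w) [] - val [] (\<tau> h0 (edge_tgt E)) []) +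
        (val [] (\<tau> h0 (edge_tgt E)) [] - val [] (\<tau> h0 w') [])"
      using val_append[of "nf h0" "[E]" p "[]"] Cons.IH[OF E(3)] E(2) by simp
    then show ?case by (simp add: add_diff_eq)
  qed simp
  \<comment> \<open>Sliding \<open>p\<close> past \<open>c0\<close> removes the prefix
    \<open>nf h0\<close>.\<close>
  have "val [] c0 w + val [] p [] = val (nf h0) p [] + val [] c0 w"
    using interchange0[OF c0 p, of "[]" "[]"] by simp
  also have "val (nf h0) p [] = 0" using potential[OF p] by simp
  finally have "val [] c0 w + val [] p [] = val [] c0 w + 0" by simp
  then show "val [] p [] = val [] [] []" by (simp only: add_left_cancel val_Nil)
qed

end

section \<open>The stabilizer of an H-class\<close>

locale h_class = monoid S for S (structure) +
  fixes H :: "'a set"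
  assumes H: "H \<in> carrier S // green_H S"
begin

abbreviation T :: "'a set" where "T \<equiv> right_stab S H"

lemma H_carrier: "x \<in> H \<Longrightarrow> x \<in> carrier S"
  using H by (auto elim!: quotientE simp: green_H_def green_R_def)

lemma H_green: "x \<in> H \<Longrightarrow> y \<in> H \<Longrightarrow> (x, y) \<in> green_H S"
  by (rule in_quotient_imp_in_rel[OF equiv_green_H H]) simp

lemma H_nonempty: "\<exists>x. x \<in> H"
  using H in_quotient_imp_non_empty[OF equiv_green_H] by blast

lemma green_R_iff:
  assumes "x \<in> carrier S" "y \<in> carrier S"
  shows "(x, y) \<in> green_R S \<longleftrightarrow> (\<exists>c\<in>carrier S. x \<otimes> c = y) \<and> (\<exists>d\<in>carrier S. y \<otimes> d = x)"
proof -
  have le: "x <#\<^bsub>S\<^esub> carrier S \<subseteq> y <#\<^bsub>S\<^esub> carrier S \<longleftrightarrow> (\<exists>d\<in>carrier S. y \<otimes> d = x)"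
    if "x \<in> carrier S" "y \<in> carrier S" for x y
  proof
    assume "x <#\<^bsub>S\<^esub> carrier S \<subseteq> y <#\<^bsub>S\<^esub> carrier S"
    moreover have "x \<in> x <#\<^bsub>S\<^esub> carrier S"
      using that unfolding l_coset_def by (intro UN_I[of \<one>]) simp_all
    ultimately have "x \<in> y <#\<^bsub>S\<^esub> carrier S" by blast
    then show "\<exists>d\<in>carrier S. y \<otimes> d = x" unfolding l_coset_def by auto
  next
    assume "\<exists>d\<in>carrier S. y \<otimes> d = x"
    then obtain d where d: "d \<in> carrier S" "x = y \<otimes> d" by blast
    show "x <#\<^bsub>S\<^esub> carrier S \<subseteq> y <#\<^bsub>S\<^esub> carrier S"
    proof
      fix z assume "z \<in> x <#\<^bsub>S\<^esub> carrier S"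
      then obtain e where "e \<in> carrier S" "z = x \<otimes> e" unfolding l_coset_def by blast
      then show "z \<in> y <#\<^bsub>S\<^esub> carrier S"
        using d that unfolding l_coset_def by (intro UN_I[of "d \<otimes> e"]) (simp_all add: m_assoc)
    qed
  qed
  then show ?thesis using assms by (auto simp: green_R_def set_eq_subset)
qed

lemma green_L_iff:
  assumes "x \<in> carrier S" "y \<in> carrier S"
  shows "(x, y) \<in> green_L S \<longleftrightarrow> (\<exists>c\<in>carrier S. c \<otimes> x = y) \<and> (\<exists>d\<in>carrier S. d \<otimes> y = x)"
proof -
  have le: "carrier S #>\<^bsub>S\<^esub> x \<subseteq> carrier S #>\<^bsub>S\<^esub> y \<longleftrightarrow> (\<exists>d\<in>carrier S. d \<otimes> y = x)"
    if "x \<in> carrier S" "y \<in> carrier S" for x y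
  proof
    assume "carrier S #>\<^bsub>S\<^esub> x \<subseteq> carrier S #>\<^bsub>S\<^esub> y"
    moreover have "x \<in> carrier S #>\<^bsub>S\<^esub> x"
      using that unfolding r_coset_def by (intro UN_I[of \<one>]) simp_all
    ultimately have "x \<in> carrier S #>\<^bsub>S\<^esub> y" by blast
    then show "\<exists>d\<in>carrier S. d \<otimes> y = x" unfolding r_coset_def by auto
  next
    assume "\<exists>d\<in>carrier S. d \<otimes> y = x"
    then obtain d where d: "d \<in> carrier S" "x = d \<otimes> y" by blast
    show "carrier S #>\<^bsub>S\<^esub> x \<subseteq> carrier S #>\<^bsub>S\<^esub> y"
    proof
      fix z assume "z \<in> carrier S #>\<^bsub>S\<^esub> x"
      then obtain e where "e \<in> carrier S" "z = e \<otimes> x" unfolding r_coset_def by blast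
      then show "z \<in> carrier S #>\<^bsub>S\<^esub> y"
        using d that unfolding r_coset_def by (intro UN_I[of "e \<otimes> d"]) (simp_all add: m_assoc)
    qed
  qed
  then show ?thesis using assms by (auto simp: green_L_def set_eq_subset)
qed

lemma R_trans: "x \<in> H \<Longrightarrow> y \<in> H \<Longrightarrow> \<exists>c\<in>carrier S. x \<otimes> c = y"
  using H_green green_R_iff H_carrier unfolding green_H_def by blast

lemma L_trans: "x \<in> H \<Longrightarrow> y \<in> H \<Longrightarrow> \<exists>c\<in>carrier S. c \<otimes> x = y"
  using H_green green_L_iff H_carrier unfolding green_H_def by blast

lemma H_I:
  assumes "x \<in> H" "y \<in> carrier S" "(x, y) \<in> green_R S" "(x, y) \<in> green_L S"
  shows "y \<in> H"
proof -
  have "(x, y) \<in> green_H S" using assms by (simp add: green_H_def)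
  then show ?thesis by (rule in_quotient_imp_closed[OF equiv_green_H H assms(1)])
qed

lemma T_carrier: "c \<in> T \<Longrightarrow> c \<in> carrier S"
  by (simp add: right_stab_def)

lemma H_T: "x \<in> H \<Longrightarrow> c \<in> T \<Longrightarrow> x \<otimes> c \<in> H"
  unfolding right_stab_def r_coset_def by blast

text \<open>Green's lemma in the form needed here: \<open>y = t \<otimes> x\<close> gives
  \<open>y \<otimes> c = t \<otimes> (x \<otimes> c)\<close>, so left multiplication by
  \<open>t\<close> transfers from \<open>x\<close> to \<open>y\<close> that \<open>d\<close> undoes
  \<open>c\<close>.\<close>

lemma H_translate:
  assumes "x \<in> H" "c \<in> carrier S" "x \<otimes> c \<in> H" "y \<in> H"
  shows "y \<otimes> c \<in> H"
proof -
  note [simp] = H_carrier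
  obtain d where d: "d \<in> carrier S" "x \<otimes> c \<otimes> d = x"
    using R_trans[OF assms(3,1)] by blast
  obtain t where t: "t \<in> carrier S" "t \<otimes> x = y" using L_trans[OF assms(1,4)] by blast
  obtain t' where t': "t' \<in> carrier S" "t' \<otimes> y = x" using L_trans[OF assms(4,1)] by blast
  have yS: "y \<in> carrier S" "y \<otimes> c \<in> carrier S" using assms by simp_all
  note ycS = yS(2)
  have y: "y \<otimes> c = t \<otimes> (x \<otimes> c)" using t assms by (simp add: m_assoc[symmetric])
  have "y \<otimes> c \<otimes> d = t \<otimes> (x \<otimes> c \<otimes> d)" unfolding y using t d assms by (simp add: m_assoc)
  then have "y \<otimes> c \<otimes> d = y" using d t by simp
  then have R: "(y, y \<otimes> c) \<in> green_R S"
    unfolding green_R_iff[OF yS] using assms(2) d(1) by blast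
  have "t' \<otimes> (y \<otimes> c) = x \<otimes> c" using t' assms by (simp add: m_assoc[symmetric])
  then have "(x \<otimes> c, y \<otimes> c) \<in> green_L S"
    unfolding green_L_iff[OF H_carrier[OF assms(3)] ycS] using y[symmetric] t(1) t'(1) by blast
  moreover have "(y, x \<otimes> c) \<in> green_L S" using H_green[OF assms(4,3)] unfolding green_H_def by blast
  moreover have "trans (green_L S)" using equiv_green_L[of S] by (simp add: equiv_def)
  ultimately have "(y, y \<otimes> c) \<in> green_L S" by (meson transD)
  then show ?thesis by (rule H_I[OF assms(4) ycS R])
qed

text \<open>All elements of \<open>H\<close> are left multiples of each other, so the effect of
  \<open>c\<close> on one of them decides membership in the stabilizer. Surjectivity of the
  translation uses that \<open>d\<close>, which undoes \<open>c\<close> at \<open>x\<close>, also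
  maps \<open>H\<close> into itself.\<close>

lemma T_I:
  assumes "x \<in> H" "c \<in> carrier S" "x \<otimes> c \<in> H"
  shows "c \<in> T"
proof -
  note [simp] = H_carrier
  obtain d where d: "d \<in> carrier S" "x \<otimes> c \<otimes> d = x"
    using R_trans[OF assms(3,1)] by blast
  have sub: "y \<otimes> c \<in> H" if "y \<in> H" for y using H_translate[OF assms that] .
  have sup: "\<exists>z\<in>H. z \<otimes> c = y" if "y \<in> H" for y
  proof -
    obtain q where q: "q \<in> carrier S" "q \<otimes> (x \<otimes> c) = y"
      using L_trans[OF assms(3) \<open>y \<in> H\<close>] by blast
    have "y \<otimes> d \<in> H" using H_translate[of "x \<otimes> c" d y] assms d \<open>y \<in> H\<close> by simp
    moreover have "y \<otimes> d \<otimes> c = q \<otimes> ((x \<otimes> c \<otimes> d) \<otimes> c)"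
      using q(1) d(1) assms by (simp add: q(2)[symmetric] m_assoc)
    then have "y \<otimes> d \<otimes> c = y" using d q by simp
    ultimately show ?thesis by blast
  qed
  have "H #>\<^bsub>S\<^esub> c = H"
    unfolding r_coset_def using sub sup by blast
  then show ?thesis using assms by (simp add: right_stab_def)
qed

lemma T_one: "\<one> \<in> T"
  using H_nonempty T_I[of _ \<one>] H_carrier by fastforce

lemma T_mult:
  assumes "c \<in> T" "d \<in> T"
  shows "c \<otimes> d \<in> T"
proof -
  obtain x where x: "x \<in> H" using H_nonempty by blast
  have "x \<otimes> (c \<otimes> d) = x \<otimes> c \<otimes> d" using x assms H_carrier T_carrier by (simp add: m_assoc)
  then show ?thesis using T_I[OF x, of "c \<otimes> d"] H_T x assms T_carrier by simp
qed

lemma T_pow: "c \<in> T \<Longrightarrow> c [^] (k::nat) \<in> T"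
  by (induction k) (auto intro: T_one T_mult)

lemma T_trans: "x \<in> H \<Longrightarrow> y \<in> H \<Longrightarrow> \<exists>c\<in>T. x \<otimes> c = y"
  using R_trans T_I by metis

lemma T_separate:
  assumes "x \<in> H" "c \<in> carrier S" "d \<in> carrier S" "x \<otimes> c = x \<otimes> d" "y \<in> H"
  shows "y \<otimes> c = y \<otimes> d"
proof -
  obtain t where t: "t \<in> carrier S" "t \<otimes> x = y" using L_trans[OF assms(1,5)] by blast
  have "t \<otimes> (x \<otimes> c) = t \<otimes> (x \<otimes> d)" using assms by simp
  then show ?thesis using t assms H_carrier m_assoc by metis
qed

text \<open>\<open>T\<close> itself is only a monoid. Its elements become invertible as maps of
  \<open>H\<close>, because \<open>T\<close> is transitive on \<open>H\<close> and agreement at one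
  point is agreement everywhere.\<close>

lemma T_inverse:
  assumes "c \<in> T"
  shows "\<exists>d\<in>T. \<forall>x\<in>H. x \<otimes> c \<otimes> d = x \<and> x \<otimes> d \<otimes> c = x"
proof -
  obtain x where x: "x \<in> H" using H_nonempty by blast
  obtain d where d: "d \<in> T" "x \<otimes> c \<otimes> d = x" using T_trans[OF H_T[OF x assms] x] by blast
  note car = T_carrier[OF assms] T_carrier[OF d(1)] H_carrier
  have cd: "y \<otimes> c \<otimes> d = y" if "y \<in> H" for y
    using T_separate[OF x _ _ _ that, of "c \<otimes> d" \<one>] d x that car by (simp add: m_assoc)
  have "y \<otimes> d \<otimes> c = y" if "y \<in> H" for y
  proof -
    have "x \<otimes> c \<otimes> (d \<otimes> c) = x \<otimes> c \<otimes> \<one>"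
      using d x car by (simp add: m_assoc[symmetric])
    then show ?thesis
      using T_separate[OF H_T[OF x assms] _ _ _ that, of "d \<otimes> c" \<one>] that car by (simp add: m_assoc)
  qed
  then show ?thesis using cd d by blast
qed

section \<open>Right \<open>T\<close>-orbits and the vertices\<close>

definition trel :: "'a \<Rightarrow> 'a \<Rightarrow> bool" where
  "trel x y \<longleftrightarrow> (\<exists>c\<in>T. x \<otimes> c = y) \<and> (\<exists>d\<in>T. y \<otimes> d = x)"

lemma trelI: "x \<otimes> c = y \<Longrightarrow> y \<otimes> d = x \<Longrightarrow> c \<in> T \<Longrightarrow> d \<in> T \<Longrightarrow> trel x y"
  unfolding trel_def by blast

lemma trel_refl: "x \<in> carrier S \<Longrightarrow> trel x x"
  by (rule trelI[of _ \<one> _ \<one>]) (simp_all add: T_one)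

lemma trel_sym: "trel x y \<Longrightarrow> trel y x"
  unfolding trel_def by blast

lemma dominated_trans:
  assumes "x \<in> carrier S" "\<exists>c\<in>T. x \<otimes> c = y" "\<exists>c\<in>T. y \<otimes> c = z"
  shows "\<exists>c\<in>T. x \<otimes> c = z"
  using assms T_mult m_assoc T_carrier by metis

lemma trel_trans: "x \<in> carrier S \<Longrightarrow> z \<in> carrier S \<Longrightarrow> trel x y \<Longrightarrow> trel y z \<Longrightarrow> trel x z"
  unfolding trel_def using dominated_trans by meson

lemma trel_left:
  assumes "trel x y" "x \<in> carrier S" "y \<in> carrier S" "a \<in> carrier S"
  shows "trel (a \<otimes> x) (a \<otimes> y)"
proof -
  obtain c d where "c \<in> T" "x \<otimes> c = y" "d \<in> T" "y \<otimes> d = x" using assms(1) unfolding trel_def by blast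
  then show ?thesis using assms T_carrier by (intro trelI[of _ c _ d]) (auto simp: m_assoc)
qed

lemma trel_H: "trel x y \<Longrightarrow> x \<in> carrier S \<Longrightarrow> \<alpha> \<in> carrier S \<Longrightarrow> \<alpha> \<otimes> x \<in> H \<Longrightarrow> \<alpha> \<otimes> y \<in> H"
  unfolding trel_def using H_T m_assoc T_carrier by metis

lemma H_trel: "x \<in> H \<Longrightarrow> y \<in> H \<Longrightarrow> trel x y"
  unfolding trel_def using T_trans by blast

definition vertices :: "'a \<Rightarrow> 'a set" where
  "vertices s = {y \<in> carrier S. (\<exists>t\<in>carrier S. y = t \<otimes> s) \<and> (\<exists>\<alpha>\<in>carrier S. \<alpha> \<otimes> y \<in> H)}"

end

locale pointwise_stab = h_class +
  fixes s :: 'a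
  assumes s: "s \<in> carrier S" and Hs: "x \<in> H \<Longrightarrow> x \<otimes> s = x"
begin

abbreviation V :: "'a set" where "V \<equiv> vertices s"

lemma V_carrier: "y \<in> V \<Longrightarrow> y \<in> carrier S"
  by (simp add: vertices_def)

lemma s_T: "s \<in> T"
proof -
  obtain x where "x \<in> H" using H_nonempty by blast
  then show ?thesis using T_I[of x s] s Hs by simp
qed

lemma Hs_pow: "x \<in> H \<Longrightarrow> x \<otimes> s [^] (k::nat) = x"
proof (induction k)
  case (Suc k)
  then show ?case using Hs s H_carrier by (simp add: m_assoc[symmetric])
qed (simp add: H_carrier)

lemma V_I: "t \<in> carrier S \<Longrightarrow> \<alpha> \<in> carrier S \<Longrightarrow> \<alpha> \<otimes> (t \<otimes> s) \<in> H \<Longrightarrow> t \<otimes> s \<in> V"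
  unfolding vertices_def using s by blast

lemma H_V: "x \<in> H \<Longrightarrow> x \<in> V"
  using V_I[of x \<one>] Hs[of x] H_carrier[of x] by simp

lemma s_V: "s \<in> V"
proof -
  obtain x where "x \<in> H" using H_nonempty by blast
  then show ?thesis using V_I[of \<one> x] Hs[of x] H_carrier[of x] s by simp
qed

lemma V_right_factor:
  assumes "a \<otimes> y \<in> V" "a \<in> carrier S" "y \<in> carrier S" "\<exists>t\<in>carrier S. y = t \<otimes> s"
  shows "y \<in> V"
proof -
  obtain \<alpha> where \<alpha>: "\<alpha> \<in> carrier S" "\<alpha> \<otimes> (a \<otimes> y) \<in> H" using assms(1) unfolding vertices_def by blast
  then have "\<alpha> \<otimes> a \<otimes> y \<in> H" using assms by (simp add: m_assoc)
  moreover have "\<alpha> \<otimes> a \<in> carrier S" using \<alpha>(1) assms(2) by simp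
  ultimately show ?thesis using assms(3,4) unfolding vertices_def by blast
qed

lemma V_left_ideal:
  assumes "y \<in> V" "a \<in> carrier S"
  shows "\<exists>t\<in>carrier S. a \<otimes> y = t \<otimes> s"
proof -
  obtain t where "t \<in> carrier S" "y = t \<otimes> s" using assms(1) unfolding vertices_def by blast
  then show ?thesis using s assms(2) by (intro bexI[of _ "a \<otimes> t"]) (simp_all add: m_assoc)
qed

lemma V_trel:
  assumes "y \<in> V" "y' \<in> V" "trel y y'" "a \<in> carrier S" "a \<otimes> y \<in> V"
  shows "a \<otimes> y' \<in> V"
proof -
  obtain \<alpha> where \<alpha>: "\<alpha> \<in> carrier S" "\<alpha> \<otimes> (a \<otimes> y) \<in> H" using assms(5) unfolding vertices_def by blast
  note car = V_carrier[OF assms(1)] V_carrier[OF assms(2)]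
  have "\<alpha> \<otimes> (a \<otimes> y') \<in> H"
    by (rule trel_H[OF trel_left[OF assms(3) car assms(4)] _ \<alpha>]) (use assms(4) car in simp)
  moreover have "a \<otimes> y' \<in> carrier S" using assms(4) car by simp
  ultimately show ?thesis
    using V_left_ideal[OF assms(2,4)] \<alpha>(1) unfolding vertices_def by blast
qed

text \<open>Along the sequence the right \<open>T\<close>-orbits descend. By finiteness two terms
  \<open>f k\<close> and \<open>f l\<close> with \<open>k < l\<close> have the same orbit, and
  \<open>f (Suc k)\<close> lies between them.\<close>

lemma descending_stabilizes:
  assumes fin: "finite (rp ` V)" and rp: "\<And>y y'. y \<in> V \<Longrightarrow> y' \<in> V \<Longrightarrow> rp y = rp y' \<Longrightarrow> trel y y'"
    and f: "\<And>k::nat. f k \<in> V" and step: "\<And>k. \<exists>c\<in>T. f k \<otimes> c = f (Suc k)"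
  shows "\<exists>k>0. trel (f k) (f (Suc k))"
proof -
  have "\<not> inj_on (rp \<circ> f) {0<..}"
  proof
    assume "inj_on (rp \<circ> f) {0<..}"
    moreover have "finite ((rp \<circ> f) ` {0<..})"
      by (rule finite_subset[OF _ fin]) (use f in auto)
    ultimately have "finite {0::nat<..}" by (rule finite_imageD[rotated])
    then show False using infinite_Ioi by blast
  qed
  then obtain k l where "0 < k" "k < l" "rp (f k) = rp (f l)"
    unfolding inj_on_def by (metis comp_apply greaterThan_iff linorder_neqE_nat)
  then have kl: "trel (f l) (f k)" "Suc k \<le> l" using rp f trel_sym by auto
  have down: "\<exists>c\<in>T. f (Suc k) \<otimes> c = f (Suc k + j)" for j
  proof (induction j)
    case 0
    then show ?case using trel_refl V_carrier f unfolding trel_def by (metis add_0_right)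
  next
    case (Suc j)
    show ?case using dominated_trans[OF _ Suc step] V_carrier f by simp
  qed
  have "\<exists>c\<in>T. f (Suc k) \<otimes> c = f l" using down[of "l - Suc k"] kl by simp
  moreover have "\<exists>c\<in>T. f l \<otimes> c = f k" using kl unfolding trel_def by blast
  ultimately have "\<exists>c\<in>T. f (Suc k) \<otimes> c = f k" using dominated_trans V_carrier f by blast
  then show ?thesis using step \<open>0 < k\<close> unfolding trel_def by blast
qed

end

text \<open>\<open>rp\<close> picks one vertex from every class. The conditions
  \<open>rp s = s\<close> and \<open>trel (s \<otimes> s) s\<close> make \<open>s\<close> a state at
  which a word for \<open>s\<close> reads as a loop.\<close>

locale state_choice = pointwise_stab +
  fixes rp :: "'a \<Rightarrow> 'a"
  assumes rp_V: "y \<in> V \<Longrightarrow> rp y \<in> V" and rp_trel: "y \<in> V \<Longrightarrow> trel y (rp y)"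
    and rp_eq: "y \<in> V \<Longrightarrow> y' \<in> V \<Longrightarrow> trel y y' \<Longrightarrow> rp y = rp y'"
    and rp_s: "rp s = s" and ss: "trel (s \<otimes> s) s" and fin: "finite (rp ` V)"
begin

lemma rp_eqD: "y \<in> V \<Longrightarrow> y' \<in> V \<Longrightarrow> rp y = rp y' \<Longrightarrow> trel y y'"
  using rp_trel trel_trans trel_sym V_carrier by metis

lemma trel_ys:
  assumes "y \<in> carrier S" "\<exists>t\<in>carrier S. y = t \<otimes> s"
  shows "trel (y \<otimes> s) y"
proof -
  obtain t where t: "t \<in> carrier S" "y = t \<otimes> s" using assms(2) by blast
  show ?thesis using trel_left[OF ss _ _ t(1)] s t by (simp add: m_assoc)
qed

text \<open>Two elements with the same \<open>T\<close>-class are obtained from a common vertex \<open>f\<close>, which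
  plays the role of an idempotent fixing \<open>y\<close>. It is found far down a descending chain of
  vertices \<open>s \<otimes> q\<^sup>k\<close>.\<close>

lemma common_factor:
  assumes "trel y y'" "y \<in> carrier S" "y' \<in> carrier S"
    and ideal: "\<exists>t\<in>carrier S. y = t \<otimes> s" "\<exists>t\<in>carrier S. y' = t \<otimes> s"
  shows "\<exists>f m n. f \<in> V \<and> m \<in> carrier S \<and> n \<in> carrier S \<and> trel (m \<otimes> s) f \<and> trel (n \<otimes> s) f \<and>
    m \<otimes> s \<in> V \<and> n \<otimes> s \<in> V \<and> trel (y \<otimes> f) y \<and> y \<otimes> m = y \<and> y \<otimes> n = y'"
proof -
  note [simp] = T_carrier H_carrier s
  obtain z d where z: "z \<in> T" "y \<otimes> z = y'" and d: "d \<in> T" "y' \<otimes> d = y"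
    using assms(1) unfolding trel_def by blast
  obtain c where c: "c \<in> T" "y \<otimes> s \<otimes> c = y" using trel_ys[OF assms(2) ideal(1)] unfolding trel_def by blast
  obtain c' where c': "c' \<in> T" "y' \<otimes> s \<otimes> c' = y'" using trel_ys[OF assms(3) ideal(2)] unfolding trel_def by blast
  \<comment> \<open>The round trip \<open>y\<close>, \<open>y s\<close>, \<open>y\<close>,
    \<open>y'\<close>, \<open>y' s\<close>, \<open>y'\<close>, \<open>y\<close>: multiplication of
    \<open>y\<close> by \<open>s \<otimes> g\<close> runs through it and so fixes \<open>y\<close>.
    The detours provide a factor \<open>s\<close> both at \<open>y\<close> and at
    \<open>y'\<close>.\<close>
  define g where "g = c \<otimes> z \<otimes> s \<otimes> c' \<otimes> d"
  have g: "g \<in> T" unfolding g_def by (intro T_mult s_T z(1) d(1) c(1) c'(1))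
  define f0 where "f0 = s \<otimes> g"
  have f0: "f0 \<in> T" unfolding f0_def by (intro T_mult g s_T)
  have "y \<otimes> f0 = (((y \<otimes> s \<otimes> c) \<otimes> z) \<otimes> s \<otimes> c') \<otimes> d"
    unfolding f0_def g_def using z(1) d(1) c(1) c'(1) assms(2) by (simp add: m_assoc)
  then have yf0: "y \<otimes> f0 = y" using z d c c' by simp
  have yf0k: "y \<otimes> f0 [^] k = y" for k :: nat
  proof (induction k)
    case (Suc k)
    have "y \<otimes> f0 [^] Suc k = y \<otimes> f0 [^] k \<otimes> f0" using f0 assms(2) by (simp add: m_assoc)
    then show ?case using Suc yf0 by simp
  qed (use assms(2) in simp)
  \<comment> \<open>Moving \<open>s\<close> to the front turns \<open>f0 [^] k \<otimes> s\<close>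
    into \<open>s \<otimes> q [^] k\<close>, a chain that descends by right multiplication with
    \<open>q \<in> T\<close>.\<close>
  define q where "q = g \<otimes> s"
  have q: "q \<in> T" unfolding q_def by (intro T_mult g s_T)
  have comm: "f0 [^] k \<otimes> s = s \<otimes> q [^] k" for k :: nat
  proof (induction k)
    case (Suc k)
    have "f0 [^] Suc k \<otimes> s = f0 [^] k \<otimes> s \<otimes> (g \<otimes> s)"
      using f0 g by (simp add: f0_def m_assoc)
    then show ?case using Suc q g by (simp add: q_def m_assoc)
  qed simp
  have inV: "t \<otimes> s \<in> V" if "t \<in> T" for t
  proof -
    obtain x where x: "x \<in> H" using H_nonempty by blast
    show ?thesis using V_I[of t x] H_T[OF x T_mult[OF that s_T]] that x by simp
  qed
  have chainV: "f0 [^] k \<otimes> s \<in> V" for k :: nat using inV T_pow f0 by blast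
  have "\<exists>k>0. trel (f0 [^] k \<otimes> s) (f0 [^] (Suc k) \<otimes> s)"
  proof (rule descending_stabilizes[OF fin rp_eqD])
    fix k
    have "f0 [^] k \<otimes> s \<otimes> q = f0 [^] Suc k \<otimes> s" unfolding comm using q by (simp add: m_assoc)
    then show "\<exists>c\<in>T. f0 [^] k \<otimes> s \<otimes> c = f0 [^] Suc k \<otimes> s" using q by blast
  qed (use chainV in auto)
  then obtain k :: nat where k: "trel (f0 [^] k \<otimes> s) (f0 [^] (Suc k) \<otimes> s)" by blast
  define f where "f = f0 [^] k \<otimes> s"
  define m where "m = f0 [^] k"
  \<comment> \<open>\<open>m\<close> keeps \<open>y\<close> fixed; \<open>n\<close> continues from
    there to \<open>y'\<close> through the first half of the round trip.\<close>
  define n where "n = f0 [^] k \<otimes> s \<otimes> c \<otimes> z"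
  have mT: "m \<in> T" unfolding m_def by (rule T_pow[OF f0])
  have fT: "f \<in> T" unfolding f_def by (intro T_mult T_pow f0 s_T)
  have nT: "n \<in> T" unfolding n_def by (intro T_mult T_pow f0 s_T c(1) z(1))
  have ms: "m \<otimes> s = f" by (simp add: m_def f_def)
  have "y \<otimes> f = y \<otimes> s" unfolding f_def using yf0k[of k] f0 assms(2) by (simp add: m_assoc[symmetric])
  then have yf: "trel (y \<otimes> f) y" using trel_ys[OF assms(2) ideal(1)] by simp
  have ym: "y \<otimes> m = y" unfolding m_def by (rule yf0k)
  have "y \<otimes> n = (y \<otimes> f0 [^] k) \<otimes> s \<otimes> c \<otimes> z"
    unfolding n_def using f0 c(1) z(1) assms(2) by (simp add: m_assoc)
  then have yn: "y \<otimes> n = y'" using yf0k c z by simp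
  have "f \<otimes> (c \<otimes> z \<otimes> s) = n \<otimes> s"
    unfolding f_def n_def using f0 c(1) z(1) by (simp add: m_assoc)
  then have fn: "\<exists>r\<in>T. f \<otimes> r = n \<otimes> s" using T_mult c(1) z(1) s_T by blast
  \<comment> \<open>The second half of the round trip leads on to the next term of the chain, so
    \<open>n \<otimes> s\<close> lies between two terms whose classes agree.\<close>
  have "n \<otimes> s \<otimes> (c' \<otimes> d \<otimes> s) = f0 [^] Suc k \<otimes> s"
    unfolding n_def using f0 c(1) z(1) c'(1) d(1) g by (simp add: m_assoc f0_def g_def)
  then have "\<exists>r\<in>T. n \<otimes> s \<otimes> r = f0 [^] Suc k \<otimes> s" using T_mult c'(1) d(1) s_T by blast
  moreover have "\<exists>r\<in>T. f0 [^] Suc k \<otimes> s \<otimes> r = f" using k unfolding trel_def f_def by blast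
  ultimately have "\<exists>r\<in>T. n \<otimes> s \<otimes> r = f" using dominated_trans[of "n \<otimes> s"] nT by simp
  then have ns: "trel (n \<otimes> s) f" using fn unfolding trel_def by blast
  have "trel (m \<otimes> s) f" unfolding ms using trel_refl fT by simp
  then show ?thesis
    using ns yf ym yn inV[OF mT] inV[OF nT] T_carrier[OF mT] T_carrier[OF nT] ms by metis
qed

end

section \<open>A presentation of the Schutzenberger group\<close>

text \<open>The encoding \<open>enc\<close> of letter, state and sign as one letter is a parameter,
  so that the alphabet of the new presentation can be taken inside the natural numbers.\<close>

locale squier_transfer = state_choice S H s rp
  for S :: "('a, 'm) monoid_scheme" (structure) and H s rp +
  fixes P :: "'c presentation" and ev :: "'c list \<Rightarrow> 'a" and sw :: "'c list"
    and enc :: "'c \<Rightarrow> 'a \<Rightarrow> bool \<Rightarrow> 'b"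
  assumes P: "presentation P"
    and ev_closed: "u \<in> words P \<Longrightarrow> ev u \<in> carrier S"
    and ev_Nil: "ev [] = \<one>"
    and ev_append: "u \<in> words P \<Longrightarrow> v \<in> words P \<Longrightarrow> ev (u @ v) = ev u \<otimes> ev v"
    and ev_surj: "x \<in> carrier S \<Longrightarrow> \<exists>u\<in>words P. ev u = x"
    and ev_eq: "u \<in> words P \<Longrightarrow> v \<in> words P \<Longrightarrow> ev u = ev v \<longleftrightarrow> (u, v) \<in> presentation_cong P"
    and sw: "sw \<in> words P" and ev_sw: "ev sw = s"
    and enc_inj: "inj_on (\<lambda>(a, o', b). enc a o' b) (letters P \<times> rp ` V \<times> UNIV)"
begin

section \<open>States and the reading of words from the right\<close>

definition Ob :: "'a set" where "Ob = rp ` V"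

lemma rp_Ob: "y \<in> V \<Longrightarrow> rp y \<in> Ob"
  by (simp add: Ob_def)

lemma finite_Ob: "finite Ob"
  unfolding Ob_def by (rule fin)

lemma O_V: "p \<in> Ob \<Longrightarrow> p \<in> V"
  unfolding Ob_def using rp_V by blast

lemma O_carrier: "p \<in> Ob \<Longrightarrow> p \<in> carrier S"
  using O_V V_carrier by blast

lemma rp_O:
  assumes "p \<in> Ob"
  shows "rp p = p"
proof -
  obtain y where y: "y \<in> V" "p = rp y" using assms unfolding Ob_def by blast
  then show ?thesis using rp_eq[OF y(1) rp_V[OF y(1)] rp_trel[OF y(1)]] by simp
qed

lemma s_O: "s \<in> Ob"
  using rp_Ob[OF s_V] by (simp add: rp_s)

text \<open>Words are read from the right: \<open>st U p\<close> is the state reached from \<open>p\<close>, and a letter of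
  \<open>\<phi> U p\<close> records the letter of \<open>U\<close> together with the state from which it is read.\<close>

definition st :: "'c list \<Rightarrow> 'a \<Rightarrow> 'a" where
  "st U p = rp (ev U \<otimes> p)"

text \<open>Only the final product is required to be a vertex. By \<open>ok_suffix\<close> all
  intermediate products then are vertices too, because right factors of a vertex that lie in the
  left ideal of \<open>s\<close> are vertices.\<close>

definition ok :: "'c list \<Rightarrow> 'a \<Rightarrow> bool" where
  "ok U p \<longleftrightarrow> U \<in> words P \<and> p \<in> Ob \<and> ev U \<otimes> p \<in> V"

primrec \<phi> :: "'c list \<Rightarrow> 'a \<Rightarrow> 'b list" where
  "\<phi> [] p = []"
| "\<phi> (a # U) p = enc a (st U p) True # \<phi> U p"

lemma ok_words: "ok U p \<Longrightarrow> U \<in> words P"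
  and ok_O: "ok U p \<Longrightarrow> p \<in> Ob"
  and ok_V: "ok U p \<Longrightarrow> ev U \<otimes> p \<in> V"
  by (simp_all add: ok_def)

lemma ok_Nil [simp]: "ok [] p \<longleftrightarrow> p \<in> Ob"
  by (auto simp: ok_def ev_Nil O_V O_carrier)

lemma st_Nil [simp]: "p \<in> Ob \<Longrightarrow> st [] p = p"
  using O_carrier rp_O by (simp add: st_def ev_Nil)

lemma st_O: "ok U p \<Longrightarrow> st U p \<in> Ob"
  by (simp add: ok_def st_def rp_Ob)

lemma ev_append_assoc:
  "U \<in> words P \<Longrightarrow> W \<in> words P \<Longrightarrow> x \<in> carrier S \<Longrightarrow> ev (U @ W) \<otimes> x = ev U \<otimes> (ev W \<otimes> x)"
  by (simp add: ev_append ev_closed m_assoc)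

lemma ok_suffix:
  assumes "ok (U @ W) p"
  shows "ok W p"
proof -
  have UW: "U \<in> words P" "W \<in> words P" "p \<in> Ob" using assms by (auto simp: ok_def)
  have "ev U \<otimes> (ev W \<otimes> p) \<in> V" using ok_V[OF assms] UW O_carrier by (simp add: ev_append_assoc)
  then have "ev W \<otimes> p \<in> V"
    by (rule V_right_factor) (use UW ev_closed O_carrier V_left_ideal[OF O_V] in auto)
  then show ?thesis using UW by (simp add: ok_def)
qed

lemma ok_st_iff:
  assumes "ok W p" "U \<in> words P"
  shows "ok (U @ W) p \<longleftrightarrow> ok U (st W p)"
proof -
  have W: "W \<in> words P" "p \<in> Ob" "ev W \<otimes> p \<in> V" using assms(1) by (auto simp: ok_def)
  have "ev U \<otimes> (ev W \<otimes> p) \<in> V \<longleftrightarrow> ev U \<otimes> rp (ev W \<otimes> p) \<in> V"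
    using V_trel[OF W(3) rp_V[OF W(3)] rp_trel[OF W(3)] ev_closed[OF assms(2)]]
      V_trel[OF rp_V[OF W(3)] W(3) trel_sym[OF rp_trel[OF W(3)]] ev_closed[OF assms(2)]] by blast
  then show ?thesis using W assms(2) O_carrier rp_Ob[OF W(3)] by (simp add: ok_def st_def ev_append_assoc)
qed

lemma ok_append: "ok (U @ W) p \<longleftrightarrow> U \<in> words P \<and> ok W p \<and> ok U (st W p)"
proof
  assume a: "ok (U @ W) p"
  have "U \<in> words P" using ok_words[OF a] by simp
  then show "U \<in> words P \<and> ok W p \<and> ok U (st W p)" using ok_suffix[OF a] ok_st_iff a by simp
next
  assume "U \<in> words P \<and> ok W p \<and> ok U (st W p)"
  then show "ok (U @ W) p" using ok_st_iff by simp
qed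

lemma ok_appendD:
  assumes "ok (U @ W) p"
  shows "U \<in> words P" "ok W p" "ok U (st W p)"
  using assms ok_append[of U W p] by simp_all

lemma st_append:
  assumes "ok (U @ W) p"
  shows "st (U @ W) p = st U (st W p)"
proof -
  have ok: "U \<in> words P" "ok W p" "ok U (st W p)" using ok_appendD[OF assms] by simp_all
  then have W: "W \<in> words P" "p \<in> Ob" "ev W \<otimes> p \<in> V" by (auto simp: ok_def)
  have "trel (ev U \<otimes> (ev W \<otimes> p)) (ev U \<otimes> st W p)"
    unfolding st_def by (rule trel_left[OF rp_trel[OF W(3)]]) (use W(3) ok(1) rp_V V_carrier ev_closed in auto)
  then have "rp (ev U \<otimes> (ev W \<otimes> p)) = rp (ev U \<otimes> st W p)"
    by (intro rp_eq) (use assms ok W O_carrier in \<open>auto simp: ok_def ev_append_assoc\<close>)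
  then show ?thesis using ok W O_carrier by (simp add: st_def[of "U @ W"] st_def[of U] ev_append_assoc)
qed

lemma \<phi>_append: "ok (U @ W) p \<Longrightarrow> \<phi> (U @ W) p = \<phi> U (st W p) @ \<phi> W p"
proof (induction U)
  case (Cons a U)
  then have "ok (U @ W) p" using ok_appendD(2)[of "[a]" "U @ W" p] by simp
  then show ?case using Cons.IH st_append by simp
qed simp

section \<open>Generators and relations for the group\<close>

definition edge :: "'c \<Rightarrow> 'a \<Rightarrow> bool" where
  "edge a p \<longleftrightarrow> a \<in> letters P \<and> ok [a] p"

abbreviation pos :: "'c \<Rightarrow> 'a \<Rightarrow> 'b" where "pos a p \<equiv> enc a p True"
abbreviation neg :: "'c \<Rightarrow> 'a \<Rightarrow> 'b" where "neg a p \<equiv> enc a p False"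

lemma edge_O: "edge a p \<Longrightarrow> p \<in> Ob"
  by (simp add: edge_def ok_def)

lemma edge_word: "edge a p \<Longrightarrow> [a] \<in> words P"
  by (simp add: edge_def)

lemma edge_ok: "edge a p \<Longrightarrow> ok [a] p"
  by (simp add: edge_def)

lemma ok_Cons_edge:
  assumes "ok (a # U) p"
  shows "edge a (st U p)" "ok U p" "st (a # U) p = st [a] (st U p)"
  using assms ok_append[of "[a]" U p] st_append[of "[a]" U p] by (auto simp: edge_def)

text \<open>A path in the state graph from \<open>s\<close> to each state. Setting these paths to 1
  plays the part that collapsing a spanning tree has in the computation of a fundamental group. The
  empty path is taken for \<open>s\<close>, so that the relation for \<open>s\<close> gives a loop
  at the empty word.\<close>

definition \<kappa> :: "'a \<Rightarrow> 'c list" where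
  "\<kappa> p = (if p = s then [] else SOME w. w \<in> words P \<and> ev w \<otimes> s = p)"

definition Q :: "'b presentation" where
  "Q = \<lparr>letters = {enc a p \<epsilon> | a p \<epsilon>. edge a p},
    rels = {([pos a p, neg a p], []) | a p. edge a p} \<union>
      {([neg a p, pos a p], []) | a p. edge a p} \<union>
      {(\<phi> u p, \<phi> v p) | u v p. (u, v) \<in> rels P \<and> ok u p} \<union>
      {(\<phi> (\<kappa> p) s, []) | p. p \<in> Ob}\<rparr>"

lemma \<kappa>:
  assumes "p \<in> Ob"
  shows "\<kappa> p \<in> words P" "ev (\<kappa> p) \<otimes> s = p" "ok (\<kappa> p) s" "st (\<kappa> p) s = p"
proof -
  have ex: "\<exists>w. w \<in> words P \<and> ev w \<otimes> s = p"
  proof -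
    obtain t where "t \<in> carrier S" "p = t \<otimes> s" using O_V[OF assms] unfolding vertices_def by blast
    then show ?thesis using ev_surj by blast
  qed
  have "\<kappa> p \<in> words P \<and> ev (\<kappa> p) \<otimes> s = p"
  proof (cases "p = s")
    case True
    then show ?thesis using s by (simp add: \<kappa>_def ev_Nil)
  next
    case False
    then show ?thesis using someI_ex[OF ex] by (simp add: \<kappa>_def)
  qed
  then show "\<kappa> p \<in> words P" "ev (\<kappa> p) \<otimes> s = p" "ok (\<kappa> p) s" "st (\<kappa> p) s = p"
    using s_O O_V[OF assms] rp_O[OF assms] by (auto simp: ok_def st_def)
qed

lemma \<kappa>_s [simp]: "\<kappa> s = []"
  by (simp add: \<kappa>_def)

lemma ss_V: "s \<otimes> s \<in> V"
proof -
  obtain x where "x \<in> H" using H_nonempty by blast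
  then show ?thesis using V_I[OF s, of x] Hs[of x] H_carrier[of x] s by (simp add: m_assoc[symmetric])
qed

lemma sw_ok: "ok sw s" and sw_st: "st sw s = s"
  using sw ev_sw s_O ss_V rp_eq[OF ss_V s_V ss] rp_s by (auto simp: ok_def st_def)

lemma pos_letters: "edge a p \<Longrightarrow> enc a p \<epsilon> \<in> letters Q"
  by (auto simp: Q_def)

lemma \<phi>_words: "ok U p \<Longrightarrow> \<phi> U p \<in> words Q"
proof (induction U)
  case (Cons a U)
  then show ?case using ok_Cons_edge[of a U p] pos_letters by simp
qed simp

lemma P_rel:
  assumes "(u, v) \<in> rels P"
  shows "u \<in> words P" "v \<in> words P" "ev u = ev v"
proof -
  show uv: "u \<in> words P" "v \<in> words P" using P assms by (auto simp: presentation_def)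
  show "ev u = ev v"
    using ev_eq[OF uv] rels_subset_presentation_cong[OF P] assms by blast
qed

lemma ok_cong: "ev U = ev W \<Longrightarrow> U \<in> words P \<Longrightarrow> W \<in> words P \<Longrightarrow> ok U p \<longleftrightarrow> ok W p"
  by (simp add: ok_def)

lemma st_cong: "ev U = ev W \<Longrightarrow> st U p = st W p"
  by (simp add: st_def)

lemma P_rel_ok: "(u, v) \<in> rels P \<Longrightarrow> ok u p \<longleftrightarrow> ok v p"
  using P_rel ok_cong by metis

lemma P_rel_st: "(u, v) \<in> rels P \<Longrightarrow> st u p = st v p"
  using P_rel st_cong by metis

lemma Q_rels:
  "edge a p \<Longrightarrow> ([pos a p, neg a p], []) \<in> rels Q"
  "edge a p \<Longrightarrow> ([neg a p, pos a p], []) \<in> rels Q"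
  "(u, v) \<in> rels P \<Longrightarrow> ok u p \<Longrightarrow> (\<phi> u p, \<phi> v p) \<in> rels Q"
  "p \<in> Ob \<Longrightarrow> (\<phi> (\<kappa> p) s, []) \<in> rels Q"
  unfolding Q_def presentation.simps by blast+

lemma Q_rels_cases:
  assumes "(x, y) \<in> rels Q"
  obtains (A) a p where "edge a p" "x = [pos a p, neg a p]" "y = []"
  | (B) a p where "edge a p" "x = [neg a p, pos a p]" "y = []"
  | (R) u v p where "(u, v) \<in> rels P" "ok u p" "x = \<phi> u p" "y = \<phi> v p"
  | (C) p where "p \<in> Ob" "x = \<phi> (\<kappa> p) s" "y = []"
proof -
  have "(x, y) \<in> {([pos a p, neg a p], []) | a p. edge a p} \<union>
      {([neg a p, pos a p], []) | a p. edge a p} \<union>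
      {(\<phi> u p, \<phi> v p) | u v p. (u, v) \<in> rels P \<and> ok u p} \<union>
      {(\<phi> (\<kappa> p) s, []) | p. p \<in> Ob}"
    using assms by (simp only: Q_def presentation.simps)
  then show thesis using A B R C by blast
qed

lemma Q: "presentation Q"
  unfolding presentation_def
proof (rule subrelI)
  fix x y assume "(x, y) \<in> rels Q"
  then show "(x, y) \<in> words Q \<times> words Q"
  proof (cases rule: Q_rels_cases)
    case (R u v p)
    then show ?thesis using \<phi>_words P_rel_ok by simp
  next
    case (C p)
    then show ?thesis using \<phi>_words \<kappa>(3) by simp
  qed (simp_all add: pos_letters)
qed

lemma edge_finite:
  assumes "finite (letters P)"
  shows "finite {(a, p). edge a p}"
  by (rule finite_subset[of _ "letters P \<times> Ob"]) (use assms finite_Ob edge_O in \<open>auto simp: edge_def\<close>)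

lemma Q_finite:
  assumes "finite_presentation P"
  shows "finite_presentation Q"
proof -
  have f: "finite (letters P)" "finite (rels P)" using assms by (auto simp: finite_presentation_def)
  note E = edge_finite[OF f(1)]
  have "letters Q = (\<lambda>((a, p), \<epsilon>). enc a p \<epsilon>) ` ({(a, p). edge a p} \<times> UNIV)"
    unfolding Q_def by force
  then have 1: "finite (letters Q)" using E by simp
  have "{([pos a p, neg a p], [] :: 'b list) | a p. edge a p} = (\<lambda>(a, p). ([pos a p, neg a p], [])) ` {(a, p). edge a p}"
    by force
  then have 2: "finite {([pos a p, neg a p], [] :: 'b list) | a p. edge a p}"
    by (simp only: finite_imageI[OF E])
  have "{([neg a p, pos a p], [] :: 'b list) | a p. edge a p} = (\<lambda>(a, p). ([neg a p, pos a p], [])) ` {(a, p). edge a p}"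
    by force
  then have fin_neg: "finite {([neg a p, pos a p], [] :: 'b list) | a p. edge a p}"
    by (simp only: finite_imageI[OF E])
  have "{(\<phi> u p, \<phi> v p) | u v p. (u, v) \<in> rels P \<and> ok u p} \<subseteq> (\<lambda>((u, v), p). (\<phi> u p, \<phi> v p)) ` (rels P \<times> Ob)"
  proof
    fix z assume "z \<in> {(\<phi> u p, \<phi> v p) | u v p. (u, v) \<in> rels P \<and> ok u p}"
    then obtain u v p where z: "z = (\<phi> u p, \<phi> v p)" "(u, v) \<in> rels P" "ok u p" by blast
    show "z \<in> (\<lambda>((u, v), p). (\<phi> u p, \<phi> v p)) ` (rels P \<times> Ob)"
      by (rule image_eqI[of _ _ "((u, v), p)"]) (use z ok_O in simp_all)
  qed
  then have 3: "finite {(\<phi> u p, \<phi> v p) | u v p. (u, v) \<in> rels P \<and> ok u p}"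
    by (rule finite_subset) (use f finite_Ob in simp)
  have 4: "finite {(\<phi> (\<kappa> p) s, [] :: 'b list) | p. p \<in> Ob}" using finite_Ob by simp
  have "finite (rels Q)" unfolding Q_def using 2 fin_neg 3 4 by simp
  then show ?thesis using 1 Q by (simp add: finite_presentation_def)
qed

subsection \<open>Reading derivations\<close>

text \<open>Each factor of a derivation step is read from the state reached by what stands to its
  right. Both sides of a relation have the same value, so the state from which
  \<open>\<alpha>\<close> is read is the same before and after the step.\<close>

fun \<Phi>e :: "'c edge \<Rightarrow> 'a \<Rightarrow> 'b edge" where
  "\<Phi>e (Edge \<alpha> r \<epsilon> \<beta>) p = Edge (\<phi> \<alpha> (st (rel_side r \<epsilon> @ \<beta>) p))
     (\<phi> (fst r) (st \<beta> p), \<phi> (snd r) (st \<beta> p)) \<epsilon> (\<phi> \<beta> p)"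

definition \<Phi> :: "'c edge list \<Rightarrow> 'a \<Rightarrow> 'b edge list" where
  "\<Phi> q p = map (\<lambda>E. \<Phi>e E p) q"

lemma \<Phi>_Nil [simp]: "\<Phi> [] p = []"
  and \<Phi>_Cons [simp]: "\<Phi> (E # q) p = \<Phi>e E p # \<Phi> q p"
  and \<Phi>_append [simp]: "\<Phi> (q @ r) p = \<Phi> q p @ \<Phi> r p"
  by (simp_all add: \<Phi>_def)

lemma path_ev:
  assumes "dpath P U q W"
  shows "ev U = ev W"
proof -
  have "(U, W) \<in> presentation_cong P" using assms path_presentation_cong[OF P] by blast
  then show ?thesis using ev_eq dpath_ends[OF P assms] by simp
qed

lemma edge_ev: "E \<in> dedges P \<Longrightarrow> ev (edge_src E) = ev (edge_tgt E)"
  by (rule path_ev[OF dpath_single[OF P]])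

lemma path_ok:
  assumes "dpath P U q W"
  shows "ok U p \<longleftrightarrow> ok W p"
  by (rule ok_cong[OF path_ev[OF assms] dpath_ends[OF P assms]])

lemma edge_ok_tgt: "E \<in> dedges P \<Longrightarrow> ok (edge_tgt E) p \<longleftrightarrow> ok (edge_src E) p"
  using path_ok[OF dpath_single[OF P]] by blast

lemma edge_split:
  assumes "Edge \<alpha> r \<epsilon> \<beta> \<in> dedges P" "ok (\<alpha> @ rel_side r \<epsilon> @ \<beta>) p"
  shows "ok \<beta> p" "ok (rel_side r \<delta>) (st \<beta> p)" "ok \<alpha> (st (rel_side r \<delta> @ \<beta>) p)"
    "st (rel_side r \<delta> @ \<beta>) p = st (rel_side r \<epsilon> @ \<beta>) p" "ok (\<alpha> @ rel_side r \<delta> @ \<beta>) p"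
    "st (rel_side r \<delta>) (st \<beta> p) = st (rel_side r \<epsilon> @ \<beta>) p"
proof -
  have r: "(fst r, snd r) \<in> rels P" using assms(1) by (simp add: dedge_iff)
  have side: "rel_side r \<delta> \<in> words P" "rel_side r \<epsilon> \<in> words P" "ev (rel_side r \<delta>) = ev (rel_side r \<epsilon>)"
    using P_rel[OF r] by (cases \<delta>; cases \<epsilon>; simp)+
  have b: "\<beta> \<in> words P" "\<alpha> \<in> words P" using assms(1) by (simp_all add: dedge_iff)
  have *: "ok \<alpha> (st (rel_side r \<epsilon> @ \<beta>) p)" "ok (rel_side r \<epsilon> @ \<beta>) p" "ok (rel_side r \<epsilon>) (st \<beta> p)" "ok \<beta> p"
    using ok_appendD[OF assms(2)] ok_appendD(2,3)[of "rel_side r \<epsilon>" \<beta> p] by simp_all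
  show "ok \<beta> p" by fact
  show ok_side: "ok (rel_side r \<delta>) (st \<beta> p)" using *(3) ok_cong[OF side(3,1,2)] by blast
  have ev_eq: "ev (rel_side r \<delta> @ \<beta>) = ev (rel_side r \<epsilon> @ \<beta>)" using side b by (simp add: ev_append)
  then show st_eq: "st (rel_side r \<delta> @ \<beta>) p = st (rel_side r \<epsilon> @ \<beta>) p" by (rule st_cong)
  then show "ok \<alpha> (st (rel_side r \<delta> @ \<beta>) p)" using *(1) by simp
  then show "ok (\<alpha> @ rel_side r \<delta> @ \<beta>) p" using ok_side *(4) b side by (simp add: ok_append)
  show "st (rel_side r \<delta>) (st \<beta> p) = st (rel_side r \<epsilon> @ \<beta>) p"
    using st_append[OF *(2)] st_cong[OF side(3)] by simp
qed

lemma \<Phi>e: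
  assumes "E \<in> dedges P" "ok (edge_src E) p"
  shows "\<Phi>e E p \<in> dedges Q" "edge_src (\<Phi>e E p) = \<phi> (edge_src E) p" "edge_tgt (\<Phi>e E p) = \<phi> (edge_tgt E) p"
    "\<Phi>e (edge_rev E) p = edge_rev (\<Phi>e E p)"
proof -
  obtain \<alpha> r \<epsilon> \<beta> where E: "E = Edge \<alpha> r \<epsilon> \<beta>" by (cases E)
  have r: "(fst r, snd r) \<in> rels P" using assms(1) E by (simp add: dedge_iff)
  note sp = edge_split[OF assms(1)[unfolded E], of p]
  have ok: "ok (\<alpha> @ rel_side r \<epsilon> @ \<beta>) p" using assms(2) E by simp
  have u: "ok (fst r) (st \<beta> p)" using sp(2)[OF ok, of True] by simp
  then have "(\<phi> (fst r) (st \<beta> p), \<phi> (snd r) (st \<beta> p)) \<in> rels Q"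
    by (rule Q_rels(3)[OF r])
  then show "\<Phi>e E p \<in> dedges Q"
    using \<phi>_words sp(1)[OF ok] sp(3)[OF ok, of \<epsilon>] E by (simp add: dedge_iff)
  have side: "rel_side (\<phi> (fst r) (st \<beta> p), \<phi> (snd r) (st \<beta> p)) \<delta> = \<phi> (rel_side r \<delta>) (st \<beta> p)" for \<delta>
    by (cases \<delta>) simp_all
  have split: "\<phi> (\<alpha> @ rel_side r \<delta> @ \<beta>) p = \<phi> \<alpha> (st (rel_side r \<epsilon> @ \<beta>) p) @ \<phi> (rel_side r \<delta>) (st \<beta> p) @ \<phi> \<beta> p" for \<delta>
    using \<phi>_append[OF sp(5)[OF ok, of \<delta>]] \<phi>_append[of "rel_side r \<delta>" \<beta> p] sp(4)[OF ok, of \<delta>]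
      sp(5)[OF ok, of \<delta>] ok_append[of \<alpha> "rel_side r \<delta> @ \<beta>" p] by simp
  show "edge_src (\<Phi>e E p) = \<phi> (edge_src E) p" "edge_tgt (\<Phi>e E p) = \<phi> (edge_tgt E) p"
    using split E side by simp_all
  show "\<Phi>e (edge_rev E) p = edge_rev (\<Phi>e E p)"
    using sp(4)[OF ok, of "\<not> \<epsilon>"] E by simp
qed

lemma \<Phi>_path:
  assumes "dpath P U q W" "ok U p"
  shows "dpath Q (\<phi> U p) (\<Phi> q p) (\<phi> W p)"
  using assms
proof (induction q arbitrary: U)
  case Nil
  then show ?case using \<phi>_words by auto
next
  case (Cons E q)
  then have E: "E \<in> dedges P" "edge_src E = U" "dpath P (edge_tgt E) q W"
    using dpath_Cons[OF P] by auto
  have ok: "ok (edge_src E) p" "ok (edge_tgt E) p" using E Cons.prems edge_ok_tgt by auto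
  show ?case
    using Cons.IH[OF E(3) ok(2)] \<Phi>e[OF E(1) ok(1)] E(2) by (simp add: dpath_Cons[OF Q])
qed

lemma \<Phi>e_act:
  assumes "E \<in> dedges P" "ok (\<gamma> @ edge_src E @ \<delta>) p"
  shows "\<Phi>e (edge_act \<gamma> E \<delta>) p = edge_act (\<phi> \<gamma> (st (edge_src E @ \<delta>) p)) (\<Phi>e E (st \<delta> p)) (\<phi> \<delta> p)"
proof -
  obtain \<alpha> r \<epsilon> \<beta> where E: "E = Edge \<alpha> r \<epsilon> \<beta>" by (cases E)
  have "ok (\<gamma> @ \<alpha> @ rel_side r \<epsilon> @ \<beta> @ \<delta>) p" using assms(2) E by simp
  then have ok: "ok (\<alpha> @ rel_side r \<epsilon> @ \<beta> @ \<delta>) p" "ok \<gamma> (st (\<alpha> @ rel_side r \<epsilon> @ \<beta> @ \<delta>) p)"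
    "ok (\<gamma> @ \<alpha>) (st (rel_side r \<epsilon> @ \<beta> @ \<delta>) p)"
    using ok_appendD(2,3)[of \<gamma> "\<alpha> @ rel_side r \<epsilon> @ \<beta> @ \<delta>" p]
      ok_appendD(3)[of "\<gamma> @ \<alpha>" "rel_side r \<epsilon> @ \<beta> @ \<delta>" p] by simp_all
  have ok2: "ok (rel_side r \<epsilon> @ \<beta> @ \<delta>) p" using ok_appendD(2)[OF ok(1)] .
  have ok3: "ok (\<beta> @ \<delta>) p" using ok_appendD(2)[OF ok2] .
  have e1: "\<phi> (\<gamma> @ \<alpha>) (st (rel_side r \<epsilon> @ \<beta> @ \<delta>) p) =
      \<phi> \<gamma> (st (\<alpha> @ rel_side r \<epsilon> @ \<beta> @ \<delta>) p) @ \<phi> \<alpha> (st (rel_side r \<epsilon> @ \<beta> @ \<delta>) p)"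
    using \<phi>_append[OF ok(3)] st_append[OF ok(1)] by simp
  have e2: "st (rel_side r \<epsilon> @ \<beta> @ \<delta>) p = st (rel_side r \<epsilon> @ \<beta>) (st \<delta> p)"
    using st_append[of "rel_side r \<epsilon> @ \<beta>" \<delta> p] ok2 by simp
  show ?thesis using E e1 e2 \<phi>_append[OF ok3] st_append[OF ok3] by simp
qed

lemma \<Phi>_act:
  assumes "dpath P U q W" "ok (\<gamma> @ U @ \<delta>) p"
  shows "\<Phi> (path_act \<gamma> q \<delta>) p = path_act (\<phi> \<gamma> (st (U @ \<delta>) p)) (\<Phi> q (st \<delta> p)) (\<phi> \<delta> p)"
  using assms
proof (induction q arbitrary: U)
  case (Cons E q)
  then have E: "E \<in> dedges P" "edge_src E = U" "dpath P (edge_tgt E) q W"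
    using dpath_Cons[OF P] by auto
  have w: "\<gamma> \<in> words P" "\<delta> \<in> words P" using ok_words[OF Cons.prems(2)] by auto
  have ev: "ev (U @ \<delta>) = ev (edge_tgt E @ \<delta>)"
    using edge_ev[OF E(1)] E edge_ends_words[OF P E(1)] w by (simp add: ev_append)
  have "ok (\<gamma> @ edge_tgt E @ \<delta>) p"
    using edge_ok_tgt[OF edge_act_dedges[OF E(1) w]] Cons.prems(2) E by simp
  then show ?case
    using Cons.IH[OF E(3)] \<Phi>e_act[OF E(1)] Cons.prems(2) E(2) st_cong[OF ev] by simp
qed simp

text \<open>Reading from a fixed state maps the readable part of the Squier complex of
  \<open>P\<close> into that of \<open>Q\<close>. This is what allows labellings over
  \<open>Q\<close> to be pulled back.\<close>

lemma \<Phi>_square: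
  assumes "E \<in> dedges P" "F \<in> dedges P" "ok (edge_src E @ edge_src F) p"
  shows "\<Phi> (commuting_square E F) p = commuting_square (\<Phi>e E (st (edge_src F) p)) (\<Phi>e F p)"
    "\<Phi>e E (st (edge_src F) p) \<in> dedges Q" "\<Phi>e F p \<in> dedges Q"
proof -
  let ?p = "st (edge_src F) p"
  have ok: "ok (edge_src F) p" "ok (edge_src E) ?p" using ok_appendD[OF assms(3)] by simp_all
  have st: "st (edge_tgt F) p = ?p" using st_cong[OF edge_ev[OF assms(2)]] by simp
  note w = edge_ends_words[OF P assms(1)] edge_ends_words[OF P assms(2)]
  note okt = edge_ok_tgt[OF assms(1)] edge_ok_tgt[OF assms(2)]
  have oks: "ok (edge_tgt E) ?p" "ok (edge_tgt F) p" using okt ok by auto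
  note E = \<Phi>e[OF assms(1) ok(2)] and F = \<Phi>e[OF assms(2) ok(1)]
  have p: "p \<in> Ob" using ok(1) ok_O by blast
  have full: "ok (edge_tgt E @ edge_src F) p" "ok (edge_tgt E @ edge_tgt F) p" "ok (edge_src E @ edge_tgt F) p"
    using w ok oks st by (simp_all add: ok_append)
  have rev: "edge_rev E \<in> dedges P" "edge_rev F \<in> dedges P" using assms by simp_all
  have "\<Phi>e (edge_act [] E (edge_src F)) p = edge_act [] (\<Phi>e E ?p) (\<phi> (edge_src F) p)"
    using \<Phi>e_act[OF assms(1), of "[]" "edge_src F" p] assms(3) by simp
  moreover have "\<Phi>e (edge_act (edge_tgt E) F []) p = edge_act (\<phi> (edge_tgt E) ?p) (\<Phi>e F p) []"
    using \<Phi>e_act[OF assms(2), of "edge_tgt E" "[]" p] full(1) p by simp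
  moreover have "\<Phi>e (edge_act [] (edge_rev E) (edge_tgt F)) p = edge_act [] (edge_rev (\<Phi>e E ?p)) (\<phi> (edge_tgt F) p)"
    using \<Phi>e_act[OF rev(1), of "[]" "edge_tgt F" p] full(2) st E(4) by simp
  moreover have "\<Phi>e (edge_act (edge_src E) (edge_rev F) []) p = edge_act (\<phi> (edge_src E) ?p) (edge_rev (\<Phi>e F p)) []"
    using \<Phi>e_act[OF rev(2), of "edge_src E" "[]" p] full(3) st p F(4) by simp
  ultimately show "\<Phi> (commuting_square E F) p = commuting_square (\<Phi>e E ?p) (\<Phi>e F p)"
    using E F by (simp add: commuting_square_def)
  show "\<Phi>e E ?p \<in> dedges Q" "\<Phi>e F p \<in> dedges Q" using E(1) F(1) by simp_all
qed

end

context squier_transfer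
begin

subsection \<open>The action of the letters\<close>

text \<open>The correction between the product \<open>ev [a] \<otimes> p\<close> and the state
  representing it. The generator \<open>pos a p\<close> stands for this element of
  \<open>T\<close>.\<close>

definition cf :: "'c \<Rightarrow> 'a \<Rightarrow> 'a" where
  "cf a p = (SOME c. c \<in> T \<and> st [a] p \<otimes> c = ev [a] \<otimes> p)"

definition cfi :: "'c \<Rightarrow> 'a \<Rightarrow> 'a" where
  "cfi a p = (SOME d. d \<in> T \<and> (\<forall>x\<in>H. x \<otimes> cf a p \<otimes> d = x \<and> x \<otimes> d \<otimes> cf a p = x))"

definition dec :: "'b \<Rightarrow> 'c \<times> 'a \<times> bool" where
  "dec = inv_into (letters P \<times> Ob \<times> UNIV) (\<lambda>(a, p, \<epsilon>). enc a p \<epsilon>)"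

definition co :: "'b \<Rightarrow> 'a" where
  "co b = (case dec b of (a, p, \<epsilon>) \<Rightarrow> if \<epsilon> then cf a p else cfi a p)"

definition act :: "'a \<Rightarrow> 'b \<Rightarrow> 'a" where
  "act x b = x \<otimes> co b"

lemma cf:
  assumes "edge a p"
  shows "cf a p \<in> T" "st [a] p \<otimes> cf a p = ev [a] \<otimes> p"
proof -
  have "trel (ev [a] \<otimes> p) (st [a] p)"
    using rp_trel[OF ok_V[OF edge_ok[OF assms]]] by (simp add: st_def)
  then have "\<exists>c. c \<in> T \<and> st [a] p \<otimes> c = ev [a] \<otimes> p" unfolding trel_def by blast
  from someI_ex[OF this] show "cf a p \<in> T" "st [a] p \<otimes> cf a p = ev [a] \<otimes> p"
    unfolding cf_def by blast+
qed

lemma cfi: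
  assumes "edge a p"
  shows "cfi a p \<in> T" "x \<in> H \<Longrightarrow> x \<otimes> cf a p \<otimes> cfi a p = x" "x \<in> H \<Longrightarrow> x \<otimes> cfi a p \<otimes> cf a p = x"
proof -
  have "\<exists>d. d \<in> T \<and> (\<forall>x\<in>H. x \<otimes> cf a p \<otimes> d = x \<and> x \<otimes> d \<otimes> cf a p = x)"
    using T_inverse[OF cf(1)[OF assms]] by blast
  from someI_ex[OF this]
  have *: "cfi a p \<in> T \<and> (\<forall>x\<in>H. x \<otimes> cf a p \<otimes> cfi a p = x \<and> x \<otimes> cfi a p \<otimes> cf a p = x)"
    unfolding cfi_def .
  then show "cfi a p \<in> T" by (rule conjunct1)
  show "x \<otimes> cf a p \<otimes> cfi a p = x" "x \<otimes> cfi a p \<otimes> cf a p = x" if "x \<in> H"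
    using * that by simp_all
qed

lemma dec: "edge a p \<Longrightarrow> dec (enc a p \<epsilon>) = (a, p, \<epsilon>)"
proof -
  assume e: "edge a p"
  have "(a, p, \<epsilon>) \<in> letters P \<times> Ob \<times> UNIV" using e edge_O by (simp add: edge_def)
  moreover have "inj_on (\<lambda>(a, p, \<epsilon>). enc a p \<epsilon>) (letters P \<times> Ob \<times> UNIV)"
    using enc_inj by (simp add: Ob_def)
  ultimately show ?thesis unfolding dec_def using inv_into_f_f by fastforce
qed

lemma Q_letters_cases:
  assumes "b \<in> letters Q"
  obtains a p \<epsilon> where "edge a p" "b = enc a p \<epsilon>"
  using assms unfolding Q_def by auto

lemma co_pos: "edge a p \<Longrightarrow> co (pos a p) = cf a p"
  and co_neg: "edge a p \<Longrightarrow> co (neg a p) = cfi a p"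
  by (simp_all add: co_def dec)

lemma co_T: "b \<in> letters Q \<Longrightarrow> co b \<in> T"
  by (erule Q_letters_cases) (case_tac \<epsilon>; simp add: co_pos co_neg cf cfi)

lemma act_H: "x \<in> H \<Longrightarrow> b \<in> letters Q \<Longrightarrow> act x b \<in> H"
  unfolding act_def by (rule H_T[OF _ co_T])

text \<open>Telescoping: acting by the first letter of the reading replaces the state of
  \<open>a # U\<close> by \<open>ev [a]\<close> times the state of \<open>U\<close>, which moves
  \<open>a\<close> into the left factor \<open>\<alpha>\<close>.\<close>

lemma foldl_act_\<phi>:
  assumes "ok U p" "\<alpha> \<in> carrier S"
  shows "foldl act (\<alpha> \<otimes> st U p) (\<phi> U p) = \<alpha> \<otimes> (ev U \<otimes> p)"
  using assms
proof (induction U arbitrary: \<alpha>)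
  case Nil
  then show ?case using O_carrier by (simp add: ev_Nil)
next
  case (Cons a U)
  note U = ok_Cons_edge[OF Cons.prems(1)]
  have w: "[a] \<in> words P" "U \<in> words P" "p \<in> Ob"
    using edge_word[OF U(1)] ok_words[OF U(2)] ok_O[OF U(2)] by simp_all
  note car = O_carrier[OF w(3)] O_carrier[OF st_O[OF U(2)]] O_carrier[OF st_O[OF edge_ok[OF U(1)]]]
    ev_closed[OF w(1)] ev_closed[OF w(2)] T_carrier[OF cf(1)[OF U(1)]]
  have "act (\<alpha> \<otimes> st (a # U) p) (pos a (st U p)) = \<alpha> \<otimes> (st [a] (st U p) \<otimes> cf a (st U p))"
    unfolding act_def co_pos[OF U(1)] U(3) using car Cons.prems(2) by (simp add: m_assoc)
  also have "\<dots> = (\<alpha> \<otimes> ev [a]) \<otimes> st U p"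
    unfolding cf(2)[OF U(1)] using car Cons.prems(2) by (simp add: m_assoc)
  finally have "foldl act (\<alpha> \<otimes> st (a # U) p) (\<phi> (a # U) p) = foldl act ((\<alpha> \<otimes> ev [a]) \<otimes> st U p) (\<phi> U p)"
    by simp
  also have "\<dots> = (\<alpha> \<otimes> ev [a]) \<otimes> (ev U \<otimes> p)"
    by (rule Cons.IH[OF U(2)]) (use car Cons.prems(2) in simp)
  also have "\<dots> = \<alpha> \<otimes> (ev (a # U) \<otimes> p)"
    using car Cons.prems(2) ev_append[OF w(1,2)] by (simp add: m_assoc)
  finally show ?case .
qed

text \<open>All of \<open>H\<close> lies in one class of \<open>trel\<close>, so this state does not
  depend on the chosen element.\<close>

definition h0 :: 'a where
  "h0 = rp (SOME x. x \<in> H)"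

lemma rp_H: "x \<in> H \<Longrightarrow> rp x \<in> H"
proof -
  assume x: "x \<in> H"
  have "\<one> \<otimes> rp x \<in> H"
    by (rule trel_H[OF rp_trel[OF H_V[OF x]]]) (use x H_carrier in simp_all)
  then show ?thesis using rp_V[OF H_V[OF x]] V_carrier by simp
qed

lemma h0: "h0 \<in> H" "h0 \<in> Ob" "x \<in> H \<Longrightarrow> rp x = h0"
proof -
  have H: "(SOME x. x \<in> H) \<in> H" by (rule someI_ex[OF H_nonempty])
  show "h0 \<in> H" "h0 \<in> Ob" unfolding h0_def using rp_H[OF H] rp_Ob[OF H_V[OF H]] .
  show "rp x = h0" if "x \<in> H"
    unfolding h0_def by (rule rp_eq[OF H_V[OF that] H_V[OF H] H_trel[OF that H]])
qed

section \<open>Words leading from a state into \<open>H\<close>\<close>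

definition ends :: "'c list \<Rightarrow> 'a \<Rightarrow> 'a \<Rightarrow> bool" where
  "ends W p x \<longleftrightarrow> W \<in> words P \<and> p \<in> Ob \<and> x \<in> H \<and> ev W \<otimes> p = x"

lemma endsD:
  assumes "ends W p x"
  shows "W \<in> words P" "p \<in> Ob" "x \<in> H" "ev W \<otimes> p = x" "ok W p" "st W p = h0"
    "foldl act h0 (\<phi> W p) = x"
proof -
  show *: "W \<in> words P" "p \<in> Ob" "x \<in> H" "ev W \<otimes> p = x" using assms by (auto simp: ends_def)
  show ok: "ok W p" using * H_V by (simp add: ok_def)
  show st: "st W p = h0" using * h0(3) by (simp add: st_def)
  have "foldl act (\<one> \<otimes> st W p) (\<phi> W p) = \<one> \<otimes> (ev W \<otimes> p)" by (rule foldl_act_\<phi>[OF ok]) simp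
  then show "foldl act h0 (\<phi> W p) = x" using st * h0(1) H_carrier by simp
qed

lemma ends_append:
  assumes "ends W (st U p) x" "ok U p"
  shows "ends (W @ U) p (foldl act x (\<phi> U p))"
proof -
  note W = endsD[OF assms(1)]
  note U = ok_words[OF assms(2)] ok_O[OF assms(2)]
  have ok: "ok (W @ U) p" using W(5) assms(2) W(1) by (simp add: ok_append)
  have "foldl act (ev W \<otimes> st U p) (\<phi> U p) = ev W \<otimes> (ev U \<otimes> p)"
    by (rule foldl_act_\<phi>[OF assms(2) ev_closed[OF W(1)]])
  then have ev: "ev (W @ U) \<otimes> p = foldl act x (\<phi> U p)"
    using W U O_carrier by (simp add: ev_append_assoc)
  have "x' \<in> H \<Longrightarrow> w \<in> words Q \<Longrightarrow> foldl act x' w \<in> H" for x' w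
    by (induction w arbitrary: x') (auto intro: act_H)
  then have "foldl act x (\<phi> U p) \<in> H" using W(3) \<phi>_words[OF assms(2)] by blast
  then show ?thesis using ev U W(1) by (simp add: ends_def)
qed

lemma ends_exists:
  assumes "p \<in> Ob" "x \<in> H"
  shows "\<exists>W. ends W p x"
proof -
  obtain \<alpha> where \<alpha>: "\<alpha> \<in> carrier S" "\<alpha> \<otimes> p \<in> H" using O_V[OF assms(1)] unfolding vertices_def by blast
  obtain t where t: "t \<in> carrier S" "t \<otimes> (\<alpha> \<otimes> p) = x" using L_trans[OF \<alpha>(2) assms(2)] by blast
  obtain W where W: "W \<in> words P" "ev W = t \<otimes> \<alpha>" using ev_surj[of "t \<otimes> \<alpha>"] \<alpha> t by auto
  have "ev W \<otimes> p = x" using W(2) t \<alpha>(1) O_carrier[OF assms(1)] by (simp add: m_assoc)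
  then show ?thesis using W assms by (auto simp: ends_def)
qed

definition wt :: "'a \<Rightarrow> 'a \<Rightarrow> 'c list" where
  "wt x p = (SOME W. ends W p x)"

lemma wt: "p \<in> Ob \<Longrightarrow> x \<in> H \<Longrightarrow> ends (wt x p) p x"
  unfolding wt_def by (rule someI_ex[OF ends_exists])

lemma ends_\<kappa>:
  assumes "ends W p x"
  shows "ends (W @ \<kappa> p) s x"
  using endsD(1-4)[OF assms] \<kappa>[of p] s_O s by (simp add: ends_def ev_append_assoc)

lemma ends_sw:
  assumes "ends W s x"
  shows "ev (W @ sw) = x" "ends (W @ sw) s x"
proof -
  note W = endsD(1-4)[OF assms]
  show ev: "ev (W @ sw) = x" using W sw ev_sw by (simp add: ev_append)
  show "ends (W @ sw) s x" using W Hs[OF W(3)] ev sw by (simp add: ends_def)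
qed

definition nf :: "'a \<Rightarrow> 'b list" where
  "nf x = \<phi> (wt x s) s"

lemma nf_words: "x \<in> H \<Longrightarrow> nf x \<in> words Q"
  unfolding nf_def by (rule \<phi>_words[OF endsD(5)[OF wt[OF s_O]]])

lemma vertex_reachable:
  assumes "p \<in> Ob" "x \<in> H"
  shows "\<exists>\<alpha>\<in>carrier S. \<alpha> \<otimes> p = x"
  using endsD(1,4)[OF wt[OF assms]] ev_closed by blast

lemma foldl_act_\<phi>':
  assumes "ok U p" "x \<in> H" "\<alpha> \<in> carrier S" "\<alpha> \<otimes> st U p = x"
  shows "foldl act x (\<phi> U p) = \<alpha> \<otimes> (ev U \<otimes> p)"
  using foldl_act_\<phi>[OF assms(1,3)] assms(4) by simp

text \<open>By \<open>vertex_reachable\<close>, \<open>x\<close> is a left multiple of every state.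
  Writing \<open>x\<close> as \<open>\<alpha>\<close> times the final state of a reading lets
  \<open>foldl_act_\<phi>\<close> evaluate both sides of a relation in \<open>S\<close>.\<close>

lemma act_rel:
  assumes x: "x \<in> H" and uv: "(u, v) \<in> rels Q"
  shows "foldl act x u = foldl act x v"
  using uv
proof (cases rule: Q_rels_cases)
  case (A a p)
  then show ?thesis using x by (simp add: act_def co_pos co_neg cfi)
next
  case (B a p)
  then show ?thesis using x by (simp add: act_def co_pos co_neg cfi)
next
  case (R u' v' p)
  have ok': "ok v' p" using P_rel_ok[OF R(1)] R(2) by simp
  obtain \<alpha> where \<alpha>: "\<alpha> \<in> carrier S" "\<alpha> \<otimes> st u' p = x" using vertex_reachable[OF st_O[OF R(2)] x] by blast
  have "\<alpha> \<otimes> st v' p = x" using \<alpha>(2) P_rel_st[OF R(1)] by simp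
  then show ?thesis
    using foldl_act_\<phi>'[OF R(2) x \<alpha>] foldl_act_\<phi>'[OF ok' x \<alpha>(1)] R(3,4) P_rel(3)[OF R(1)] by simp
next
  case (C p)
  obtain \<alpha> where \<alpha>: "\<alpha> \<in> carrier S" "\<alpha> \<otimes> p = x" using vertex_reachable[OF C(1) x] by blast
  then show ?thesis using foldl_act_\<phi>'[OF \<kappa>(3)[OF C(1)] x \<alpha>(1)] \<kappa>(2,4)[OF C(1)] C by simp
qed

subsection \<open>Chosen paths\<close>

definition Ce :: "'a \<Rightarrow> 'b edge list" where
  "Ce p = [Edge [] (\<phi> (\<kappa> p) s, []) True []]"

lemma rel_path:
  assumes "(u, v) \<in> rels Q"
  shows "dpath Q u [Edge [] (u, v) True []] v"
  using dpath_single[OF Q, of "Edge [] (u, v) True []"] assms by (simp add: dedge_iff)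

lemma Ce: "p \<in> Ob \<Longrightarrow> dpath Q (\<phi> (\<kappa> p) s) (Ce p) []"
  unfolding Ce_def by (rule rel_path[OF Q_rels(4)])

definition conn :: "'b list \<Rightarrow> 'b list \<Rightarrow> bool" where
  "conn u v \<longleftrightarrow> (\<exists>q. dpath Q u q v)"

lemma conn_trans: "conn u v \<Longrightarrow> conn v w \<Longrightarrow> conn u w"
  unfolding conn_def using dpath_appendI[OF Q] by blast

lemma conn_sym: "conn u v \<Longrightarrow> conn v u"
  unfolding conn_def using dpath_dinv[OF Q] by blast

lemma conn_context: "conn u v \<Longrightarrow> \<alpha> \<in> words Q \<Longrightarrow> \<beta> \<in> words Q \<Longrightarrow> conn (\<alpha> @ u @ \<beta>) (\<alpha> @ v @ \<beta>)"
  unfolding conn_def using dpath_act[OF Q] by blast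

text \<open>The formal inverses cancel the reading letter by letter. This permits left cancellation
  of readings up to derivations.\<close>

lemma left_inverse:
  assumes "ok U p"
  shows "\<exists>w\<in>words Q. conn (w @ \<phi> U p) []"
  using assms
proof (induction U)
  case Nil
  have "conn [] []" unfolding conn_def by (intro exI[of _ "[]"]) simp
  then show ?case by (intro bexI[of _ "[]"]) simp_all
next
  case (Cons a U)
  note U = ok_Cons_edge[OF Cons.prems]
  obtain w where w: "w \<in> words Q" "conn (w @ \<phi> U p) []" using Cons.IH[OF U(2)] by blast
  let ?e = "pos a (st U p)" and ?e' = "neg a (st U p)"
  have "conn [?e', ?e] []" unfolding conn_def using rel_path[OF Q_rels(2)[OF U(1)]] by blast
  then have "conn (w @ [?e', ?e] @ \<phi> U p) (w @ [] @ \<phi> U p)"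
    by (rule conn_context[OF _ w(1) \<phi>_words[OF U(2)]])
  then have "conn ((w @ [?e']) @ \<phi> (a # U) p) []" using conn_trans w(2) by simp
  moreover have "w @ [?e'] \<in> words Q" using w(1) pos_letters[OF U(1)] by simp
  ultimately show ?case by blast
qed

text \<open>The relations need not contain \<open>\<phi> sw s\<close>. But for a word
  \<open>U\<close> leading from \<open>s\<close> into \<open>H\<close>, the words
  \<open>U @ sw @ sw\<close> and \<open>U @ sw\<close> are equal in \<open>S\<close>, since
  \<open>s\<close> fixes \<open>H\<close> pointwise. Reading a derivation between them and
  cancelling the common prefix deletes \<open>\<phi> sw s\<close>.\<close>

lemma sw_null: "conn (\<phi> sw s) []"
proof -
  define U where "U = wt h0 s"
  have U: "ends U s h0" unfolding U_def by (rule wt[OF s_O h0(1)])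
  have e: "ends (U @ sw) s h0" "ends ((U @ sw) @ sw) s h0" "ev ((U @ sw) @ sw) = ev (U @ sw)"
    using ends_sw[OF U] ends_sw[OF ends_sw(2)[OF U]] by simp_all
  then obtain q where q: "dpath P ((U @ sw) @ sw) q (U @ sw)"
    using path_presentation_cong[OF P] ev_eq[OF endsD(1)[OF e(2)] endsD(1)[OF e(1)]] by blast
  let ?w = "\<phi> (U @ sw) s"
  have "\<phi> ((U @ sw) @ sw) s = ?w @ \<phi> sw s"
    using \<phi>_append[OF endsD(5)[OF e(2)]] sw_st by simp
  then have 1: "conn (?w @ \<phi> sw s) ?w"
    unfolding conn_def using \<Phi>_path[OF q endsD(5)[OF e(2)]] by auto
  obtain v where v: "v \<in> words Q" "conn (v @ ?w) []" using left_inverse[OF endsD(5)[OF e(1)]] by blast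
  have k: "\<phi> sw s \<in> words Q" by (rule \<phi>_words[OF sw_ok])
  have "conn ([] @ (v @ ?w) @ \<phi> sw s) ([] @ [] @ \<phi> sw s)" by (rule conn_context[OF v(2)]) (use k in simp_all)
  then have "conn (\<phi> sw s) (v @ ?w @ \<phi> sw s)" using conn_sym by simp
  moreover have "conn (v @ (?w @ \<phi> sw s) @ []) (v @ ?w @ [])" by (rule conn_context[OF 1 v(1)]) simp
  ultimately have "conn (\<phi> sw s) (v @ ?w)" using conn_trans by simp
  then show ?thesis using conn_trans v(2) by blast
qed

definition cs :: "'b edge list" where
  "cs = (SOME q. dpath Q (\<phi> sw s) q [])"

lemma cs: "dpath Q (\<phi> sw s) cs []"
  using sw_null unfolding conn_def cs_def by (rule someI_ex)

text \<open>The derivation over \<open>P\<close> is an arbitrary choice;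
  \<open>val_derivation\<close> shows that labels do not depend on it once a homotopy base of
  \<open>P\<close> has been read into \<open>Y\<close>.\<close>

definition dl :: "'c list \<Rightarrow> 'c list \<Rightarrow> 'a \<Rightarrow> 'b edge list" where
  "dl U W p = \<Phi> (SOME q. dpath P U q W) p"

lemma dl_obtain:
  assumes "U \<in> words P" "W \<in> words P" "ev U = ev W"
  obtains q where "dpath P U q W" "\<And>p. dl U W p = \<Phi> q p"
proof -
  have "\<exists>q. dpath P U q W" using assms ev_eq[OF assms(1,2)] path_presentation_cong[OF P] by blast
  then have "dpath P U (SOME q. dpath P U q W) W" by (rule someI_ex)
  then show thesis using that by (simp add: dl_def)
qed

lemma dl_path:
  assumes "ok U p" "W \<in> words P" "ev U = ev W"
  shows "dpath Q (\<phi> U p) (dl U W p) (\<phi> W p)"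
proof -
  obtain q where "dpath P U q W" "dl U W p = \<Phi> q p"
    using dl_obtain[OF ok_words[OF assms(1)] assms(2,3)] by metis
  then show ?thesis using \<Phi>_path assms(1) by simp
qed

text \<open>Here \<open>U\<close> and \<open>W\<close> need not be equal in \<open>S\<close>, they only have the same product with \<open>s\<close>. So \<open>sw\<close> is
  inserted before a derivation over \<open>P\<close> is applied.\<close>

definition dt :: "'c list \<Rightarrow> 'c list \<Rightarrow> 'b edge list" where
  "dt U W = path_act (\<phi> U s) (dinv cs) [] @ dl (U @ sw) (W @ sw) s @ path_act (\<phi> W s) cs []"

lemma \<phi>_sw: "ends W s x \<Longrightarrow> \<phi> (W @ sw) s = \<phi> W s @ \<phi> sw s"
  using \<phi>_append[OF endsD(5)[OF ends_sw(2)]] sw_st by simp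

lemma dt_path:
  assumes "ends U s x" "ends W s x"
  shows "dpath Q (\<phi> U s) (dt U W) (\<phi> W s)"
proof -
  have w: "\<phi> U s \<in> words Q" "\<phi> W s \<in> words Q"
    using \<phi>_words endsD(5)[OF assms(1)] endsD(5)[OF assms(2)] by blast+
  have "dpath Q (\<phi> U s @ [] @ []) (path_act (\<phi> U s) (dinv cs) []) (\<phi> U s @ \<phi> sw s @ [])"
    by (rule dpath_act[OF Q dpath_dinv[OF Q cs] w(1)]) simp
  moreover have "dpath Q (\<phi> (U @ sw) s) (dl (U @ sw) (W @ sw) s) (\<phi> (W @ sw) s)"
    by (rule dl_path[OF endsD(5)[OF ends_sw(2)[OF assms(1)]] endsD(1)[OF ends_sw(2)[OF assms(2)]]])
      (simp add: ends_sw(1)[OF assms(1)] ends_sw(1)[OF assms(2)])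
  moreover have "dpath Q (\<phi> W s @ \<phi> sw s @ []) (path_act (\<phi> W s) cs []) (\<phi> W s @ [] @ [])"
    by (rule dpath_act[OF Q cs w(2)]) simp
  ultimately show ?thesis
    unfolding dt_def using dpath_appendI[OF Q] \<phi>_sw[OF assms(1)] \<phi>_sw[OF assms(2)] by (metis append_Nil2)
qed

text \<open>The comparison takes place at \<open>s\<close>: \<open>W\<close> is extended by
  \<open>\<kappa> p\<close> so that it can be read from there, \<open>dt\<close> passes from the
  normal form to the extended word, and \<open>Ce p\<close> deletes the extension.\<close>

definition om :: "'c list \<Rightarrow> 'a \<Rightarrow> 'a \<Rightarrow> 'b edge list" where
  "om W p x = dt (wt x s) (W @ \<kappa> p) @ path_act (\<phi> W p) (Ce p) []"

lemma \<phi>_\<kappa>: "ends W p x \<Longrightarrow> \<phi> (W @ \<kappa> p) s = \<phi> W p @ \<phi> (\<kappa> p) s"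
  using \<phi>_append[OF endsD(5)[OF ends_\<kappa>]] \<kappa>(4)[OF endsD(2)] by simp

lemma om_path:
  assumes "ends W p x"
  shows "dpath Q (nf x) (om W p x) (\<phi> W p)"
proof -
  note W = endsD[OF assms]
  have "dpath Q (nf x) (dt (wt x s) (W @ \<kappa> p)) (\<phi> W p @ \<phi> (\<kappa> p) s)"
    using dt_path[OF wt[OF s_O W(3)] ends_\<kappa>[OF assms]] \<phi>_\<kappa>[OF assms] by (simp add: nf_def)
  moreover have "dpath Q (\<phi> W p @ \<phi> (\<kappa> p) s @ []) (path_act (\<phi> W p) (Ce p) []) (\<phi> W p @ [] @ [])"
    by (rule dpath_act[OF Q Ce[OF W(2)] \<phi>_words[OF W(5)]]) simp
  ultimately show ?thesis unfolding om_def using dpath_appendI[OF Q] by (metis append_Nil2)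
qed

lemma ends_edge:
  assumes "edge a p" "ends W (st [a] p) x"
  shows "ends (W @ [a]) p (act x (pos a p))" "\<phi> (W @ [a]) p = \<phi> W (st [a] p) @ [pos a p]"
proof -
  have p: "p \<in> Ob" by (rule edge_O[OF assms(1)])
  show e: "ends (W @ [a]) p (act x (pos a p))"
    using ends_append[OF assms(2) edge_ok[OF assms(1)]] p by simp
  show "\<phi> (W @ [a]) p = \<phi> W (st [a] p) @ [pos a p]" using \<phi>_append[OF endsD(5)[OF e]] p by simp
qed

text \<open>The letter is absorbed by reading: the reading of \<open>W\<close> followed by
  \<open>pos a p\<close> is the reading of \<open>W @ [a]\<close>. A particular \<open>W\<close> has
  to be chosen; by \<open>\<sigma>p_val\<close> every other choice gives the same label.\<close>

definition \<sigma>p :: "'a \<Rightarrow> 'c \<Rightarrow> 'a \<Rightarrow> 'b edge list" where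
  "\<sigma>p x a p = path_act [] (om (wt x (st [a] p)) (st [a] p) x) [pos a p] @
     dinv (om (wt x (st [a] p) @ [a]) p (act x (pos a p)))"

lemma \<sigma>p_path:
  assumes "edge a p" "x \<in> H"
  shows "dpath Q (nf x @ [pos a p]) (\<sigma>p x a p) (nf (act x (pos a p)))"
proof -
  let ?W = "wt x (st [a] p)"
  have W: "ends ?W (st [a] p) x" by (rule wt[OF st_O[OF edge_ok[OF assms(1)]] assms(2)])
  have "dpath Q ([] @ nf x @ [pos a p]) (path_act [] (om ?W (st [a] p) x) [pos a p]) ([] @ \<phi> ?W (st [a] p) @ [pos a p])"
    by (rule dpath_act[OF Q om_path[OF W]]) (use pos_letters[OF assms(1)] in simp_all)
  moreover have "dpath Q (\<phi> (?W @ [a]) p) (dinv (om (?W @ [a]) p (act x (pos a p)))) (nf (act x (pos a p)))"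
    by (rule dpath_dinv[OF Q om_path[OF ends_edge(1)[OF assms(1) W]]])
  ultimately show ?thesis
    unfolding \<sigma>p_def using dpath_appendI[OF Q] ends_edge(2)[OF assms(1) W] by (metis append_Nil)
qed

text \<open>Not an independent choice: the path for the positive letter at \<open>y\<close> is run
  backwards and the pair of letters is cancelled. Naturality along \<open>[pos a p, neg a p]\<close>
  then holds by construction.\<close>

definition \<sigma>n :: "'a \<Rightarrow> 'c \<Rightarrow> 'a \<Rightarrow> 'b edge list" where
  "\<sigma>n x a p = (let y = act x (neg a p) in path_act [] (dinv (\<sigma>p y a p)) [neg a p] @
     path_act (nf y) [Edge [] ([pos a p, neg a p], []) True []] [])"

lemma act_neg_pos: "edge a p \<Longrightarrow> x \<in> H \<Longrightarrow> act (act x (neg a p)) (pos a p) = x"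
  by (simp add: act_def co_pos co_neg cfi)

lemma act_pos_neg: "edge a p \<Longrightarrow> x \<in> H \<Longrightarrow> act (act x (pos a p)) (neg a p) = x"
  by (simp add: act_def co_pos co_neg cfi)

lemma \<sigma>n_path:
  assumes "edge a p" "x \<in> H"
  shows "dpath Q (nf x @ [neg a p]) (\<sigma>n x a p) (nf (act x (neg a p)))"
proof -
  let ?y = "act x (neg a p)"
  have y: "?y \<in> H" by (rule act_H[OF assms(2) pos_letters[OF assms(1)]])
  have "dpath Q (nf x) (dinv (\<sigma>p ?y a p)) (nf ?y @ [pos a p])"
    using dpath_dinv[OF Q \<sigma>p_path[OF assms(1) y]] act_neg_pos[OF assms] by simp
  then have "dpath Q ([] @ nf x @ [neg a p]) (path_act [] (dinv (\<sigma>p ?y a p)) [neg a p]) ([] @ (nf ?y @ [pos a p]) @ [neg a p])"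
    by (rule dpath_act[OF Q]) (use pos_letters[OF assms(1)] in simp_all)
  moreover have "dpath Q (nf ?y @ [pos a p, neg a p] @ []) (path_act (nf ?y) [Edge [] ([pos a p, neg a p], []) True []] []) (nf ?y @ [] @ [])"
    by (rule dpath_act[OF Q rel_path[OF Q_rels(1)[OF assms(1)]] nf_words[OF y]]) simp
  ultimately show ?thesis unfolding \<sigma>n_def Let_def using dpath_appendI[OF Q] by fastforce
qed

definition \<sigma> :: "'a \<Rightarrow> 'b \<Rightarrow> 'b edge list" where
  "\<sigma> x b = (case dec b of (a, p, \<epsilon>) \<Rightarrow> if \<epsilon> then \<sigma>p x a p else \<sigma>n x a p)"

lemma \<sigma>_pos: "edge a p \<Longrightarrow> \<sigma> x (pos a p) = \<sigma>p x a p"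
  and \<sigma>_neg: "edge a p \<Longrightarrow> \<sigma> x (neg a p) = \<sigma>n x a p"
  by (simp_all add: \<sigma>_def dec)

definition c0 :: "'b edge list" where
  "c0 = dt (wt h0 s) (\<kappa> h0) @ Ce h0"

lemma c0: "dpath Q (nf h0) c0 []"
proof -
  have "ends (\<kappa> h0) s h0" using \<kappa>[OF h0(2)] s_O h0(1) by (simp add: ends_def)
  then have "dpath Q (nf h0) (dt (wt h0 s) (\<kappa> h0)) (\<phi> (\<kappa> h0) s)"
    unfolding nf_def by (rule dt_path[OF wt[OF s_O h0(1)]])
  then show ?thesis unfolding c0_def using dpath_appendI[OF Q] Ce[OF h0(2)] by blast
qed

sublocale nf: normal_forms Q H act nf \<sigma> h0 c0
proof
  show "presentation Q" by (rule Q)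
  show "act x b \<in> H" if "x \<in> H" "b \<in> letters Q" for x b using act_H that .
  show "nf x \<in> words Q" if "x \<in> H" for x using nf_words that .
  show "dpath Q (nf x @ [b]) (\<sigma> x b) (nf (act x b))" if "x \<in> H" "b \<in> letters Q" for x b
    using that(2)
  proof (cases rule: Q_letters_cases)
    case (1 a p \<epsilon>)
    then show ?thesis
      using \<sigma>p_path[OF 1(1) that(1)] \<sigma>n_path[OF 1(1) that(1)] by (cases \<epsilon>) (simp_all add: \<sigma>_pos \<sigma>_neg)
  qed
  show "h0 \<in> H" by (rule h0(1))
  show "dpath Q (nf h0) c0 []" by (rule c0)
  show "foldl act x u = foldl act x v" if "x \<in> H" "(u, v) \<in> rels Q" for x u v
    using act_rel that .
qed

lemma Q_cong_iff:
  assumes "u \<in> words Q" "v \<in> words Q"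
  shows "(u, v) \<in> presentation_cong Q \<longleftrightarrow> foldl act h0 u = foldl act h0 v"
  using path_presentation_cong[OF Q] nf.connected[OF assms] nf.path_foldl_act[OF _ h0(1)] by blast

end

section \<open>Transfer of finite derivation type\<close>

locale squier_fdt = squier_transfer S H s rp P ev sw enc
  for S :: "('a, 'm) monoid_scheme" (structure) and H s rp and P :: "'c presentation"
    and ev sw and enc :: "'c \<Rightarrow> 'a \<Rightarrow> bool \<Rightarrow> 'b" +
  fixes X :: "'c edge list set"
  assumes hb: "homotopy_base P X"
begin

section \<open>Finitely many closed paths over \<open>Q\<close>\<close>

abbreviation "kh p \<equiv> \<kappa> p @ sw"

definition c2 :: "'a \<Rightarrow> 'b edge list" where
  "c2 p = path_act (\<phi> (\<kappa> p) s) cs [] @ Ce p"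

text \<open>The data of \<open>common_factor\<close> for the two ways from \<open>st [a] p\<close> back to \<open>s\<close>, either directly
  or along the edge \<open>a\<close>. The loop that is null along \<open>c1\<close> after reading \<open>kh (st [a] p)\<close> first is null
  along \<open>d\<close> after reading it last; \<open>adj\<close> makes the two compatible, like the unit and counit of an
  adjoint equivalence.\<close>

definition edge_data :: "'c \<Rightarrow> 'a \<Rightarrow> 'a \<times> 'c list \<times> 'c list \<times> 'b edge list \<Rightarrow> bool" where
  "edge_data a p D \<longleftrightarrow> (case D of (E, m, n, d) \<Rightarrow>
     ok m s \<and> st m s = E \<and> ok n s \<and> st n s = E \<and> ok (kh (st [a] p)) E \<and> st (kh (st [a] p)) E = st [a] p \<and>
     ev (kh (st [a] p) @ m) = ev (kh (st [a] p)) \<and> ev (kh (st [a] p) @ n) = ev ([a] @ kh p) \<and>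
     dpath Q (\<phi> m s @ \<phi> (kh (st [a] p)) E) d [])"

definition ed :: "'c \<Rightarrow> 'a \<Rightarrow> 'a \<times> 'c list \<times> 'c list \<times> 'b edge list" where
  "ed a p = (SOME D. edge_data a p D)"

text \<open>The overlap of the two cancellations. As \<open>\<sigma>n\<close> is built from the
  first, this is what naturality along the second requires.\<close>

definition zig :: "'c \<Rightarrow> 'a \<Rightarrow> 'b edge list" where
  "zig a p = path_act [] [Edge [] ([pos a p, neg a p], []) True []] [pos a p] @
     dinv (path_act [pos a p] [Edge [] ([neg a p, pos a p], []) True []] [])"

text \<open>Two copies of the reading of \<open>\<kappa> p\<close>, of which either may be deleted;
  naturality along the relation for \<open>p\<close> compares the two deletions.\<close>

definition ck :: "'a \<Rightarrow> 'b edge list" where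
  "ck p = path_act [] (Ce p) (\<phi> (\<kappa> p) s) @ dinv (path_act (\<phi> (\<kappa> p) s) (Ce p) [])"

definition c1 :: "'c list \<Rightarrow> 'a \<Rightarrow> 'b edge list" where
  "c1 m p = dl (kh p @ m) (kh p) s @ c2 p"

text \<open>With \<open>K\<close> the reading of \<open>kh (st [a] p)\<close> from \<open>E\<close>
  and \<open>M\<close> that of \<open>m\<close> from \<open>s\<close>, these are the two ways from
  \<open>K M K\<close> to \<open>K\<close>: deleting \<open>M K\<close> by \<open>d\<close> or
  \<open>K M\<close> by \<open>c1\<close>.\<close>

definition adj :: "'c \<Rightarrow> 'a \<Rightarrow> 'b edge list" where
  "adj a p = (case ed a p of (E, m, n, d) \<Rightarrow>
     path_act (\<phi> (kh (st [a] p)) E) d [] @ dinv (path_act [] (c1 m (st [a] p)) (\<phi> (kh (st [a] p)) E)))"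

definition Y :: "'b edge list set" where
  "Y = {\<Phi> q p | q p. q \<in> X \<and> p \<in> Ob \<and> (\<exists>u. dpath P u q u \<and> ok u p)} \<union>
     {zig a p | a p. edge a p} \<union> ck ` Ob \<union> {Ce s} \<union> {adj a p | a p. edge a p}"

lemma X_closed: "closed_paths P X"
  using hb by (simp add: homotopy_base_def closed_paths_def)

text \<open>The factor \<open>sw\<close> makes the value of \<open>kh p\<close> equal to
  \<open>p\<close> in \<open>S\<close> itself, whereas \<open>\<kappa> p\<close> only reaches
  \<open>p\<close> after multiplication by \<open>s\<close>. So words that agree on \<open>p\<close>
  can be compared by derivations over \<open>P\<close> when \<open>kh p\<close> follows
  them.\<close>

lemma kh:
  assumes "p \<in> Ob"
  shows "kh p \<in> words P" "ev (kh p) = p" "ok (kh p) s" "st (kh p) s = p"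
    "\<phi> (kh p) s = \<phi> (\<kappa> p) s @ \<phi> sw s"
proof -
  show w: "kh p \<in> words P" using \<kappa>[OF assms] sw by simp
  show "ev (kh p) = p" using \<kappa>[OF assms] sw ev_sw by (simp add: ev_append)
  show ok: "ok (kh p) s" using \<kappa>[OF assms] sw_ok sw_st by (simp add: ok_append)
  show "st (kh p) s = p" using st_append[OF ok] sw_st \<kappa>[OF assms] by simp
  show "\<phi> (kh p) s = \<phi> (\<kappa> p) s @ \<phi> sw s" using \<phi>_append[OF ok] sw_st by simp
qed

lemma c2_path: "p \<in> Ob \<Longrightarrow> dpath Q (\<phi> (kh p) s) (c2 p) []"
proof -
  assume p: "p \<in> Ob"
  have "dpath Q (\<phi> (\<kappa> p) s @ \<phi> sw s @ []) (path_act (\<phi> (\<kappa> p) s) cs []) (\<phi> (\<kappa> p) s @ [] @ [])"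
    by (rule dpath_act[OF Q cs \<phi>_words[OF \<kappa>(3)[OF p]]]) simp
  then show ?thesis unfolding c2_def using dpath_appendI[OF Q _ Ce[OF p]] kh(5)[OF p] by simp
qed

lemma edge_data_exists:
  assumes e: "edge a p"
  shows "\<exists>D. edge_data a p D"
proof -
  let ?q = "st [a] p"
  have p: "p \<in> Ob" and q: "?q \<in> Ob" using edge_O[OF e] st_O[OF edge_ok[OF e]] .
  have a: "ev [a] \<in> carrier S" by (rule ev_closed[OF edge_word[OF e]])
  have apV: "ev [a] \<otimes> p \<in> V" by (rule ok_V[OF edge_ok[OF e]])
  have t: "trel ?q (ev [a] \<otimes> p)" unfolding st_def by (rule trel_sym[OF rp_trel[OF apV]])
  have ideal: "\<exists>t\<in>carrier S. ?q = t \<otimes> s" "\<exists>t\<in>carrier S. ev [a] \<otimes> p = t \<otimes> s"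
    using O_V[OF q] apV unfolding vertices_def by blast+
  \<comment> \<open>\<open>common_factor\<close> is applied to the state and the actual product
    \<open>ev [a] \<otimes> p\<close>: \<open>m\<close> fixes the former and \<open>n\<close>
    carries it to the latter.\<close>
  obtain f m n where f: "f \<in> V" and m: "m \<in> carrier S" and n: "n \<in> carrier S"
    and mf: "trel (m \<otimes> s) f" and nf: "trel (n \<otimes> s) f" and V: "m \<otimes> s \<in> V" "n \<otimes> s \<in> V"
    and qf: "trel (?q \<otimes> f) ?q" and qm: "?q \<otimes> m = ?q" and qn: "?q \<otimes> n = ev [a] \<otimes> p"
    using common_factor[OF t O_carrier[OF q] V_carrier[OF apV] ideal] by blast
  obtain m' where m': "m' \<in> words P" "ev m' = m" using ev_surj[OF m] by blast
  obtain n' where n': "n' \<in> words P" "ev n' = n" using ev_surj[OF n] by blast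
  let ?E = "rp f"
  have E: "?E \<in> Ob" by (rule rp_Ob[OF f])
  have mn: "ok m' s" "st m' s = ?E" "ok n' s" "st n' s = ?E"
    using m' n' V s_O rp_eq[OF V(1) f mf] rp_eq[OF V(2) f nf] by (simp_all add: ok_def st_def)
  note car = O_carrier[OF q] V_carrier[OF f] O_carrier[OF E]
  have qfV: "?q \<otimes> f \<in> V"
  proof -
    obtain \<alpha> where \<alpha>: "\<alpha> \<in> carrier S" "\<alpha> \<otimes> ?q \<in> H" using O_V[OF q] unfolding vertices_def by blast
    have "\<alpha> \<otimes> (?q \<otimes> f) \<in> H" by (rule trel_H[OF trel_sym[OF qf] car(1) \<alpha>])
    then show ?thesis
      using V_left_ideal[OF f car(1)] \<alpha>(1) car unfolding vertices_def by auto
  qed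
  have qEV: "?q \<otimes> ?E \<in> V" by (rule V_trel[OF f rp_V[OF f] rp_trel[OF f] car(1) qfV])
  have "trel (?q \<otimes> f) (?q \<otimes> ?E)" by (rule trel_left[OF rp_trel[OF f] car(2,3,1)])
  then have "rp (?q \<otimes> ?E) = rp (?q \<otimes> f)" using rp_eq[OF qfV qEV] by simp
  also have "\<dots> = rp ?q" by (rule rp_eq[OF qfV O_V[OF q] qf])
  finally have rq: "rp (?q \<otimes> ?E) = ?q" using rp_O[OF q] by simp
  have K: "ok (kh ?q) ?E" "st (kh ?q) ?E = ?q"
    using kh(1,2)[OF q] E qEV rq by (simp_all add: ok_def st_def)
  have evs: "ev (kh ?q @ m') = ev (kh ?q)"
    by (simp only: ev_append[OF kh(1)[OF q] m'(1)] kh(2)[OF q] m'(2) qm)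
  have evs': "ev (kh ?q @ n') = ev ([a] @ kh p)"
    by (simp only: ev_append[OF kh(1)[OF q] n'(1)] ev_append[OF edge_word[OF e] kh(1)[OF p]]
        kh(2)[OF q] kh(2)[OF p] n'(2) qn)
  let ?K = "\<phi> (kh ?q) ?E" and ?M = "\<phi> m' s"
  have KM: "conn (?K @ ?M) []"
  proof -
    have okm: "ok (kh ?q @ m') s" using K mn kh(1)[OF q] by (simp only: ok_append simp_thms)
    have "dpath Q (\<phi> (kh ?q @ m') s) (dl (kh ?q @ m') (kh ?q) s) (\<phi> (kh ?q) s)"
      by (rule dl_path[OF okm kh(1)[OF q] evs])
    then have "dpath Q (?K @ ?M) (dl (kh ?q @ m') (kh ?q) s) (\<phi> (kh ?q) s)"
      using \<phi>_append[OF okm] mn by simp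
    then show ?thesis unfolding conn_def using dpath_appendI[OF Q _ c2_path[OF q]] by blast
  qed
  have KQ: "?K \<in> words Q" and MQ: "?M \<in> words Q" using \<phi>_words K(1) mn(1) by blast+
  \<comment> \<open>\<open>K M\<close> is null and \<open>K\<close> has a left inverse
    \<open>v\<close>. Inserting \<open>v K\<close> in front of \<open>M K\<close> shows that
    \<open>M K\<close> is null as well.\<close>
  obtain v where v: "v \<in> words Q" "conn (v @ ?K) []" using left_inverse[OF K(1)] by blast
  have "conn ([] @ (v @ ?K) @ (?M @ ?K)) ([] @ [] @ (?M @ ?K))"
    by (rule conn_context[OF v(2)]) (use KQ MQ in simp_all)
  then have "conn (?M @ ?K) (v @ (?K @ ?M) @ ?K)" using conn_sym by simp
  moreover have "conn (v @ (?K @ ?M) @ ?K) (v @ [] @ ?K)" by (rule conn_context[OF KM v(1) KQ])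
  ultimately have "conn (?M @ ?K) (v @ [] @ ?K)" by (rule conn_trans)
  then have "conn (?M @ ?K) (v @ ?K)" by simp
  then have "conn (?M @ ?K) []" using v(2) by (rule conn_trans)
  then obtain d where "dpath Q (?M @ ?K) d []" unfolding conn_def by blast
  then have "edge_data a p (?E, m', n', d)"
    unfolding edge_data_def using mn K evs evs' by simp
  then show ?thesis by blast
qed

lemma ed: "edge a p \<Longrightarrow> edge_data a p (ed a p)"
  unfolding ed_def by (rule someI_ex[OF edge_data_exists])

lemma c1_path:
  assumes "q \<in> Ob" "ok m s" "ok (kh q) (st m s)" "ev (kh q @ m) = ev (kh q)"
  shows "dpath Q (\<phi> (kh q) (st m s) @ \<phi> m s) (c1 m q) []"
proof -
  have okm: "ok (kh q @ m) s" using assms(2,3) kh(1)[OF assms(1)] by (simp only: ok_append simp_thms)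
  have "dpath Q (\<phi> (kh q @ m) s) (dl (kh q @ m) (kh q) s) (\<phi> (kh q) s)"
    by (rule dl_path[OF okm kh(1)[OF assms(1)] assms(4)])
  then show ?thesis
    unfolding c1_def \<phi>_append[OF okm] using dpath_appendI[OF Q _ c2_path[OF assms(1)]] by blast
qed

lemma parallel_closed:
  assumes "dpath Q u p v" "dpath Q u q v"
  shows "\<exists>u. dpath Q u (p @ dinv q) u"
  using dpath_appendI[OF Q assms(1) dpath_dinv[OF Q assms(2)]] by blast

lemma Y_closed: "closed_paths Q Y"
  unfolding closed_paths_def
proof
  fix y assume "y \<in> Y"
  then consider (X) q p u where "y = \<Phi> q p" "dpath P u q u" "ok u p"
    | (zig) a p where "y = zig a p" "edge a p"
    | (ck) p where "y = ck p" "p \<in> Ob"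
    | (C) "y = Ce s"
    | (adj) a p where "y = adj a p" "edge a p"
    unfolding Y_def by blast
  then show "\<exists>u. dpath Q u y u"
  proof cases
    case X
    then show ?thesis using \<Phi>_path by blast
  next
    case zig
    note L = pos_letters[OF zig(2)]
    have 1: "dpath Q ([] @ [pos a p, neg a p] @ [pos a p])
        (path_act [] [Edge [] ([pos a p, neg a p], []) True []] [pos a p]) ([] @ [] @ [pos a p])"
      by (rule dpath_act[OF Q rel_path[OF Q_rels(1)[OF zig(2)]]]) (use L in simp_all)
    have 2: "dpath Q ([pos a p] @ [neg a p, pos a p] @ [])
        (path_act [pos a p] [Edge [] ([neg a p, pos a p], []) True []] []) ([pos a p] @ [] @ [])"
      by (rule dpath_act[OF Q rel_path[OF Q_rels(2)[OF zig(2)]]]) (use L in simp_all)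
    show ?thesis unfolding zig zig_def
      by (rule parallel_closed[of "[pos a p, neg a p, pos a p]" _ "[pos a p]"]) (use 1 2 in simp_all)
  next
    case ck
    let ?k = "\<phi> (\<kappa> p) s"
    have k: "?k \<in> words Q" by (rule \<phi>_words[OF \<kappa>(3)[OF ck(2)]])
    have 1: "dpath Q ([] @ ?k @ ?k) (path_act [] (Ce p) ?k) ([] @ [] @ ?k)"
      by (rule dpath_act[OF Q Ce[OF ck(2)]]) (use k in simp_all)
    have 2: "dpath Q (?k @ ?k @ []) (path_act ?k (Ce p) []) (?k @ [] @ [])"
      by (rule dpath_act[OF Q Ce[OF ck(2)] k]) simp
    show ?thesis unfolding ck ck_def
      by (rule parallel_closed[of "?k @ ?k" _ ?k]) (use 1 2 in simp_all)
  next
    case C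
    then show ?thesis using Ce[OF s_O] by (intro exI[of _ "[]"]) simp
  next
    case adj
    obtain E m n d where D: "ed a p = (E, m, n, d)" by (cases "ed a p") auto
    let ?q = "st [a] p"
    let ?K = "\<phi> (kh ?q) E" and ?M = "\<phi> m s"
    have q: "?q \<in> Ob" by (rule st_O[OF edge_ok[OF adj(2)]])
    have dat: "ok m s" "st m s = E" "ok (kh ?q) E" "ev (kh ?q @ m) = ev (kh ?q)" "dpath Q (?M @ ?K) d []"
      using ed[OF adj(2)] unfolding D edge_data_def by simp_all
    have K: "?K \<in> words Q" by (rule \<phi>_words[OF dat(3)])
    have 1: "dpath Q (?K @ (?M @ ?K) @ []) (path_act ?K d []) (?K @ [] @ [])"
      by (rule dpath_act[OF Q dat(5) K]) simp
    have "dpath Q (?K @ ?M) (c1 m ?q) []" using c1_path[OF q dat(1)] dat by simp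
    then have 2: "dpath Q ([] @ (?K @ ?M) @ ?K) (path_act [] (c1 m ?q) ?K) ([] @ [] @ ?K)"
      by (rule dpath_act[OF Q]) (use K in simp_all)
    show ?thesis unfolding adj adj_def D prod.case
      by (rule parallel_closed[of "?K @ ?M @ ?K" _ ?K]) (use 1 2 in simp_all)
  qed
qed

lemma Y_finite:
  assumes "finite X" "finite (letters P)"
  shows "finite Y"
proof -
  note E = edge_finite[OF assms(2)]
  have "{\<Phi> q p | q p. q \<in> X \<and> p \<in> Ob \<and> (\<exists>u. dpath P u q u \<and> ok u p)} \<subseteq> (\<lambda>(q, p). \<Phi> q p) ` (X \<times> Ob)"
    by force
  then have 1: "finite {\<Phi> q p | q p. q \<in> X \<and> p \<in> Ob \<and> (\<exists>u. dpath P u q u \<and> ok u p)}"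
    by (rule finite_subset) (use assms(1) finite_Ob in simp)
  have "{zig a p | a p. edge a p} = (\<lambda>(a, p). zig a p) ` {(a, p). edge a p}" by force
  then have 2: "finite {zig a p | a p. edge a p}" by (simp only: finite_imageI[OF E])
  have "{adj a p | a p. edge a p} = (\<lambda>(a, p). adj a p) ` {(a, p). edge a p}" by force
  then have 3: "finite {adj a p | a p. edge a p}" by (simp only: finite_imageI[OF E])
  show ?thesis unfolding Y_def using 1 2 3 finite_Ob by simp
qed

text \<open>Derivations that cannot be read from \<open>p\<close> get 0. Readability is constant
  along paths, so this default is compatible with the conditions on a labelling.\<close>

definition pull :: "('b edge \<Rightarrow> 'g::group_add) \<Rightarrow> 'a \<Rightarrow> 'c edge \<Rightarrow> 'g" where
  "pull \<theta> p E = (if ok (edge_src E) p then \<theta> (\<Phi>e E p) else 0)"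

lemma pull_sum:
  assumes "dpath P U q W"
  shows "(\<Sum>e\<leftarrow>q. pull \<theta> p e) = (if ok U p then (\<Sum>e\<leftarrow>\<Phi> q p. \<theta> e) else 0)"
  using assms
proof (induction q arbitrary: U)
  case (Cons E q)
  then have E: "E \<in> dedges P" "edge_src E = U" "dpath P (edge_tgt E) q W"
    using dpath_Cons[OF P] by auto
  show ?case using Cons.IH[OF E(3)] edge_ok_tgt[OF E(1), of p] E(2) by (simp add: pull_def)
qed simp

lemma pull_labelling:
  assumes lab: "labelling Q Y \<theta>"
  shows "labelling P X (pull \<theta> p)"
  unfolding labelling_def
proof (intro conjI ballI)
  fix E assume E: "E \<in> dedges P"
  show "pull \<theta> p (edge_rev E) = - pull \<theta> p E"
  proof (cases "ok (edge_src E) p")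
    case True
    then show ?thesis
      using \<Phi>e[OF E True] lab edge_ok_tgt[OF E] by (simp add: pull_def labelling_def)
  next
    case False
    then show ?thesis using edge_ok_tgt[OF E] by (simp add: pull_def)
  qed
next
  fix E F assume EF: "E \<in> dedges P" "F \<in> dedges P"
  have path: "dpath P (edge_src E @ edge_src F) (commuting_square E F) (edge_src E @ edge_src F)"
    by (rule commuting_square_closed[OF P EF])
  show "(\<Sum>e\<leftarrow>commuting_square E F. pull \<theta> p e) = 0"
  proof (cases "ok (edge_src E @ edge_src F) p")
    case True
    have "(\<Sum>e\<leftarrow>\<Phi> (commuting_square E F) p. \<theta> e) = 0"
      using \<Phi>_square[OF EF True] lab unfolding labelling_def by simp
    then show ?thesis using pull_sum[OF path, of \<theta> p] True by simp
  next
    case False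
    then show ?thesis using pull_sum[OF path, of \<theta> p] by simp
  qed
next
  fix q \<alpha> \<beta> assume q: "q \<in> X" and w: "\<alpha> \<in> words P" "\<beta> \<in> words P"
  obtain u where u: "dpath P u q u" using q X_closed unfolding closed_paths_def by blast
  have path: "dpath P (\<alpha> @ u @ \<beta>) (path_act \<alpha> q \<beta>) (\<alpha> @ u @ \<beta>)" by (rule dpath_act[OF P u w])
  show "(\<Sum>e\<leftarrow>path_act \<alpha> q \<beta>. pull \<theta> p e) = 0"
  proof (cases "ok (\<alpha> @ u @ \<beta>) p")
    case True
    note s1 = ok_appendD[OF True] and s2 = ok_appendD[OF ok_appendD(2)[OF True]]
    have "\<Phi> q (st \<beta> p) \<in> Y" unfolding Y_def using q u s2(3) st_O[OF s2(2)] by blast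
    then have "(\<Sum>e\<leftarrow>\<Phi> (path_act \<alpha> q \<beta>) p. \<theta> e) = 0"
      unfolding \<Phi>_act[OF u True] using lab \<phi>_words[OF s1(3)] \<phi>_words[OF s2(2)]
      unfolding labelling_def by blast
    then show ?thesis using pull_sum[OF path, of \<theta> p] True by simp
  next
    case False
    then show ?thesis using pull_sum[OF path, of \<theta> p] by simp
  qed
qed

text \<open>Here the homotopy base of \<open>P\<close> enters: the closed path
  \<open>q @ dinv r\<close> is null-homotopic over \<open>P\<close>, and the label pulled back to it
  is the difference of the labels of the two readings.\<close>

lemma derivations_heq:
  assumes q: "dpath P U q W" and r: "dpath P U r W" and ok: "ok U p"
  shows "heq Q Y (\<Phi> q p) (\<Phi> r p)"
  unfolding heq_def
proof (intro allI impI)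
  fix \<theta> :: "'b edge \<Rightarrow> 'b edge list set sym_group" assume lab: "labelling Q Y \<theta>"
  note pl = pull_labelling[OF lab, of p]
  have closed: "dpath P U (q @ dinv r) U" by (rule dpath_appendI[OF P q dpath_dinv[OF P r]])
  have "homotopic (adjoin_cells P X) U U (q @ dinv r) []"
    using hb closed unfolding homotopy_base_def by blast
  from label_homotopic[OF P X_closed pl this]
  have "(\<Sum>e\<leftarrow>q @ dinv r. pull \<theta> p e) = 0" by simp
  then have "(\<Sum>e\<leftarrow>q. pull \<theta> p e) = (\<Sum>e\<leftarrow>r. pull \<theta> p e)"
    using label_dinv[OF pl, of r] r by (simp add: dpath_def)
  then show "(\<Sum>e\<leftarrow>\<Phi> q p. \<theta> e) = (\<Sum>e\<leftarrow>\<Phi> r p. \<theta> e)"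
    using pull_sum[OF q, of \<theta> p] pull_sum[OF r, of \<theta> p] ok by simp
qed

end

section \<open>Label identities over \<open>Q\<close>\<close>

locale squier_label = squier_fdt S H s rp P ev sw enc X
  for S :: "('a, 'm) monoid_scheme" (structure) and H s rp and P :: "'c presentation"
    and ev sw and enc :: "'c \<Rightarrow> 'a \<Rightarrow> bool \<Rightarrow> 'b" and X +
  fixes \<theta> :: "'b edge \<Rightarrow> 'b edge list set sym_group"
  assumes labelling: "labelling Q Y \<theta>"
begin

sublocale sym_labelled Q Y \<theta>
  by unfold_locales (rule Q, rule labelling)

lemma val_derivation:
  assumes "dpath P U q W" "ok U p" "\<alpha> \<in> words Q" "\<beta> \<in> words Q"
  shows "val \<alpha> (\<Phi> q p) \<beta> = val \<alpha> (dl U W p) \<beta>"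
proof -
  obtain r where r: "dpath P U r W" "dl U W p = \<Phi> r p"
    using dl_obtain[OF dpath_ends[OF P assms(1)] path_ev[OF assms(1)]] by metis
  show ?thesis unfolding r(2) by (rule val_heq[OF derivations_heq[OF assms(1) r(1) assms(2)] assms(3,4)])
qed

lemma dl_trans:
  assumes "ok U p" "W \<in> words P" "Z \<in> words P" "ev U = ev W" "ev W = ev Z"
    and "\<alpha> \<in> words Q" "\<beta> \<in> words Q"
  shows "val \<alpha> (dl U W p) \<beta> + val \<alpha> (dl W Z p) \<beta> = val \<alpha> (dl U Z p) \<beta>"
proof -
  obtain q where q: "dpath P U q W" "dl U W p = \<Phi> q p"
    using dl_obtain[OF ok_words[OF assms(1)] assms(2,4)] by metis
  obtain r where r: "dpath P W r Z" "dl W Z p = \<Phi> r p"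
    using dl_obtain[OF assms(2,3,5)] by metis
  show ?thesis
    using val_derivation[OF dpath_appendI[OF P q(1) r(1)] assms(1,6,7)] q(2) r(2) by simp
qed

lemma dl_refl: "ok U p \<Longrightarrow> \<alpha> \<in> words Q \<Longrightarrow> \<beta> \<in> words Q \<Longrightarrow> val \<alpha> (dl U U p) \<beta> = 0"
  using val_derivation[of U "[]" U p \<alpha> \<beta>] ok_words by simp

lemma dl_sym:
  assumes "ok U p" "W \<in> words P" "ev U = ev W" "\<alpha> \<in> words Q" "\<beta> \<in> words Q"
  shows "val \<alpha> (dl W U p) \<beta> = - val \<alpha> (dl U W p) \<beta>"
proof -
  have "val \<alpha> (dl U W p) \<beta> + val \<alpha> (dl W U p) \<beta> = 0"
    using dl_trans[OF assms(1,2) ok_words[OF assms(1)] assms(3) assms(3)[symmetric] assms(4,5)]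
      dl_refl[OF assms(1,4,5)] by simp
  then show ?thesis by (metis minus_unique)
qed

lemma dl_context:
  assumes ok: "ok (\<gamma> @ U @ \<delta>) p" and W: "W \<in> words P" "ev U = ev W"
    and "\<alpha> \<in> words Q" "\<beta> \<in> words Q"
  shows "val \<alpha> (dl (\<gamma> @ U @ \<delta>) (\<gamma> @ W @ \<delta>) p) \<beta> =
    val (\<alpha> @ \<phi> \<gamma> (st (U @ \<delta>) p)) (dl U W (st \<delta> p)) (\<phi> \<delta> p @ \<beta>)"
proof -
  have w: "U \<in> words P" "\<gamma> \<in> words P" "\<delta> \<in> words P" using ok_words[OF ok] by simp_all
  obtain q where q: "dpath P U q W" "\<And>p. dl U W p = \<Phi> q p"
    using dl_obtain[OF w(1) W] by metis
  have path: "dpath P (\<gamma> @ U @ \<delta>) (path_act \<gamma> q \<delta>) (\<gamma> @ W @ \<delta>)" by (rule dpath_act[OF P q(1) w(2,3)])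
  show ?thesis
    unfolding val_derivation[OF path ok assms(4,5), symmetric] \<Phi>_act[OF q(1) ok] q(2) by simp
qed

lemma \<phi>Q: "ends W p x \<Longrightarrow> \<phi> W p \<in> words Q"
  by (rule \<phi>_words[OF endsD(5)])

lemma dt_val:
  assumes "ends U s x" "\<alpha> \<in> words Q" "\<beta> \<in> words Q"
  shows "val \<alpha> (dt U W) \<beta> = - val (\<alpha> @ \<phi> U s) cs \<beta> + val \<alpha> (dl (U @ sw) (W @ sw) s) \<beta> + val (\<alpha> @ \<phi> W s) cs \<beta>"
  unfolding dt_def using val_dinv[OF cs, of "\<alpha> @ \<phi> U s" \<beta>] \<phi>Q[OF assms(1)] assms(2,3)
  by (simp add: add.assoc)

lemma dt_trans:
  assumes "ends U s x" "ends W s x" "ends Z s x" "\<alpha> \<in> words Q" "\<beta> \<in> words Q"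
  shows "val \<alpha> (dt U W) \<beta> + val \<alpha> (dt W Z) \<beta> = val \<alpha> (dt U Z) \<beta>"
proof -
  note e = ends_sw[OF assms(1)] ends_sw[OF assms(2)] ends_sw[OF assms(3)]
  have "val \<alpha> (dl (U @ sw) (W @ sw) s) \<beta> + val \<alpha> (dl (W @ sw) (Z @ sw) s) \<beta> = val \<alpha> (dl (U @ sw) (Z @ sw) s) \<beta>"
    by (rule dl_trans[OF endsD(5)[OF e(2)] endsD(1)[OF e(4)] endsD(1)[OF e(6)] _ _ assms(4,5)])
      (simp_all only: e(1) e(3) e(5))
  note tr = this[symmetric]
  show ?thesis unfolding dt_val[OF assms(1,4,5)] dt_val[OF assms(2,4,5)] tr
    by (simp add: add.assoc)
qed

text \<open>When the words already agree in \<open>S\<close>, the derivation acts to the left of the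
  inserted \<open>sw\<close> and slides past its deletion, so the insertion has no effect on the
  label.\<close>

lemma dt_derivation:
  assumes W: "ends W s x" and Z: "Z \<in> words P" "ev W = ev Z" and w: "\<alpha> \<in> words Q" "\<beta> \<in> words Q"
  shows "val \<alpha> (dt W Z) \<beta> = val \<alpha> (dl W Z s) \<beta>"
proof -
  have Z': "ends Z s x" using W Z by (simp add: ends_def)
  note path = dl_path[OF endsD(5)[OF W] Z]
  have "val \<alpha> (dl ([] @ W @ sw) ([] @ Z @ sw) s) \<beta> = val \<alpha> (dl W Z s) (\<phi> sw s @ \<beta>)"
    by (subst dl_context) (use endsD(5)[OF ends_sw(2)[OF W]] Z w sw_st in simp_all)
  then have c: "val \<alpha> (dl (W @ sw) (Z @ sw) s) \<beta> = val \<alpha> (dl W Z s) (\<phi> sw s @ \<beta>)" by simp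
  have "val \<alpha> (dl W Z s) (\<phi> sw s @ \<beta>) + val (\<alpha> @ \<phi> Z s) cs \<beta> = val (\<alpha> @ \<phi> W s) cs \<beta> + val \<alpha> (dl W Z s) ([] @ \<beta>)"
    by (rule interchange0[OF path cs w])
  then show ?thesis unfolding dt_val[OF W w] c by (simp add: add.assoc)
qed

lemma om_val: "val \<alpha> (om W p x) \<beta> = val \<alpha> (dt (wt x s) (W @ \<kappa> p)) \<beta> + val (\<alpha> @ \<phi> W p) (Ce p) \<beta>"
  by (simp add: om_def)

lemma om_derivation:
  assumes W: "ends W p x" and Z: "Z \<in> words P" "ev W = ev Z" and w: "\<alpha> \<in> words Q" "\<beta> \<in> words Q"
  shows "val \<alpha> (om W p x) \<beta> + val \<alpha> (dl W Z p) \<beta> = val \<alpha> (om Z p x) \<beta>"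
proof -
  note W' = endsD[OF W]
  note p = \<kappa>[OF W'(2)]
  have Z': "ends Z p x" using W Z by (simp add: ends_def)
  note path = dl_path[OF W'(5) Z]
  note eW = ends_\<kappa>[OF W] and eZ = ends_\<kappa>[OF Z'] and u = wt[OF s_O W'(3)]
  have ev: "ev (W @ \<kappa> p) = ev (Z @ \<kappa> p)" using W'(1) Z p(1) by (simp add: ev_append)
  have "val \<alpha> (dl ([] @ W @ \<kappa> p) ([] @ Z @ \<kappa> p) s) \<beta> = val \<alpha> (dl W Z p) (\<phi> (\<kappa> p) s @ \<beta>)"
    by (subst dl_context) (use endsD(5)[OF eW] Z w p in simp_all)
  then have c: "val \<alpha> (dt (W @ \<kappa> p) (Z @ \<kappa> p)) \<beta> = val \<alpha> (dl W Z p) (\<phi> (\<kappa> p) s @ \<beta>)"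
    using dt_derivation[OF eW endsD(1)[OF eZ] ev w] by simp
  have i: "val \<alpha> (dl W Z p) (\<phi> (\<kappa> p) s @ \<beta>) + val (\<alpha> @ \<phi> Z p) (Ce p) \<beta> = val (\<alpha> @ \<phi> W p) (Ce p) \<beta> + val \<alpha> (dl W Z p) \<beta>"
    using interchange0[OF path Ce[OF W'(2)] w] by simp
  have t: "val \<alpha> (dt (wt x s) (W @ \<kappa> p)) \<beta> + val \<alpha> (dt (W @ \<kappa> p) (Z @ \<kappa> p)) \<beta> = val \<alpha> (dt (wt x s) (Z @ \<kappa> p)) \<beta>"
    by (rule dt_trans[OF u eW eZ w])
  show ?thesis unfolding om_val t[symmetric] c using i by (simp add: add.assoc)
qed

text \<open>The normal form cancels from the difference by \<open>dt_trans\<close>. What is left is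
  a derivation from \<open>W @ kh p\<close> to \<open>Z @ kh p\<close>, enclosed between an
  insertion and a deletion of \<open>kh p\<close>.\<close>

lemma om_diff:
  assumes W: "ends W p x" and Z: "ends Z p x" and w: "\<alpha> \<in> words Q" "\<beta> \<in> words Q"
  shows "- val \<alpha> (om W p x) \<beta> + val \<alpha> (om Z p x) \<beta> =
    - val (\<alpha> @ \<phi> W p) (c2 p) \<beta> + val \<alpha> (dl (W @ kh p) (Z @ kh p) s) \<beta> + val (\<alpha> @ \<phi> Z p) (c2 p) \<beta>"
proof -
  note p = endsD(2)[OF W]
  note eW = ends_\<kappa>[OF W] and eZ = ends_\<kappa>[OF Z] and u = wt[OF s_O endsD(3)[OF W]]
  have c2: "val (\<alpha> @ \<phi> V p) (c2 p) \<beta> = val (\<alpha> @ \<phi> V p @ \<phi> (\<kappa> p) s) cs \<beta> + val (\<alpha> @ \<phi> V p) (Ce p) \<beta>" for V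
    by (simp add: c2_def)
  have d: "val \<alpha> (dt (W @ \<kappa> p) (Z @ \<kappa> p)) \<beta> = - val (\<alpha> @ \<phi> W p @ \<phi> (\<kappa> p) s) cs \<beta> +
      val \<alpha> (dl (W @ kh p) (Z @ kh p) s) \<beta> + val (\<alpha> @ \<phi> Z p @ \<phi> (\<kappa> p) s) cs \<beta>"
    using dt_val[OF eW w, of "Z @ \<kappa> p"] \<phi>_\<kappa>[OF W] \<phi>_\<kappa>[OF Z] by simp
  have "val \<alpha> (dt (wt x s) (W @ \<kappa> p)) \<beta> + val \<alpha> (dt (W @ \<kappa> p) (Z @ \<kappa> p)) \<beta> = val \<alpha> (dt (wt x s) (Z @ \<kappa> p)) \<beta>"
    by (rule dt_trans[OF u eW eZ w])
  note t = this[symmetric]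
  show ?thesis unfolding om_val t c2 d by (simp add: add.assoc minus_add diff_conv_add_uminus del: add_uminus_conv_diff)
qed

text \<open>As \<open>y\<close> and \<open>kh p @ n\<close> agree in \<open>S\<close>, the
  derivation from \<open>W @ y\<close> to \<open>Z @ y\<close> can be routed through
  \<open>W @ kh p @ n\<close> and \<open>Z @ kh p @ n\<close>. In the middle, \<open>n\<close> is an
  inert right context and the rest takes place at the state \<open>E\<close>. Applied to both ways
  back, this reduces them to one and the same derivation.\<close>

lemma dl_transport:
  assumes W: "ends W p x" and Z: "ends Z p x" and n: "ok n s" "st n s = E"
    and K: "ok (kh p) E" "st (kh p) E = p" and y: "y \<in> words P" "ev (kh p @ n) = ev y"
    and w: "\<alpha> \<in> words Q" "\<beta> \<in> words Q"
  shows "val \<alpha> (dl (W @ y) (Z @ y) s) \<beta> =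
    - val (\<alpha> @ \<phi> W p) (dl (kh p @ n) y s) \<beta> + val \<alpha> (dl (W @ kh p) (Z @ kh p) E) (\<phi> n s @ \<beta>) +
    val (\<alpha> @ \<phi> Z p) (dl (kh p @ n) y s) \<beta>"
proof -
  note W' = endsD[OF W] and Z' = endsD[OF Z]
  have nw: "n \<in> words P" and khw: "kh p \<in> words P" using ok_words[OF n(1)] ok_words[OF K(1)] .
  have okK: "ok (kh p @ n) s" using n K khw by (simp only: ok_append simp_thms)
  have stK: "st (kh p @ n) s = p" using st_append[OF okK] n K by simp
  have okW: "ok (W @ kh p @ n) s" and okZ: "ok (Z @ kh p @ n) s"
    using W' Z' okK stK ok_append[of W "kh p @ n" s] ok_append[of Z "kh p @ n" s] by simp_all
  have evK: "ev (kh p) = p" by (rule kh(2)[OF W'(2)])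
  have ev_eq: "ev (W @ kh p) = ev (Z @ kh p)"
    using ev_append[OF W'(1) khw] ev_append[OF Z'(1) khw] evK W'(4) Z'(4) by simp
  have evV: "ev (V @ kh p @ n) = ev (V @ y)" if "V \<in> words P" for V
    using that y khw nw ev_append[OF that, of "kh p @ n"] ev_append[OF that y(1)] by simp
  have 1: "val \<alpha> (dl (V @ kh p @ n) (V @ y) s) \<beta> = val (\<alpha> @ \<phi> V p) (dl (kh p @ n) y s) \<beta>"
    if "ok (V @ kh p @ n) s" for V
    using dl_context[of V "kh p @ n" "[]" s y \<alpha> \<beta>] that y w stK s_O by simp
  have 2: "val \<alpha> (dl (W @ kh p @ n) (Z @ kh p @ n) s) \<beta> = val \<alpha> (dl (W @ kh p) (Z @ kh p) E) (\<phi> n s @ \<beta>)"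
    using dl_context[of "[]" "W @ kh p" n s "Z @ kh p" \<alpha> \<beta>] okW ev_eq n w Z'(1) khw by simp
  have okWy: "ok (W @ y) s"
    using ok_cong[OF evV[OF W'(1)], of s] okW W'(1) y(1) khw nw by simp
  have evWZ: "ev (W @ kh p @ n) = ev (Z @ kh p @ n)"
    using ev_eq ev_append[of "W @ kh p" n] ev_append[of "Z @ kh p" n] W'(1) Z'(1) khw nw by simp
  note words = W'(1) Z'(1) khw nw y(1)
  have "val \<alpha> (dl (W @ y) (Z @ y) s) \<beta> = val \<alpha> (dl (W @ y) (W @ kh p @ n) s) \<beta> + val \<alpha> (dl (W @ kh p @ n) (Z @ y) s) \<beta>"
    by (rule dl_trans[symmetric]) (use okWy words evV[OF W'(1)] evV[OF Z'(1)] evWZ w in simp_all)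
  also have "val \<alpha> (dl (W @ y) (W @ kh p @ n) s) \<beta> = - val \<alpha> (dl (W @ kh p @ n) (W @ y) s) \<beta>"
    by (rule dl_sym) (use okW words evV[OF W'(1)] w in simp_all)
  also have "val \<alpha> (dl (W @ kh p @ n) (Z @ y) s) \<beta> =
      val \<alpha> (dl (W @ kh p @ n) (Z @ kh p @ n) s) \<beta> + val \<alpha> (dl (Z @ kh p @ n) (Z @ y) s) \<beta>"
    by (rule dl_trans[symmetric]) (use okW words evV[OF Z'(1)] evWZ w in simp_all)
  finally show ?thesis unfolding 1[OF okW] 1[OF okZ] 2 by (simp add: add.assoc)
qed

lemma adj_val:
  assumes e: "edge a p" and D: "ed a p = (E, m, n, d)" and w: "\<alpha> \<in> words Q" "\<beta> \<in> words Q"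
  shows "val \<alpha> (c1 m (st [a] p)) (\<phi> (kh (st [a] p)) E @ \<beta>) = val (\<alpha> @ \<phi> (kh (st [a] p)) E) d \<beta>"
proof -
  let ?q = "st [a] p"
  let ?K = "\<phi> (kh ?q) E"
  have q: "?q \<in> Ob" by (rule st_O[OF edge_ok[OF e]])
  have dat: "ok m s" "st m s = E" "ok (kh ?q) E" "ev (kh ?q @ m) = ev (kh ?q)"
    using ed[OF e] unfolding D edge_data_def by simp_all
  have K: "?K \<in> words Q" by (rule \<phi>_words[OF dat(3)])
  have path: "dpath Q (?K @ \<phi> m s) (c1 m ?q) []" using c1_path[OF q dat(1)] dat by simp
  have pact: "dpath Q ([] @ (?K @ \<phi> m s) @ ?K) (path_act [] (c1 m ?q) ?K) ([] @ [] @ ?K)"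
    by (rule dpath_act[OF Q path]) (use K in simp_all)
  have "adj a p \<in> Y" unfolding Y_def using e by blast
  then have "val \<alpha> (adj a p) \<beta> = 0" by (rule val_cell[OF _ w])
  then have "val (\<alpha> @ ?K) d \<beta> + - val \<alpha> (path_act [] (c1 m ?q) ?K) \<beta> = 0"
    unfolding adj_def D prod.case by (simp only: val_append val_dinv[OF pact w] val_act append_Nil)
  then show ?thesis by simp
qed

lemma eq_conj:
  fixes a b c d e f :: "'g::group_add"
  assumes "a + b = c + d"
  shows "- c + a + b = d" "d = - c + (a + b)"
  using assms by (simp_all add: add.assoc)

text \<open>This independence of \<open>W\<close> rests on the common factor \<open>E\<close> of the two ways in which
  paths starting at the vertex \<open>st [a] p\<close> return to \<open>H\<close>.\<close>

lemma om_step: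
  assumes e: "edge a p" and W: "ends W (st [a] p) x" and Z: "ends Z (st [a] p) x"
    and w: "\<alpha> \<in> words Q" "\<beta> \<in> words Q"
  defines "x' \<equiv> act x (pos a p)"
  shows "- val \<alpha> (om W (st [a] p) x) (pos a p # \<beta>) + val \<alpha> (om Z (st [a] p) x) (pos a p # \<beta>) =
    - val \<alpha> (om (W @ [a]) p x') \<beta> + val \<alpha> (om (Z @ [a]) p x') \<beta>"
proof -
  let ?q = "st [a] p" and ?e = "pos a p"
  obtain E m n d where D: "ed a p = (E, m, n, d)" by (cases "ed a p") auto
  have dat: "ok m s" "st m s = E" "ok n s" "st n s = E" "ok (kh ?q) E" "st (kh ?q) E = ?q"
    "ev (kh ?q @ m) = ev (kh ?q)" "ev (kh ?q @ n) = ev ([a] @ kh p)" "dpath Q (\<phi> m s @ \<phi> (kh ?q) E) d []"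
    using ed[OF e] unfolding D edge_data_def by simp_all
  let ?K = "\<phi> (kh ?q) E" and ?M = "\<phi> m s" and ?N = "\<phi> n s"
  note W' = endsD[OF W] and Z' = endsD[OF Z]
  have q: "?q \<in> Ob" and p: "p \<in> Ob" using W'(2) edge_O[OF e] .
  let ?w = "\<phi> W ?q" and ?z = "\<phi> Z ?q"
  have wq: "?w \<in> words Q" "?z \<in> words Q" using \<phi>Q[OF W] \<phi>Q[OF Z] .
  have KMN: "?K \<in> words Q" "?M \<in> words Q" "?N \<in> words Q" using \<phi>_words dat(1,3,5) by blast+
  have eQ: "?e \<in> letters Q" by (rule pos_letters[OF e])
  \<comment> \<open>\<open>zp\<close> replaces \<open>W\<close> by \<open>Z\<close>. With
    \<open>pos a p\<close> as right context it must get the same label as the corresponding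
    replacement of \<open>W @ [a]\<close> by \<open>Z @ [a]\<close>.\<close>
  define zp where "zp = dinv (om W ?q x) @ om Z ?q x"
  have zp: "dpath Q ?w zp ?z"
    unfolding zp_def by (rule dpath_appendI[OF Q dpath_dinv[OF Q om_path[OF W]] om_path[OF Z]])
  have zp_val: "val \<alpha> zp \<gamma> = - val \<alpha> (om W ?q x) \<gamma> + val \<alpha> (om Z ?q x) \<gamma>" if "\<gamma> \<in> words Q" for \<gamma>
    unfolding zp_def by (simp add: val_dinv[OF om_path[OF W] w(1) that])
  define dE where "dE = dl (W @ kh ?q) (Z @ kh ?q) E"
  have okWK: "ok (W @ kh ?q) E" using dat W'(1,5) by (simp only: ok_append simp_thms)
  have okZK: "ok (Z @ kh ?q) E" using dat Z'(1,5) by (simp only: ok_append simp_thms)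
  have evWZ: "ev (W @ kh ?q) = ev (Z @ kh ?q)"
    using ev_append[OF W'(1) kh(1)[OF q]] ev_append[OF Z'(1) kh(1)[OF q]] kh(2)[OF q] W'(4) Z'(4) by simp
  have dE: "dpath Q (?w @ ?K) dE (?z @ ?K)"
    using dl_path[OF okWK _ evWZ] ok_words[OF okZK] \<phi>_append[OF okWK] \<phi>_append[OF okZK] dat
    unfolding dE_def by simp
  \<comment> \<open>The direct return, through \<open>m\<close>: \<open>zp\<close> is
    \<open>dE\<close> with the reading \<open>M\<close> of \<open>m\<close> as right context,
    enclosed by insertion and deletion along \<open>c1\<close>.\<close>
  have step3: "val \<alpha> zp \<gamma> = - val (\<alpha> @ ?w) (c1 m ?q) \<gamma> + val \<alpha> dE (?M @ \<gamma>) + val (\<alpha> @ ?z) (c1 m ?q) \<gamma>"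
    if \<gamma>: "\<gamma> \<in> words Q" for \<gamma>
  proof -
    have c1: "val \<delta> (c1 m ?q) \<gamma> = val \<delta> (dl (kh ?q @ m) (kh ?q) s) \<gamma> + val \<delta> (c2 ?q) \<gamma>" for \<delta>
      by (simp add: c1_def)
    show ?thesis
      unfolding zp_val[OF \<gamma>] om_diff[OF W Z w(1) \<gamma>] c1 dE_def
        dl_transport[OF W Z dat(1,2,5,6) kh(1)[OF q] dat(7) w(1) \<gamma>]
      by (simp add: add.assoc minus_add diff_conv_add_uminus del: add_uminus_conv_diff)
  qed
  \<comment> \<open>With \<open>K\<close> as right context, \<open>adj\<close> exchanges
    \<open>c1\<close> for \<open>d\<close>. The latter acts on \<open>M K\<close>, to the right of
    everything changed by \<open>dE\<close>, and slides past it; \<open>dE\<close> alone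
    remains.\<close>
  have step4: "val \<alpha> zp (?K @ \<gamma>) = val \<alpha> dE \<gamma>" if \<gamma>: "\<gamma> \<in> words Q" for \<gamma>
  proof -
    have K\<gamma>: "?K @ \<gamma> \<in> words Q" using KMN \<gamma> by simp
    have aw: "\<alpha> @ ?w \<in> words Q" "\<alpha> @ ?z \<in> words Q" using w wq by simp_all
    have "val \<alpha> dE ((?M @ ?K) @ \<gamma>) + val (\<alpha> @ ?z @ ?K) d \<gamma> = val (\<alpha> @ ?w @ ?K) d \<gamma> + val \<alpha> dE ([] @ \<gamma>)"
      by (rule interchange0[OF dE dat(9) w(1) \<gamma>])
    note i = eq_conj(2)[OF this]
    show ?thesis
      unfolding step3[OF K\<gamma>] adj_val[OF e D aw(1) \<gamma>] adj_val[OF e D aw(2) \<gamma>] using i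
      by (simp add: add.assoc)
  qed
  let ?l = "\<phi> ([a] @ kh p) s"
  have "edge a (st (kh p) s)" using e kh(4)[OF p] by simp
  then have okl: "ok ([a] @ kh p) s"
    using kh[OF p] edge_ok edge_word by (simp only: ok_append simp_thms)
  have l: "?l = ?e # \<phi> (kh p) s" using kh(4)[OF p] by simp
  have okK: "ok (kh ?q @ n) s" using dat kh(1)[OF q] by (simp only: ok_append simp_thms)
  \<comment> \<open>The return along the edge uses \<open>n\<close> and the same \<open>dE\<close>,
    with \<open>ln\<close> leading to the word \<open>[a] @ kh p\<close>.\<close>
  define ln where "ln = dl (kh ?q @ n) ([a] @ kh p) s"
  have ln: "dpath Q (?K @ ?N) ln ?l"
    using dl_path[OF okK ok_words[OF okl] dat(8)] \<phi>_append[OF okK] dat(4) unfolding ln_def by simp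
  have "val \<alpha> zp ((?K @ ?N) @ \<beta>) + val (\<alpha> @ ?z) ln \<beta> = val (\<alpha> @ ?w) ln \<beta> + val \<alpha> zp (?l @ \<beta>)"
    by (rule interchange0[OF zp ln w])
  note i1 = eq_conj(2)[OF this]
  have N\<beta>: "?N @ \<beta> \<in> words Q" using KMN w by simp
  have "val \<alpha> (dl (W @ [a] @ kh p) (Z @ [a] @ kh p) s) \<beta> =
      - val (\<alpha> @ ?w) ln \<beta> + val \<alpha> dE (?N @ \<beta>) + val (\<alpha> @ ?z) ln \<beta>"
    unfolding ln_def dE_def by (rule dl_transport[OF W Z dat(3,4,5,6) ok_words[OF okl] dat(8) w])
  also have "\<dots> = val \<alpha> zp (?l @ \<beta>)"
    unfolding i1 using step4[OF N\<beta>] by (simp add: add.assoc)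
  finally have step5: "val \<alpha> (dl (W @ [a] @ kh p) (Z @ [a] @ kh p) s) \<beta> = val \<alpha> zp (?l @ \<beta>)" .
  note eW = ends_edge[OF e W] and eZ = ends_edge[OF e Z]
  have "- val \<alpha> (om (W @ [a]) p x') \<beta> + val \<alpha> (om (Z @ [a]) p x') \<beta> =
      - val (\<alpha> @ ?w @ [?e]) (c2 p) \<beta> + val \<alpha> zp (?l @ \<beta>) + val (\<alpha> @ ?z @ [?e]) (c2 p) \<beta>"
    using om_diff[OF eW(1) eZ(1) w] eW(2) eZ(2) step5 unfolding x'_def by simp
  also have "\<dots> = val \<alpha> zp (?e # \<beta>)"
  proof -
    have "val \<alpha> zp ([?e] @ \<phi> (kh p) s @ \<beta>) + val (\<alpha> @ ?z @ [?e]) (c2 p) \<beta> =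
        val (\<alpha> @ ?w @ [?e]) (c2 p) \<beta> + val \<alpha> zp ([?e] @ [] @ \<beta>)"
      by (rule interchange[OF zp c2_path[OF p] w]) (use eQ in simp)
    from eq_conj(1)[OF this] show ?thesis by (simp add: kh(4)[OF p] add.assoc)
  qed
  finally show ?thesis using zp_val[of "?e # \<beta>"] eQ w by simp
qed

text \<open>\<open>om_step\<close> frees the label from the choice of \<open>wt\<close> in
  \<open>\<sigma>p\<close>. This is what makes the sum in \<open>\<tau>_val\<close>
  telescope.\<close>

lemma \<sigma>p_val:
  assumes e: "edge a p" and W: "ends W (st [a] p) x" and w: "\<alpha> \<in> words Q" "\<beta> \<in> words Q"
  shows "val \<alpha> (\<sigma>p x a p) \<beta> = val \<alpha> (om W (st [a] p) x) (pos a p # \<beta>) - val \<alpha> (om (W @ [a]) p (act x (pos a p))) \<beta>"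
proof -
  let ?q = "st [a] p" and ?e = "pos a p"
  let ?U = "wt x ?q"
  have U: "ends ?U ?q x" by (rule wt[OF endsD(2,3)[OF W]])
  have "val \<alpha> (\<sigma>p x a p) \<beta> = val \<alpha> (om ?U ?q x) (?e # \<beta>) - val \<alpha> (om (?U @ [a]) p (act x ?e)) \<beta>"
    unfolding \<sigma>p_def using val_dinv[OF om_path[OF ends_edge(1)[OF e U]] w] by simp
  moreover have "- val \<alpha> (om ?U ?q x) (?e # \<beta>) + val \<alpha> (om W ?q x) (?e # \<beta>) =
      - val \<alpha> (om (?U @ [a]) p (act x ?e)) \<beta> + val \<alpha> (om (W @ [a]) p (act x ?e)) \<beta>"
    by (rule om_step[OF e U W w])
  moreover have "\<And>a b c d :: 'b edge list set sym_group. - a + b = - c + d \<Longrightarrow> a - c = b - d"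
  proof -
    fix a b c d :: "'b edge list set sym_group" assume *: "- a + b = - c + d"
    have "b = a + (- a + b)" by (simp add: add.assoc[symmetric])
    then have "b = a + (- c + d)" using * by simp
    then show "a - c = b - d"
      by (simp add: add.assoc diff_conv_add_uminus del: add_uminus_conv_diff)
  qed
  ultimately show ?thesis by simp
qed

lemma \<tau>_val:
  assumes "ok U p" "ends W (st U p) x" "\<alpha> \<in> words Q" "\<beta> \<in> words Q"
  shows "val \<alpha> (nf.\<tau> x (\<phi> U p)) \<beta> =
    val \<alpha> (om W (st U p) x) (\<phi> U p @ \<beta>) - val \<alpha> (om (W @ U) p (foldl act x (\<phi> U p))) \<beta>"
  using assms(1,2)
proof (induction U arbitrary: W x)
  case Nil
  then show ?case by simp
next
  case (Cons a U)
  note U = ok_Cons_edge[OF Cons.prems(1)]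
  let ?q = "st U p"
  let ?e = "pos a ?q"
  have W: "ends W (st [a] ?q) x" using Cons.prems(2) U(3) by simp
  note eW = ends_edge(1)[OF U(1) W]
  have \<beta>: "\<phi> U p @ \<beta> \<in> words Q" using \<phi>_words[OF U(2)] assms(4) by simp
  have "val \<alpha> (nf.\<tau> x (\<phi> (a # U) p)) \<beta> = val \<alpha> (\<sigma> x ?e) (\<phi> U p @ \<beta>) + val \<alpha> (nf.\<tau> (act x ?e) (\<phi> U p)) \<beta>"
    by simp
  also have "val \<alpha> (\<sigma> x ?e) (\<phi> U p @ \<beta>) = val \<alpha> (om W (st [a] ?q) x) (?e # \<phi> U p @ \<beta>) -
      val \<alpha> (om (W @ [a]) ?q (act x ?e)) (\<phi> U p @ \<beta>)"
    unfolding \<sigma>_pos[OF U(1)] by (rule \<sigma>p_val[OF U(1) W assms(3) \<beta>])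
  also have "val \<alpha> (nf.\<tau> (act x ?e) (\<phi> U p)) \<beta> = val \<alpha> (om (W @ [a]) ?q (act x ?e)) (\<phi> U p @ \<beta>) -
      val \<alpha> (om ((W @ [a]) @ U) p (foldl act (act x ?e) (\<phi> U p))) \<beta>"
    by (rule Cons.IH[OF U(2) eW])
  finally show ?case using U(3) by (simp add: add_diff_eq)
qed

subsection \<open>Naturality along the relations\<close>

abbreviation re :: "'b list \<Rightarrow> 'b list \<Rightarrow> 'b edge list" where
  "re u v \<equiv> [Edge [] (u, v) True []]"

text \<open>By \<open>\<tau>_val\<close> only the paths \<open>om\<close> at the beginning and at
  the end matter. The relation slides past the first by interchange and is absorbed into the last by
  \<open>om_derivation\<close>.\<close>

lemma natural_rel:
  assumes x: "x \<in> H" and uv: "(u, v) \<in> rels P" and ok: "ok u p"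
  shows "val (nf x) (re (\<phi> u p) (\<phi> v p)) [] + val [] (nf.\<tau> x (\<phi> v p)) [] = val [] (nf.\<tau> x (\<phi> u p)) []"
proof -
  let ?q = "st u p"
  have q: "?q \<in> Ob" by (rule st_O[OF ok])
  have okv: "ok v p" and stv: "st v p = ?q" using P_rel_ok[OF uv] ok P_rel_st[OF uv] by simp_all
  have p: "p \<in> Ob" by (rule ok_O[OF ok])
  define W where "W = wt x ?q"
  have W: "ends W ?q x" unfolding W_def by (rule wt[OF q x])
  let ?x = "foldl act x (\<phi> u p)"
  have eu: "ends (W @ u) p ?x" by (rule ends_append[OF W ok])
  have xv: "foldl act x (\<phi> v p) = ?x" using act_rel[OF x Q_rels(3)[OF uv ok]] by simp
  have W': "W \<in> words P" "v \<in> words P" "u \<in> words P" "ev u = ev v"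
    using endsD(1)[OF W] P_rel[OF uv] by simp_all
  have ev: "ev (W @ u) = ev (W @ v)" using W' by (simp add: ev_append)
  let ?r = "re (\<phi> u p) (\<phi> v p)"
  have r: "dpath Q (\<phi> u p) ?r (\<phi> v p)" by (rule rel_path[OF Q_rels(3)[OF uv ok]])
  have Er: "Edge W (u, v) True [] \<in> dedges P" using W' uv by (simp add: dedge_iff)
  have q1: "dpath P (W @ u) [Edge W (u, v) True []] (W @ v)" using dpath_single[OF P Er] by simp
  have "val [] (\<Phi> [Edge W (u, v) True []] p) [] = val (\<phi> W ?q) ?r []"
    using p by (simp add: val_def)
  then have dl: "val [] (dl (W @ u) (W @ v) p) [] = val (\<phi> W ?q) ?r []"
    using val_derivation[OF q1 endsD(5)[OF eu], of "[]" "[]"] by simp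
  have om: "val [] (om (W @ u) p ?x) [] + val (\<phi> W ?q) ?r [] = val [] (om (W @ v) p ?x) []"
    using om_derivation[OF eu _ ev, of "[]" "[]"] W' dl by simp
  have i: "val [] (om W ?q x) (\<phi> u p) + val (\<phi> W ?q) ?r [] = val (nf x) ?r [] + val [] (om W ?q x) (\<phi> v p)"
    using interchange0[OF om_path[OF W] r, of "[]" "[]"] by simp
  have tu: "val [] (nf.\<tau> x (\<phi> u p)) [] = val [] (om W ?q x) (\<phi> u p) - val [] (om (W @ u) p ?x) []"
    using \<tau>_val[OF ok W, of "[]" "[]"] by simp
  have tv: "val [] (nf.\<tau> x (\<phi> v p)) [] = val [] (om W ?q x) (\<phi> v p) - val [] (om (W @ v) p ?x) []"
    using \<tau>_val[OF okv, of W x "[]" "[]"] W stv xv by simp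
  have "val (nf x) ?r [] + val [] (nf.\<tau> x (\<phi> v p)) [] =
      (val (nf x) ?r [] + val [] (om W ?q x) (\<phi> v p)) - val [] (om (W @ v) p ?x) []"
    unfolding tv by (simp add: add_diff_eq)
  also have "\<dots> = (val [] (om W ?q x) (\<phi> u p) + val (\<phi> W ?q) ?r []) -
      (val [] (om (W @ u) p ?x) [] + val (\<phi> W ?q) ?r [])"
    unfolding i om ..
  also have "\<dots> = val [] (nf.\<tau> x (\<phi> u p)) []"
    unfolding tu by (simp add: add.assoc minus_add diff_conv_add_uminus del: add_uminus_conv_diff)
  finally show ?thesis .
qed

text \<open>At the state \<open>s\<close> the label of \<open>om\<close> reduces to that of
  \<open>dt\<close>, because \<open>Ce s\<close> is among the closed paths. The copy of
  \<open>Ce p\<close> inside \<open>om W p x\<close> is moved by \<open>ck\<close> to the right-hand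
  copy of the reading of \<open>\<kappa> p\<close>, from where interchange with \<open>dt\<close>
  carries it to \<open>nf x\<close>.\<close>

lemma natural_C:
  assumes x: "x \<in> H" and p: "p \<in> Ob"
  shows "val (nf x) (re (\<phi> (\<kappa> p) s) []) [] + val [] (nf.\<tau> x []) [] = val [] (nf.\<tau> x (\<phi> (\<kappa> p) s)) []"
proof -
  note k = \<kappa>[OF p]
  let ?k = "\<phi> (\<kappa> p) s"
  have kQ: "?k \<in> words Q" by (rule \<phi>_words[OF k(3)])
  define W where "W = wt x p"
  have W: "ends W p x" unfolding W_def by (rule wt[OF p x])
  have W': "ends W (st (\<kappa> p) s) x" using W k by simp
  note eW = ends_\<kappa>[OF W] and u = wt[OF s_O x]
  have fx: "foldl act x ?k = x" using act_rel[OF x Q_rels(4)[OF p]] by simp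
  have wQ: "\<phi> W p \<in> words Q" by (rule \<phi>Q[OF W])
  have "ck p \<in> Y" unfolding Y_def using p by blast
  from val_cell[OF this wQ, of "[]"] have "val (\<phi> W p) (ck p) [] = 0" by simp
  moreover have "dpath Q (?k @ ?k @ []) (path_act ?k (Ce p) []) (?k @ [] @ [])"
    by (rule dpath_act[OF Q Ce[OF p] kQ]) simp
  note pk = this
  have "val (\<phi> W p) (dinv (path_act ?k (Ce p) [])) [] = - val (\<phi> W p) (path_act ?k (Ce p) []) []"
    by (rule val_dinv[OF pk wQ]) simp
  ultimately have ck: "val (\<phi> W p) (Ce p) ?k = val (\<phi> W p @ ?k) (Ce p) []"
    unfolding ck_def by (simp del: path_act_dinv)
  have "Ce s \<in> Y" unfolding Y_def by blast
  then have Cs: "val \<gamma> (Ce s) [] = 0" if "\<gamma> \<in> words Q" for \<gamma>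
    using val_cell[OF _ that, of "Ce s" "[]"] by simp
  have om2: "val [] (om (W @ \<kappa> p) s x) [] = val [] (dt (wt x s) (W @ \<kappa> p)) []"
    using Cs[OF \<phi>Q[OF eW]] by (simp add: om_val)
  have om1: "val [] (om W p x) ?k = val [] (dt (wt x s) (W @ \<kappa> p)) ?k + val (\<phi> W p) (Ce p) ?k"
    by (simp add: om_val)
  have "val [] (dt (wt x s) (W @ \<kappa> p)) ?k + val (\<phi> W p @ ?k) (Ce p) [] =
      val (nf x) (Ce p) [] + val [] (dt (wt x s) (W @ \<kappa> p)) []"
    using interchange0[OF dt_path[OF u eW] Ce[OF p], of "[]" "[]"] \<phi>_\<kappa>[OF W] by (simp add: nf_def)
  then have i: "val [] (om W p x) ?k = val (nf x) (Ce p) [] + val [] (om (W @ \<kappa> p) s x) []"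
    unfolding om1 ck om2 .
  have "val [] (nf.\<tau> x ?k) [] = val [] (om W p x) ?k - val [] (om (W @ \<kappa> p) s x) []"
    using \<tau>_val[OF k(3) W', of "[]" "[]"] k(4) fx by simp
  then show ?thesis unfolding i by (simp add: Ce_def add_diff_eq[symmetric])
qed

lemma \<sigma>n_val:
  assumes e: "edge a p" and x: "x \<in> H" and w: "\<alpha> \<in> words Q" "\<beta> \<in> words Q"
  shows "val \<alpha> (\<sigma>n x a p) \<beta> = - val \<alpha> (\<sigma>p (act x (neg a p)) a p) (neg a p # \<beta>) +
    val (\<alpha> @ nf (act x (neg a p))) (re [pos a p, neg a p] []) \<beta>"
proof -
  have "act x (neg a p) \<in> H" by (rule act_H[OF x pos_letters[OF e]])
  then show ?thesis
    unfolding \<sigma>n_def Let_def val_append val_act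
    using val_dinv[OF \<sigma>p_path[OF e] w(1), of "act x (neg a p)" "neg a p # \<beta>"] pos_letters[OF e] w(2) by simp
qed

lemma natural_A:
  assumes e: "edge a p" and x: "x \<in> H"
  shows "val (nf x) (re [pos a p, neg a p] []) [] + val [] (nf.\<tau> x []) [] = val [] (nf.\<tau> x [pos a p, neg a p]) []"
proof -
  let ?y = "act x (pos a p)"
  have y: "?y \<in> H" by (rule act_H[OF x pos_letters[OF e]])
  show ?thesis
    using \<sigma>n_val[OF e y, of "[]" "[]"] act_pos_neg[OF e x]
    by (simp add: \<sigma>_pos[OF e] \<sigma>_neg[OF e] add.assoc[symmetric])
qed

text \<open>Inserting \<open>\<sigma>n\<close> leaves a cancellation of
  \<open>[pos a p, neg a p]\<close> with \<open>pos a p\<close> behind it. \<open>zig\<close> turns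
  it into the other cancellation, which slides past \<open>\<sigma>p\<close>.\<close>

lemma natural_B:
  assumes e: "edge a p" and x: "x \<in> H"
  shows "val (nf x) (re [neg a p, pos a p] []) [] + val [] (nf.\<tau> x []) [] = val [] (nf.\<tau> x [neg a p, pos a p]) []"
proof -
  let ?e = "pos a p" and ?e' = "neg a p"
  let ?y = "act x ?e'"
  have L: "?e \<in> letters Q" "?e' \<in> letters Q" by (rule pos_letters[OF e])+
  have y: "?y \<in> H" by (rule act_H[OF x L(2)])
  have yx: "act ?y ?e = x" by (rule act_neg_pos[OF e x])
  let ?A = "re [?e, ?e'] []" and ?B = "re [?e', ?e] []"
  have B: "dpath Q [?e', ?e] ?B []" by (rule rel_path[OF Q_rels(2)[OF e]])
  have ny: "nf ?y \<in> words Q" by (rule nf_words[OF y])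
  have "zig a p \<in> Y" unfolding Y_def using e by blast
  then have "val (nf ?y) (zig a p) [] = 0" by (rule val_cell[OF _ ny]) simp
  moreover have "dpath Q ([?e] @ [?e', ?e] @ []) (path_act [?e] ?B []) ([?e] @ [] @ [])"
    by (rule dpath_act[OF Q B]) (use L in simp_all)
  note pB = this
  have "val (nf ?y) (dinv (path_act [?e] ?B [])) [] = - val (nf ?y) (path_act [?e] ?B []) []"
    by (rule val_dinv[OF pB ny]) simp
  ultimately have "val (nf ?y) (path_act [] ?A [?e]) [] + - val (nf ?y) (path_act [?e] ?B []) [] = 0"
    unfolding zig_def by (simp only: val_append)
  then have zig: "val (nf ?y) ?A [?e] = val (nf ?y @ [?e]) ?B []"
    unfolding val_act by simp
  have sp: "dpath Q (nf ?y @ [?e]) (\<sigma>p ?y a p) (nf x)" using \<sigma>p_path[OF e y] yx by simp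
  have "val [] (\<sigma>p ?y a p) ([?e', ?e] @ []) + val ([] @ nf x) ?B [] =
      val ([] @ nf ?y @ [?e]) ?B [] + val [] (\<sigma>p ?y a p) ([] @ [])"
    by (rule interchange0[OF sp B]) simp_all
  then have i: "val [] (\<sigma>p ?y a p) [?e', ?e] + val (nf x) ?B [] = val (nf ?y @ [?e]) ?B [] + val [] (\<sigma>p ?y a p) []"
    by simp
  have n: "val [] (\<sigma>n x a p) [?e] = - val [] (\<sigma>p ?y a p) [?e', ?e] + val (nf ?y) ?A [?e]"
    using \<sigma>n_val[OF e x, of "[]" "[?e]"] L by simp
  have "val [] (nf.\<tau> x [?e', ?e]) [] = val [] (\<sigma>n x a p) [?e] + val [] (\<sigma>p ?y a p) []"
    by (simp add: \<sigma>_pos[OF e] \<sigma>_neg[OF e])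
  also have "\<dots> = - val [] (\<sigma>p ?y a p) [?e', ?e] + (val (nf ?y @ [?e]) ?B [] + val [] (\<sigma>p ?y a p) [])"
    unfolding n zig by (simp add: add.assoc)
  also have "\<dots> = val (nf x) ?B []" unfolding i[symmetric] by (simp add: add.assoc[symmetric])
  finally show ?thesis by simp
qed

lemma natural:
  assumes x: "x \<in> H" and uv: "(u, v) \<in> rels Q"
  shows "val (nf x) (re u v) [] + val [] (nf.\<tau> x v) [] = val [] (nf.\<tau> x u) []"
  using uv
proof (cases rule: Q_rels_cases)
  case (A a p)
  then show ?thesis using natural_A[OF A(1) x] by simp
next
  case (B a p)
  then show ?thesis using natural_B[OF B(1) x] by simp
next
  case (R u' v' p)
  then show ?thesis using natural_rel[OF x R(1,2)] by simp
next
  case (C p)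
  then show ?thesis using natural_C[OF x C(1)] by simp
qed

end

context squier_fdt
begin

theorem homotopy_base_Q: "homotopy_base Q Y"
proof (rule homotopy_baseI[OF Q Y_closed])
  fix u p assume "dpath Q u p u"
  then show "heq Q Y p []"
  proof (rule nf.closed_path_heq_Nil[rotated])
    fix x u v assume x: "x \<in> H" and uv: "(u, v) \<in> rels Q"
    show "heq Q Y (path_act (nf x) [Edge [] (u, v) True []] [] @ nf.\<tau> x v) (nf.\<tau> x u)"
    proof (rule heqI[OF Q])
      fix \<theta> :: "'b edge \<Rightarrow> 'b edge list set sym_group"
      assume "sym_labelled Q Y \<theta>"
      then interpret l: sym_labelled Q Y \<theta> .
      interpret squier_label S H s rp P ev sw enc X \<theta>
        by unfold_locales (rule l.lab)
      show "l.val [] (path_act (nf x) [Edge [] (u, v) True []] [] @ nf.\<tau> x v) [] = l.val [] (nf.\<tau> x u) []"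
        unfolding l.val_append l.val_act using natural[OF x uv] by simp
    qed
  qed
qed

end

section \<open>Presented monoids up to isomorphism\<close>

lemma quotient_class_mult:
  assumes eq: "equiv (carrier M) \<rho>"
    and cong: "\<And>u u' v v'. (u, u') \<in> \<rho> \<Longrightarrow> (v, v') \<in> \<rho> \<Longrightarrow> (u \<otimes>\<^bsub>M\<^esub> v, u' \<otimes>\<^bsub>M\<^esub> v') \<in> \<rho>"
    and u: "u \<in> carrier M" and v: "v \<in> carrier M"
  shows "\<rho> `` {u} \<otimes>\<^bsub>quotient_monoid M \<rho>\<^esub> \<rho> `` {v} = \<rho> `` {u \<otimes>\<^bsub>M\<^esub> v}"
proof -
  have refl: "(u, u) \<in> \<rho>" "(v, v) \<in> \<rho>" using eq u v by (auto simp: equiv_def refl_on_def)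
  have tr: "trans \<rho>" using eq by (simp add: equiv_def)
  have "\<rho> `` (\<rho> `` {u} <#>\<^bsub>M\<^esub> \<rho> `` {v}) = \<rho> `` {u \<otimes>\<^bsub>M\<^esub> v}"
  proof (intro equalityI subsetI)
    fix z assume "z \<in> \<rho> `` (\<rho> `` {u} <#>\<^bsub>M\<^esub> \<rho> `` {v})"
    then obtain u' v' where "(u, u') \<in> \<rho>" "(v, v') \<in> \<rho>" "(u' \<otimes>\<^bsub>M\<^esub> v', z) \<in> \<rho>"
      by (auto simp: set_mult_def)
    then have "(u \<otimes>\<^bsub>M\<^esub> v, z) \<in> \<rho>" using cong tr by (meson transD)
    then show "z \<in> \<rho> `` {u \<otimes>\<^bsub>M\<^esub> v}" by simp
  next
    fix z assume "z \<in> \<rho> `` {u \<otimes>\<^bsub>M\<^esub> v}"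
    then show "z \<in> \<rho> `` (\<rho> `` {u} <#>\<^bsub>M\<^esub> \<rho> `` {v})"
      using refl unfolding set_mult_def by auto
  qed
  then show ?thesis by (simp add: quotient_monoid_def)
qed

lemma presentation_cong_append:
  assumes "presentation Q" "(u, u') \<in> presentation_cong Q" "(v, v') \<in> presentation_cong Q"
  shows "(u @ v, u' @ v') \<in> presentation_cong Q"
proof -
  obtain p q where p: "dpath Q u p u'" and q: "dpath Q v q v'"
    using assms path_presentation_cong[OF assms(1)] by blast
  have "dpath Q ([] @ u @ v) (path_act [] p v) ([] @ u' @ v)"
    by (rule dpath_act[OF assms(1) p]) (use dpath_ends[OF assms(1) q] in simp_all)
  moreover have "dpath Q (u' @ v @ []) (path_act u' q []) (u' @ v' @ [])"
    by (rule dpath_act[OF assms(1) q]) (use dpath_ends[OF assms(1) p] in simp_all)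
  ultimately have "dpath Q (u @ v) (path_act [] p v @ path_act u' q []) (u' @ v')"
    using dpath_appendI[OF assms(1)] by simp
  then show ?thesis using path_presentation_cong[OF assms(1)] by blast
qed

lemma presentation_cong_words: "(u, v) \<in> presentation_cong Q \<Longrightarrow> v \<in> words Q"
  by (simp add: presentation_cong_def)

lemma presented_class_mult:
  assumes "presentation Q" "u \<in> words Q" "v \<in> words Q"
  shows "presentation_cong Q `` {u} \<otimes>\<^bsub>presented_monoid Q\<^esub> presentation_cong Q `` {v} =
    presentation_cong Q `` {u @ v}"
  unfolding presented_monoid_def
  using quotient_class_mult[of "free_monoid (letters Q)" "presentation_cong Q" u v]
    equiv_presentation_cong[of Q] presentation_cong_append[OF assms(1)] assms(2,3)
  by (simp add: free_monoid_def)

lemma carrier_presented_monoid: "carrier (presented_monoid Q) = words Q // presentation_cong Q"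
  by (simp add: presented_monoid_def quotient_monoid_def free_monoid_def)

lemma presented_class_eq:
  assumes "u \<in> words Q" "v \<in> words Q"
  shows "presentation_cong Q `` {u} = presentation_cong Q `` {v} \<longleftrightarrow> (u, v) \<in> presentation_cong Q"
  using eq_equiv_class_iff[OF equiv_presentation_cong assms] .

lemma presentsI:
  assumes Q: "presentation Q"
    and mult: "\<And>u v. u \<in> words Q \<Longrightarrow> v \<in> words Q \<Longrightarrow> f (u @ v) = f u \<otimes>\<^bsub>M\<^esub> f v"
    and surj: "f ` words Q = carrier M"
    and kernel: "\<And>u v. u \<in> words Q \<Longrightarrow> v \<in> words Q \<Longrightarrow> f u = f v \<longleftrightarrow> (u, v) \<in> presentation_cong Q"
  shows "presents Q M"
proof -
  let ?c = "\<lambda>u. presentation_cong Q `` {u}"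
  define h where "h C = f (SOME u. u \<in> C)" for C
  have h: "h (?c u) = f u" if u: "u \<in> words Q" for u
  proof -
    have "u \<in> ?c u" using equiv_class_self[OF equiv_presentation_cong u] .
    then have "(SOME v. v \<in> ?c u) \<in> ?c u" by (rule someI)
    then have uv: "(u, SOME v. v \<in> ?c u) \<in> presentation_cong Q" by simp
    have "f u = f (SOME v. v \<in> ?c u)" using kernel[OF u presentation_cong_words[OF uv]] uv by blast
    then show ?thesis by (simp add: h_def)
  qed
  have rep: "\<exists>u\<in>words Q. C = ?c u" if "C \<in> carrier (presented_monoid Q)" for C
    using that unfolding carrier_presented_monoid by (auto elim: quotientE)
  have "h \<in> hom (presented_monoid Q) M"
  proof (rule homI)
    fix C assume "C \<in> carrier (presented_monoid Q)"
    then obtain u where u: "u \<in> words Q" "C = ?c u" using rep by blast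
    show "h C \<in> carrier M" unfolding u(2) h[OF u(1)] using surj u(1) by blast
  next
    fix C D assume "C \<in> carrier (presented_monoid Q)" "D \<in> carrier (presented_monoid Q)"
    then obtain u v where u: "u \<in> words Q" "C = ?c u" and v: "v \<in> words Q" "D = ?c v" using rep by meson
    have "u @ v \<in> words Q" using u v by simp
    then show "h (C \<otimes>\<^bsub>presented_monoid Q\<^esub> D) = h C \<otimes>\<^bsub>M\<^esub> h D"
      unfolding u(2) v(2) presented_class_mult[OF Q u(1) v(1)] using h u v mult by simp
  qed
  moreover have "bij_betw h (carrier (presented_monoid Q)) (carrier M)"
    unfolding bij_betw_def
  proof
    show "inj_on h (carrier (presented_monoid Q))"
    proof (rule inj_onI)
      fix C D assume CD: "C \<in> carrier (presented_monoid Q)" "D \<in> carrier (presented_monoid Q)" "h C = h D"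
      then obtain u v where u: "u \<in> words Q" "C = ?c u" and v: "v \<in> words Q" "D = ?c v" using rep by meson
      have "f u = f v" using CD(3) u v h by simp
      then show "C = D" unfolding u(2) v(2) presented_class_eq[OF u(1) v(1)] using kernel u v by simp
    qed
    show "h ` carrier (presented_monoid Q) = carrier M"
    proof
      show "h ` carrier (presented_monoid Q) \<subseteq> carrier M"
        using \<open>h \<in> hom (presented_monoid Q) M\<close> by (auto simp: hom_def)
      show "carrier M \<subseteq> h ` carrier (presented_monoid Q)"
      proof
        fix y assume "y \<in> carrier M"
        then obtain u where u: "u \<in> words Q" "y = f u" using surj by blast
        then show "y \<in> h ` carrier (presented_monoid Q)"
          unfolding carrier_presented_monoid by (intro image_eqI[of _ _ "?c u"]) (simp_all add: h quotientI)
      qed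
    qed
  qed
  ultimately have "presented_monoid Q \<cong> M" unfolding is_iso_def iso_def by blast
  then show ?thesis using Q by (simp add: presents_def)
qed

lemma presents_evaluation:
  assumes "presents P M" "monoid M"
  shows "\<exists>ev. ev [] = \<one>\<^bsub>M\<^esub> \<and>
    (\<forall>u\<in>words P. \<forall>v\<in>words P. ev (u @ v) = ev u \<otimes>\<^bsub>M\<^esub> ev v) \<and>
    (\<forall>u\<in>words P. ev u \<in> carrier M) \<and> (\<forall>x\<in>carrier M. \<exists>u\<in>words P. ev u = x) \<and>
    (\<forall>u\<in>words P. \<forall>v\<in>words P. ev u = ev v \<longleftrightarrow> (u, v) \<in> presentation_cong P)"
proof -
  interpret monoid M by fact
  have P: "presentation P" using assms(1) by (simp add: presents_def)
  let ?c = "\<lambda>u. presentation_cong P `` {u}"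
  obtain h where h: "h \<in> hom (presented_monoid P) M" "bij_betw h (carrier (presented_monoid P)) (carrier M)"
    using assms(1) unfolding presents_def is_iso_def iso_def by blast
  have cl: "?c u \<in> carrier (presented_monoid P)" if "u \<in> words P" for u
    unfolding carrier_presented_monoid using that by (rule quotientI)
  define ev where "ev u = h (?c u)" for u
  have mult: "ev (u @ v) = ev u \<otimes>\<^bsub>M\<^esub> ev v" if "u \<in> words P" "v \<in> words P" for u v
    unfolding ev_def presented_class_mult[OF P that, symmetric] by (rule hom_mult[OF h(1) cl[OF that(1)] cl[OF that(2)]])
  have closed: "ev u \<in> carrier M" if "u \<in> words P" for u
    unfolding ev_def by (rule hom_in_carrier[OF h(1) cl[OF that]])
  have surj: "\<exists>u\<in>words P. ev u = x" if "x \<in> carrier M" for x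
  proof -
    have "x \<in> h ` carrier (presented_monoid P)" using h(2) that by (simp add: bij_betw_def)
    then show ?thesis unfolding carrier_presented_monoid ev_def by (auto elim!: quotientE)
  qed
  have kernel: "ev u = ev v \<longleftrightarrow> (u, v) \<in> presentation_cong P" if "u \<in> words P" "v \<in> words P" for u v
    unfolding ev_def presented_class_eq[OF that, symmetric]
    using h(2) cl[OF that(1)] cl[OF that(2)] by (auto simp: bij_betw_def inj_on_def)
  \<comment> \<open>Isomorphisms are only required to be multiplicative here; surjectivity forces
    the empty word to have the value one.\<close>
  have "ev [] = \<one>\<^bsub>M\<^esub>"
  proof -
    obtain e where e: "e \<in> words P" "ev e = \<one>\<^bsub>M\<^esub>" using surj by blast
    have "ev [] \<in> carrier M" by (rule closed) simp
    moreover have "ev e = ev [] \<otimes>\<^bsub>M\<^esub> ev e" using mult[of "[]" e] e by simp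
    ultimately show ?thesis using e by simp
  qed
  then show ?thesis using mult closed surj kernel by (intro exI[of _ ev] conjI ballI)
qed

section \<open>The Schutzenberger group as the monoid presented by \<open>Q\<close>\<close>

context squier_transfer
begin

definition cw :: "'b list \<Rightarrow> 'a" where
  "cw w = foldr (\<lambda>b c. co b \<otimes> c) w \<one>"

lemma cw_T: "w \<in> words Q \<Longrightarrow> cw w \<in> T"
  by (induction w) (auto simp: cw_def T_one intro: T_mult co_T)

lemma cw_append: "u \<in> words Q \<Longrightarrow> v \<in> words Q \<Longrightarrow> cw (u @ v) = cw u \<otimes> cw v"
proof (induction u)
  case Nil
  then show ?case using T_carrier[OF cw_T[of v]] by (simp add: cw_def)
next
  case (Cons b u)
  then have "cw u \<in> carrier S" "cw v \<in> carrier S" "co b \<in> carrier S"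
    using cw_T T_carrier co_T by simp_all
  then show ?case using Cons by (simp add: cw_def m_assoc)
qed

lemma foldl_act_cw: "x \<in> H \<Longrightarrow> w \<in> words Q \<Longrightarrow> foldl act x w = x \<otimes> cw w"
proof (induction w arbitrary: x)
  case Nil
  then show ?case using H_carrier by (simp add: cw_def)
next
  case (Cons b w)
  then have b: "b \<in> letters Q" "w \<in> words Q" by simp_all
  note car = H_carrier[OF Cons.prems(1)] T_carrier[OF co_T[OF b(1)]] T_carrier[OF cw_T[OF b(2)]]
  have "foldl act x (b # w) = x \<otimes> co b \<otimes> cw w"
    using Cons.IH[OF act_H[OF Cons.prems(1) b(1)] b(2)] by (simp add: act_def[of x b])
  also have "\<dots> = x \<otimes> (co b \<otimes> cw w)" using car by (simp add: m_assoc)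
  finally show ?case by (simp add: cw_def)
qed

lemma presents_Q: "presents Q (schutzenberger_group S H)"
proof (rule presentsI[OF Q])
  let ?c = "stab_cong S H"
  let ?f = "\<lambda>w. ?c `` {cw w}"
  have eq: "equiv T ?c" by (auto simp: equiv_def refl_on_def sym_def trans_def stab_cong_def)
  have cong: "(a \<otimes> b, a' \<otimes> b') \<in> ?c" if "(a, a') \<in> ?c" "(b, b') \<in> ?c" for a a' b b'
  proof -
    have T: "a \<in> T" "a' \<in> T" "b \<in> T" "b' \<in> T" and
      e: "\<And>x. x \<in> H \<Longrightarrow> x \<otimes> a = x \<otimes> a'" "\<And>x. x \<in> H \<Longrightarrow> x \<otimes> b = x \<otimes> b'"
      using that by (auto simp: stab_cong_def)
    have "x \<otimes> (a \<otimes> b) = x \<otimes> (a' \<otimes> b')" if x: "x \<in> H" for x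
    proof -
      have "x \<otimes> (a \<otimes> b) = (x \<otimes> a) \<otimes> b" using T T_carrier H_carrier[OF x] by (simp add: m_assoc)
      also have "\<dots> = (x \<otimes> a) \<otimes> b'" by (rule e(2)[OF H_T[OF x T(1)]])
      also have "\<dots> = (x \<otimes> a') \<otimes> b'" using e(1)[OF x] by simp
      also have "\<dots> = x \<otimes> (a' \<otimes> b')" using T T_carrier H_carrier[OF x] by (simp add: m_assoc)
      finally show ?thesis .
    qed
    then show ?thesis using T T_mult by (simp add: stab_cong_def)
  qed
  \<comment> \<open>Agreement at one point of \<open>H\<close> is agreement on all of it, so classes
    can be tested at \<open>h0\<close>, where \<open>Q_cong_iff\<close> describes the
    congruence.\<close>
  have rel: "(c, d) \<in> ?c \<longleftrightarrow> h0 \<otimes> c = h0 \<otimes> d" if "c \<in> T" "d \<in> T" for c d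
    using that T_separate[OF h0(1) T_carrier[OF that(1)] T_carrier[OF that(2)]] h0(1)
    unfolding stab_cong_def by blast
  show "?f (u @ v) = ?f u \<otimes>\<^bsub>schutzenberger_group S H\<^esub> ?f v" if "u \<in> words Q" "v \<in> words Q" for u v
    unfolding schutzenberger_group_def cw_append[OF that]
    using quotient_class_mult[of "S\<lparr>carrier := T\<rparr>" ?c "cw u" "cw v"] eq cong cw_T that by simp
  show "?f ` words Q = carrier (schutzenberger_group S H)"
  proof -
    have car: "carrier (schutzenberger_group S H) = T // ?c"
      by (simp add: schutzenberger_group_def quotient_monoid_def)
    have "\<exists>w\<in>words Q. C = ?f w" if C: "C \<in> T // ?c" for C
    proof -
      obtain c where c: "c \<in> T" "C = ?c `` {c}" using C by (auto elim: quotientE)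
      have x: "h0 \<otimes> c \<in> H" by (rule H_T[OF h0(1) c(1)])
      note W = wt[OF s_O x]
      have w: "nf (h0 \<otimes> c) \<in> words Q" by (rule nf_words[OF x])
      have "h0 \<otimes> cw (nf (h0 \<otimes> c)) = h0 \<otimes> c"
        using foldl_act_cw[OF h0(1) w] endsD(7)[OF W] by (simp add: nf_def)
      then have "(c, cw (nf (h0 \<otimes> c))) \<in> ?c" using rel[OF c(1) cw_T[OF w]] by simp
      then have "C = ?f (nf (h0 \<otimes> c))" unfolding c(2) by (rule equiv_class_eq[OF eq])
      then show ?thesis using w by (intro bexI)
    qed
    moreover have "?f w \<in> T // ?c" if "w \<in> words Q" for w using cw_T[OF that] by (rule quotientI)
    ultimately show ?thesis unfolding car by blast
  qed
  show "?f u = ?f v \<longleftrightarrow> (u, v) \<in> presentation_cong Q" if "u \<in> words Q" "v \<in> words Q" for u v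
    unfolding eq_equiv_class_iff[OF eq cw_T[OF that(1)] cw_T[OF that(2)]]
      rel[OF cw_T[OF that(1)] cw_T[OF that(2)]] Q_cong_iff[OF that] foldl_act_cw[OF h0(1) that(1)]
      foldl_act_cw[OF h0(1) that(2)] ..
qed

end

section \<open>Finiteness of the set of states\<close>

context pointwise_stab
begin

text \<open>The R-class of \<open>y\<close> alone does not determine the right
  \<open>T\<close>-orbit. The second component records the H-class to which the multiplier
  \<open>\<alpha>\<close> of \<open>y\<close> sends a representative \<open>z\<close> of the
  R-class; \<open>z\<close> depends only on the class, \<open>\<alpha>\<close> on \<open>y\<close>.
  Hypothesis (b) bounds the first component and (a) the second.\<close>

definition state :: "'a \<Rightarrow> 'a set \<times> 'a set" where
  "state y = (green_R S `` {y},
     green_H S `` {(SOME \<alpha>. \<alpha> \<in> carrier S \<and> \<alpha> \<otimes> y \<in> H) \<otimes> (SOME z. z \<in> green_R S `` {y})})"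

lemma state_witness:
  assumes "y \<in> V"
  obtains \<alpha> z where "\<alpha> \<in> carrier S" "\<alpha> \<otimes> y \<in> H" "(y, z) \<in> green_R S"
    "state y = (green_R S `` {y}, green_H S `` {\<alpha> \<otimes> z})" "z = (SOME z. z \<in> green_R S `` {y})"
proof -
  let ?\<alpha> = "SOME \<alpha>. \<alpha> \<in> carrier S \<and> \<alpha> \<otimes> y \<in> H" and ?z = "SOME z. z \<in> green_R S `` {y}"
  have "\<exists>\<alpha>. \<alpha> \<in> carrier S \<and> \<alpha> \<otimes> y \<in> H" using assms unfolding vertices_def by blast
  from someI_ex[OF this] have a: "?\<alpha> \<in> carrier S" "?\<alpha> \<otimes> y \<in> H" by simp_all
  have "y \<in> green_R S `` {y}" by (rule equiv_class_self[OF equiv_green_R V_carrier[OF assms]])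
  then have "?z \<in> green_R S `` {y}" by (rule someI)
  then have "(y, ?z) \<in> green_R S" by simp
  then show thesis using that[OF a _ _ refl] by (simp add: state_def)
qed

lemma green_R_carrier: "(x, y) \<in> green_R S \<Longrightarrow> x \<in> carrier S \<and> y \<in> carrier S"
  by (simp add: green_R_def)

text \<open>Right multiplication carries the L-relation between \<open>\<alpha> \<otimes> z\<close>
  and \<open>\<alpha>' \<otimes> z\<close> to \<open>\<alpha> \<otimes> y'\<close> and
  \<open>\<alpha>' \<otimes> y'\<close>. The last element is in \<open>H\<close>, so
  \<open>\<alpha>\<close> sends \<open>y'\<close> as well as \<open>y\<close> into \<open>H\<close>,
  and the elements linking \<open>y\<close> and \<open>y'\<close> stabilize
  \<open>H\<close>.\<close>

lemma state_trel:
  assumes y: "y \<in> V" and y': "y' \<in> V" and eq: "state y = state y'"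
  shows "trel y y'"
proof -
  obtain \<alpha> z where a: "\<alpha> \<in> carrier S" "\<alpha> \<otimes> y \<in> H" "(y, z) \<in> green_R S"
    "state y = (green_R S `` {y}, green_H S `` {\<alpha> \<otimes> z})" "z = (SOME z. z \<in> green_R S `` {y})"
    by (rule state_witness[OF y])
  obtain \<alpha>' z' where b: "\<alpha>' \<in> carrier S" "\<alpha>' \<otimes> y' \<in> H" "(y', z') \<in> green_R S"
    "state y' = (green_R S `` {y'}, green_H S `` {\<alpha>' \<otimes> z'})" "z' = (SOME z. z \<in> green_R S `` {y'})"
    by (rule state_witness[OF y'])
  have R: "green_R S `` {y} = green_R S `` {y'}" and Hc: "green_H S `` {\<alpha> \<otimes> z} = green_H S `` {\<alpha>' \<otimes> z'}"
    using eq a(4) b(4) by simp_all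
  have zz: "z' = z" using a(5) b(5) R by simp
  note yS = V_carrier[OF y] and y'S = V_carrier[OF y']
  have zS: "z \<in> carrier S" using green_R_carrier[OF a(3)] by simp
  have yy': "(y, y') \<in> green_R S" using eq_equiv_class[OF R equiv_green_R y'S] .
  have az: "\<alpha> \<otimes> z \<in> carrier S" "\<alpha>' \<otimes> z \<in> carrier S" using a(1) b(1) zS by simp_all
  have L: "(\<alpha> \<otimes> z, \<alpha>' \<otimes> z) \<in> green_L S"
    using eq_equiv_class[OF Hc[unfolded zz] equiv_green_H az(2)] by (simp add: green_H_def)
  obtain u where u: "u \<in> carrier S" "u \<otimes> (\<alpha> \<otimes> z) = \<alpha>' \<otimes> z"
    and u': "\<exists>u'\<in>carrier S. u' \<otimes> (\<alpha>' \<otimes> z) = \<alpha> \<otimes> z"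
    using L green_L_iff[OF az] by blast
  obtain v where v: "v \<in> carrier S" "v \<otimes> (\<alpha>' \<otimes> z) = \<alpha> \<otimes> z" using u' by blast
  obtain c where c: "c \<in> carrier S" "z \<otimes> c = y'"
    using green_R_iff[of y' z] b(3) zz y'S zS by blast
  obtain e where e: "e \<in> carrier S" "y \<otimes> e = y'" and e': "\<exists>d\<in>carrier S. y' \<otimes> d = y"
    using green_R_iff[OF yS y'S] yy' by blast
  obtain d where d: "d \<in> carrier S" "y' \<otimes> d = y" using e' by blast
  have ay': "\<alpha> \<otimes> y' \<in> carrier S" using a(1) y'S by simp
  have "(\<alpha> \<otimes> y, \<alpha> \<otimes> y') \<in> green_R S" by (rule green_R_left_congruence[OF monoid_axioms yy' a(1)])
  moreover have "(\<alpha> \<otimes> y, \<alpha> \<otimes> y') \<in> green_L S"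
  proof -
    have "v \<otimes> (\<alpha>' \<otimes> y') = v \<otimes> (\<alpha>' \<otimes> z) \<otimes> c"
      unfolding c(2)[symmetric] using v(1) b(1) zS c(1) by (simp add: m_assoc)
    also have "\<dots> = \<alpha> \<otimes> y'" unfolding v(2) c(2)[symmetric] using a(1) zS c(1) by (simp add: m_assoc)
    finally have 1: "v \<otimes> (\<alpha>' \<otimes> y') = \<alpha> \<otimes> y'" .
    have "u \<otimes> (\<alpha> \<otimes> y') = u \<otimes> (\<alpha> \<otimes> z) \<otimes> c"
      unfolding c(2)[symmetric] using u(1) a(1) zS c(1) by (simp add: m_assoc)
    also have "\<dots> = \<alpha>' \<otimes> y'" unfolding u(2) c(2)[symmetric] using b(1) zS c(1) by (simp add: m_assoc)
    finally have 2: "u \<otimes> (\<alpha> \<otimes> y') = \<alpha>' \<otimes> y'" .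
    have "(\<alpha>' \<otimes> y', \<alpha> \<otimes> y') \<in> green_L S"
      unfolding green_L_iff[OF H_carrier[OF b(2)] ay'] using 1 2 u(1) v(1) by blast
    moreover have "(\<alpha> \<otimes> y, \<alpha>' \<otimes> y') \<in> green_L S" using H_green[OF a(2) b(2)] by (simp add: green_H_def)
    moreover have "trans (green_L S)" using equiv_green_L[of S] by (simp add: equiv_def)
    ultimately show ?thesis by (meson transD)
  qed
  ultimately have ay'H: "\<alpha> \<otimes> y' \<in> H" by (rule H_I[OF a(2) ay'])
  have "\<alpha> \<otimes> y \<otimes> e = \<alpha> \<otimes> y'" unfolding e(2)[symmetric] using a(1) yS e(1) by (simp add: m_assoc)
  then have "e \<in> T" using T_I[OF a(2) e(1)] ay'H by simp
  moreover have "\<alpha> \<otimes> y' \<otimes> d = \<alpha> \<otimes> y" unfolding d(2)[symmetric] using a(1) y'S d(1) by (simp add: m_assoc)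
  then have "d \<in> T" using T_I[OF ay'H d(1)] a(2) by simp
  ultimately show ?thesis using trelI e(2) d(2) by blast
qed

lemma finite_states:
  assumes R: "R \<in> carrier S // green_R S" and HR: "H \<subseteq> R"
    and fin1: "finite {K \<in> carrier S // green_H S. K \<subseteq> R}"
    and fin2: "finite ({R_act S t (green_R S `` {s}) | t. t \<in> carrier S} \<inter>
           {R' \<in> carrier S // green_R S. \<exists>t\<in>carrier S. R_act S t R' = R})"
  shows "finite (state ` V)"
proof (rule finite_subset)
  let ?I = "{R_act S t (green_R S `` {s}) | t. t \<in> carrier S} \<inter>
           {R' \<in> carrier S // green_R S. \<exists>t\<in>carrier S. R_act S t R' = R}"
  let ?K = "{K \<in> carrier S // green_H S. K \<subseteq> R}"
  show "finite (?I \<times> ?K)" using fin1 fin2 by simp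
  show "state ` V \<subseteq> ?I \<times> ?K"
  proof (rule image_subsetI)
    fix y assume y: "y \<in> V"
    obtain \<alpha> z where a: "\<alpha> \<in> carrier S" "\<alpha> \<otimes> y \<in> H" "(y, z) \<in> green_R S"
      "state y = (green_R S `` {y}, green_H S `` {\<alpha> \<otimes> z})"
      by (rule state_witness[OF y])
    note yS = V_carrier[OF y]
    have cls: "green_R S `` {x} = R" if "x \<in> R" for x
    proof -
      have "x \<in> carrier S" using that R by (auto elim!: quotientE simp: green_R_def)
      then show ?thesis
        using quotient_eq_iff[OF equiv_green_R R quotientI[of x], of x x] that
          equiv_class_self[OF equiv_green_R, of x S] by (auto simp: green_R_def)
    qed
    obtain t where t: "t \<in> carrier S" "y = t \<otimes> s" using y unfolding vertices_def by blast
    have "R_act S t (green_R S `` {s}) = green_R S `` {y}"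
      unfolding t(2) by (rule R_act_class[OF monoid_axioms s t(1)])
    moreover have "R_act S \<alpha> (green_R S `` {y}) = R"
      using R_act_class[OF monoid_axioms yS a(1)] cls[of "\<alpha> \<otimes> y"] HR a(2) by auto
    moreover have "green_R S `` {y} \<in> carrier S // green_R S" using yS by (rule quotientI)
    ultimately have 1: "green_R S `` {y} \<in> ?I" using t(1) a(1) by blast
    have azR: "(\<alpha> \<otimes> y, \<alpha> \<otimes> z) \<in> green_R S" by (rule green_R_left_congruence[OF monoid_axioms a(3,1)])
    have azS: "\<alpha> \<otimes> z \<in> carrier S" using green_R_carrier[OF azR] by simp
    have "green_H S `` {\<alpha> \<otimes> z} \<subseteq> green_R S `` {\<alpha> \<otimes> z}" by (auto simp: green_H_def)
    also have "\<dots> = green_R S `` {\<alpha> \<otimes> y}" using equiv_class_eq[OF equiv_green_R azR] by simp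
    also have "\<dots> = R" using cls HR a(2) by blast
    finally have 2: "green_H S `` {\<alpha> \<otimes> z} \<in> ?K" using azS by (simp add: quotientI)
    show "state y \<in> ?I \<times> ?K" unfolding a(4) using 1 2 by simp
  qed
qed

text \<open>Once two consecutive powers have the same class, left multiplication by powers of
  \<open>s\<close> propagates this to all higher powers, in particular from \<open>n\<close> to
  \<open>n + n\<close>.\<close>

lemma idempotent_power:
  assumes fin: "finite (state ` V)"
  shows "\<exists>n>0. trel (s [^] n \<otimes> s [^] n) (s [^] (n::nat))"
proof -
  \<comment> \<open>The chain begins with \<open>s\<close> itself: the unit need not be a left
    multiple of \<open>s\<close>, hence need not be a vertex.\<close>
  have V: "s [^] Suc k \<in> V" for k
  proof -
    obtain x where "x \<in> H" using H_nonempty by blast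
    then show ?thesis using V_I[of "s [^] k" x] Hs_pow[of x "Suc k"] s H_carrier by simp
  qed
  have "\<exists>k>0. trel (s [^] Suc k) (s [^] Suc (Suc k))"
  proof (rule descending_stabilizes[OF fin state_trel, of "\<lambda>k. s [^] Suc k"])
    show "\<exists>c\<in>T. s [^] Suc k \<otimes> c = s [^] Suc (Suc k)" for k using s_T by (intro bexI[of _ s]) simp_all
  qed (use V in auto)
  then obtain k where k: "trel (s [^] Suc k) (s [^] Suc (Suc k))" by blast
  define n where "n = Suc k"
  have step: "trel (s [^] (n + j)) (s [^] (n + Suc j))" for j
  proof -
    have "trel (s [^] j \<otimes> s [^] n) (s [^] j \<otimes> s [^] Suc n)"
      by (rule trel_left) (use k s in \<open>simp_all add: n_def\<close>)
    then show ?thesis using s by (simp only: nat_pow_mult add.commute add_Suc_right add_Suc)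
  qed
  have "trel (s [^] n) (s [^] (n + j))" for j
  proof (induction j)
    case 0
    then show ?case using trel_refl s by simp
  next
    case (Suc j)
    then show ?case by (rule trel_trans[rotated 2, OF _ step]) (use s in simp_all)
  qed
  then have "trel (s [^] n \<otimes> s [^] n) (s [^] n)" using trel_sym s by (simp add: nat_pow_mult)
  then show ?thesis by (intro exI[of _ n]) (simp add: n_def)
qed

end

section \<open>Passing to a power of \<open>s\<close> and choosing the states\<close>

lemma (in pointwise_stab) state_choice_exists:
  assumes fin: "finite (state ` V)"
  shows "\<exists>s' rp. state_choice S H s' rp"
proof -
  obtain n :: nat where n: "n > 0" "trel (s [^] n \<otimes> s [^] n) (s [^] n)"
    using idempotent_power[OF fin] by blast
  define s' where "s' = s [^] n"
  have s': "s' \<in> carrier S" unfolding s'_def using s by simp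
  interpret s': pointwise_stab S H s'
    by unfold_locales (use s' Hs_pow in \<open>simp_all add: s'_def\<close>)
  \<comment> \<open>The given finiteness concerns the original \<open>s\<close>. It is inherited
    because a left multiple of \<open>s'\<close> is a left multiple of \<open>s\<close>.\<close>
  have sub: "s'.V \<subseteq> V"
  proof
    fix y assume y: "y \<in> s'.V"
    then obtain t where t: "t \<in> carrier S" "y = t \<otimes> s'" unfolding vertices_def by blast
    obtain m where m: "n = Suc m" using n(1) by (cases n) auto
    have "y = (t \<otimes> s [^] m) \<otimes> s" using t s by (simp add: s'_def m m_assoc)
    then show "y \<in> V" using y t s unfolding vertices_def by blast
  qed
  \<comment> \<open>The case distinction forces \<open>rp s' = s'\<close>. Otherwise the choice
    depends only on the class of \<open>y\<close>, because the predicate after \<open>SOME\<close>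
    does.\<close>
  define rp where "rp y = (if trel y s' then s' else SOME z. z \<in> s'.V \<and> trel y z)" for y
  have rp: "rp y \<in> s'.V \<and> trel y (rp y)" if "y \<in> s'.V" for y
  proof (cases "trel y s'")
    case True
    then show ?thesis using s'.s_V by (simp add: rp_def)
  next
    case False
    have "\<exists>z. z \<in> s'.V \<and> trel y z" using that trel_refl s'.V_carrier by blast
    from someI_ex[OF this] show ?thesis using False by (simp add: rp_def)
  qed
  have eq: "rp y = rp y'" if "y \<in> s'.V" "y' \<in> s'.V" "trel y y'" for y y'
  proof -
    have "trel y z \<longleftrightarrow> trel y' z" if "z \<in> carrier S" for z
      using trel_trans[of y z y'] trel_trans[of y' z y] trel_sym \<open>trel y y'\<close> that
        s'.V_carrier[OF \<open>y \<in> s'.V\<close>] s'.V_carrier[OF \<open>y' \<in> s'.V\<close>] by blast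
    then have "(z \<in> s'.V \<and> trel y z) = (z \<in> s'.V \<and> trel y' z)" "trel y s' = trel y' s'" for z
      using s'.V_carrier s' by blast+
    then show ?thesis by (simp add: rp_def)
  qed
  have "finite (rp ` s'.V)"
  proof -
    \<comment> \<open>Vertices with the same \<open>state\<close> have the same representative, so
      \<open>rp\<close> takes no more values than \<open>state\<close>.\<close>
    have "rp y = rp (SOME z. z \<in> s'.V \<and> state z = state y)" if "y \<in> s'.V" for y
    proof -
      have "\<exists>z. z \<in> s'.V \<and> state z = state y" using that by blast
      from someI_ex[OF this] show ?thesis
        using eq[OF that] state_trel sub that by (metis (no_types, lifting) subsetD)
    qed
    then have "rp ` s'.V \<subseteq> (\<lambda>v. rp (SOME z. z \<in> s'.V \<and> state z = v)) ` state ` V"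
      using sub by blast
    then show ?thesis using fin by (meson finite_imageI finite_subset)
  qed
  note fin' = this
  have "state_choice S H s' rp"
  proof (intro state_choice.intro state_choice_axioms.intro)
    show "pointwise_stab S H s'" by (rule s'.pointwise_stab_axioms)
    show "rp y \<in> s'.V" "trel y (rp y)" if "y \<in> s'.V" for y using rp[OF that] by simp_all
    show "rp y = rp y'" if "y \<in> s'.V" "y' \<in> s'.V" "trel y y'" for y y' by (rule eq[OF that])
    show "rp s' = s'" using trel_refl[OF s'] by (simp add: rp_def)
    show "trel (s' \<otimes> s') s'" using n(2) unfolding s'_def .
    show "finite (rp ` s'.V)" by (rule fin')
  qed
  then show ?thesis by blast
qed

lemma (in state_choice) transfer:
  fixes P :: "nat presentation"
  assumes fp: "finite_presentation P" and pres: "presents P S"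
  shows "\<exists>Q :: nat presentation. finite_presentation Q \<and> presents Q (schutzenberger_group S H) \<and>
    (presentation_FDT P \<longrightarrow> presentation_FDT Q)"
proof -
  obtain ev where ev: "ev [] = \<one> \<and>
    (\<forall>u\<in>words P. \<forall>v\<in>words P. ev (u @ v) = ev u \<otimes> ev v) \<and>
    (\<forall>u\<in>words P. ev u \<in> carrier S) \<and> (\<forall>x\<in>carrier S. \<exists>u\<in>words P. ev u = x) \<and>
    (\<forall>u\<in>words P. \<forall>v\<in>words P. ev u = ev v \<longleftrightarrow> (u, v) \<in> presentation_cong P)"
    using presents_evaluation[OF pres monoid_axioms] by (rule exE)
  obtain sw where sw: "sw \<in> words P" "ev sw = s" using ev s by meson
  obtain f :: "'a \<Rightarrow> nat" where f: "inj_on f (rp ` V)" using finite_imp_inj_to_nat_seg[OF fin] by metis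
  define enc where "enc a p \<epsilon> = prod_encode (a, prod_encode (f p, if \<epsilon> then 1 else 0))" for a p \<epsilon>
  have enc: "inj_on (\<lambda>(a, p, \<epsilon>). enc a p \<epsilon>) (letters P \<times> rp ` V \<times> UNIV)"
    using f by (auto simp: inj_on_def enc_def split: if_splits)
  interpret squier_transfer S H s rp P ev sw enc
    using fp ev sw enc by unfold_locales (simp_all add: finite_presentation_def)
  have "presentation_FDT Q" if fdt: "presentation_FDT P"
  proof -
    obtain X where X: "finite X" "homotopy_base P X" using fdt unfolding presentation_FDT_def by blast
    interpret squier_fdt S H s rp P ev sw enc X by unfold_locales (rule X(2))
    have "finite (letters P)" using fp by (simp add: finite_presentation_def)
    then show ?thesis unfolding presentation_FDT_def using homotopy_base_Q Y_finite[OF X(1)] by blast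
  qed
  then show ?thesis using Q_finite[OF fp] presents_Q by blast
qed

theorem theorem1:
  fixes S :: "('a, 'm) monoid_scheme" and H R :: "'a set" and s :: 'a
  assumes "monoid S"
    and "H \<in> carrier S // green_H S"
    and "R \<in> carrier S // green_R S" and "H \<subseteq> R"
    and "s \<in> carrier S" and "\<forall>x\<in>H. x \<otimes>\<^bsub>S\<^esub> s = x"
    and "finite {K \<in> carrier S // green_H S. K \<subseteq> R}"
    and "finite ({R_act S t (green_R S `` {s}) | t. t \<in> carrier S} \<inter>
           {R' \<in> carrier S // green_R S. \<exists>t\<in>carrier S. R_act S t R' = R})"
  shows "(finitely_presented S \<longrightarrow> finitely_presented (schutzenberger_group S H)) \<and>
         (monoid_FDT S \<longrightarrow> monoid_FDT (schutzenberger_group S H))"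
proof -
  interpret monoid S by fact
  interpret pointwise_stab S H s
    by unfold_locales (use assms in simp_all)
  obtain s' rp where "state_choice S H s' rp"
    using state_choice_exists[OF finite_states[OF assms(3,4,7,8)]] by blast
  then interpret c: state_choice S H s' rp .
  show ?thesis
    unfolding finitely_presented_def monoid_FDT_def using c.transfer by blast
qed

end
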